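(* Let $M=S^n$ be the unit sphere in $\mathbb{R}^{n+1}$ with the induced metric and let $\widehat M=\mathbb{R}^n$ with the Euclidean metric. Then the rank $n$ distribution $D$ on $Q$ describing the intrinsic rollings (without twisting or slipping) of $S^n$ on $\mathbb{R}^n$ is a regular bracket generating distribution of step 3. Consequently the system of rolling $S^n$ over $\mathbb{R}^n$ is completely controllable: for any $q_0,q_1\in Q$ there is an intrinsic rolling $q:[0,\tau]\to Q$ with $q(0)=q_0$ and $q(\tau)=q_1$.
   Context: For oriented connected $n$-dimensional Riemannian manifolds $M,\widehat M$, $Q=\{q\in\mathrm{Isom}_0^+(T_xM,T_{\widehat x}\widehat M): x\in M,\widehat x\in\widehat M\}$, where $\mathrm{Isom}_0^+$ denotes linear orientation preserving isometries; $Q$ is a manifold of dimension $n(n+3)/2$. An intrinsic rolling is an absolutely continuous curve $q:[0,\tau]\to Q$ with projections $x(t),\widehat x(t)$ to $M,\widehat M$ such that (I') $\dot{\widehat x}(t)=q(t)\dot x(t)$ for almost all $t$; (II') a tangent vector field $Z(t)$ is parallel along $x(t)$ if and only if $q(t)Z(t)$ is parallel along $\widehat x(t)$. Intrinsic rollings are exactly the absolutely continuous curves with $\dot q(t)\in D_{q(t)}$ for a.e. $t$, where $D$ is the following distribution. For open $U\subset M$, $\widehat U\subset\widehat M$ with positively oriented orthonormal frames $\{e_j\}$ and $\{\hat e_i\}$, trivialize $q\mapsto(x,\widehat x,A)\in U\times\widehat U\times\mathrm{SO}(n)$, $A=(a_{ij})=(\langle qe_j,\hat e_i\rangle)$. Then,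 in the splitting $TU\times T\widehat U\times T\mathrm{SO}(n)$, $$D_q=\left\{X_0+qX_0+\sum_{i<j}(\langle\nabla_{X_0}e_j,e_i\rangle-\langle\nabla_{qX_0}qe_j,qe_i\rangle)W_{ij}(A): X_0\in T_xM\right\},$$ with $W_{ij}(A)=\sum_r(a_{ri}\frac{\partial}{\partial a_{rj}}-a_{rj}\frac{\partial}{\partial a_{ri}})$, $\nabla$ the Levi-Civita connection (of $M$ or $\widehat M$), and $qe_j$ standing, in $\nabla_{qX_0}qe_j$, for the local field $\sum_s a_{sj}\hat e_s$ with constant coefficients $a_{sj}$. The flag of $D$ is $D^1=D$, $D^{i+1}=D+[D,D^i]$. $D$ has step $k\ge2$ at $q$ if $k$ is the maximal integer with $D^{k-1}_q\subsetneq D^k_q=D^{k+1}_q$, and step 1 at $q$ if $D^k_q=D_q$ for every $k$; $D$ has step $k$ if it has step $k$ at every $q\in Q$. $D$ is bracket generating if $D^k=TQ$ for some $k$. Regular is meant in the usual sense that the dimensions of the spaces $D^i_q$ do not depend on $q$.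
   Formalization: The formal theorem assumes n ≥ 2; for n = 1 the claim fails, since Q then has dimension 2 and D has rank 1, so D is integrable, not bracket generating, and rolling is not controllable. *)

theory Defs
  imports "HOL-Analysis.Analysis"
begin

section \<open>Smooth maps, absolutely continuous curves\<close>

primrec Ck_on :: "nat \<Rightarrow> 'a::real_normed_vector set \<Rightarrow> ('a \<Rightarrow> 'b::real_normed_vector) \<Rightarrow> bool" where
  "Ck_on 0 S f \<longleftrightarrow> continuous_on S f"
| "Ck_on (Suc k) S f \<longleftrightarrow>
     (\<forall>x\<in>S. f differentiable (at x)) \<and> (\<forall>v. Ck_on k S (\<lambda>x. frechet_derivative f (at x) v))"

text \<open>Only used for open sets in finite-dimensional spaces.\<close>

definition smooth_on :: "'a::real_normed_vector set \<Rightarrow> ('a \<Rightarrow> 'b::real_normed_vector) \<Rightarrow> bool" where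
  "smooth_on S f \<longleftrightarrow> (\<forall>k. Ck_on k S f)"

definition absolutely_continuous_curve :: "real \<Rightarrow> (real \<Rightarrow> 'a::metric_space) \<Rightarrow> bool" where
  "absolutely_continuous_curve \<tau> f \<longleftrightarrow>
     (\<forall>\<epsilon>>0. \<exists>\<delta>>0. \<forall>(m::nat) s t.
        (\<forall>i<m. 0 \<le> s i \<and> s i \<le> t i \<and> t i \<le> \<tau>) \<and>
        (\<forall>i<m. \<forall>j<m. i \<noteq> j \<longrightarrow> {s i<..<t i} \<inter> {s j<..<t j} = {}) \<and>
        (\<Sum>i<m. t i - s i) < \<delta>
        \<longrightarrow> (\<Sum>i<m. dist (f (s i)) (f (t i))) < \<epsilon>)"


section \<open>Riemannian submanifolds of Euclidean space\<close>

text \<open>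
  Manifolds are embedded submanifolds of Euclidean spaces, with the induced metric. Smooth fields
  on an open subset of a submanifold are represented by smooth maps on an open subset of the
  ambient space; only their values on the submanifold matter.
\<close>

definition tangent_space :: "'a::real_normed_vector set \<Rightarrow> 'a \<Rightarrow> 'a set" where
  "tangent_space M p =
     {v. \<exists>\<gamma> \<epsilon>. \<epsilon> > 0 \<and> smooth_on {-\<epsilon><..<\<epsilon>} \<gamma> \<and> \<gamma> ` {-\<epsilon><..<\<epsilon>} \<subseteq> M \<and>
              \<gamma> (0::real) = p \<and> (\<gamma> has_vector_derivative v) (at 0)}"

definition orthogonal_projection :: "'a::real_inner set \<Rightarrow> 'a \<Rightarrow> 'a" where
  "orthogonal_projection V v = (THE w. w \<in> V \<and> (\<forall>u\<in>V. orthogonal (v - w) u))"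

text \<open>
  The Levi-Civita connection of the metric induced on a submanifold is the tangential part of
  the ambient directional derivative: \<open>levi_civita M X0 Y p\<close> is \<open>\<nabla>\<close> of \<open>Y\<close> at \<open>p\<close> in the
  direction \<open>X0\<close>, for a tangent vector \<open>X0\<close> at \<open>p\<close>.
\<close>

definition levi_civita ::
    "'a::euclidean_space set \<Rightarrow> 'a \<Rightarrow> ('a \<Rightarrow> 'a) \<Rightarrow> 'a \<Rightarrow> 'a" where
  "levi_civita M X0 Y p =
     orthogonal_projection (tangent_space M p) (frechet_derivative Y (at p) X0)"

text \<open>
  Parallel fields along an absolutely continuous curve: absolutely continuous tangent fields whose
  covariant derivative along the curve vanishes almost everywhere.
\<close>

definition tangent_field_along ::
    "'a::euclidean_space set \<Rightarrow> real \<Rightarrow> (real \<Rightarrow> 'a) \<Rightarrow> (real \<Rightarrow> 'a) \<Rightarrow> bool" where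
  "tangent_field_along M \<tau> x Z \<longleftrightarrow> (\<forall>t\<in>{0..\<tau>}. Z t \<in> tangent_space M (x t))"

definition parallel_along ::
    "'a::euclidean_space set \<Rightarrow> real \<Rightarrow> (real \<Rightarrow> 'a) \<Rightarrow> (real \<Rightarrow> 'a) \<Rightarrow> bool" where
  "parallel_along M \<tau> x Z \<longleftrightarrow>
     tangent_field_along M \<tau> x Z \<and> absolutely_continuous_curve \<tau> Z \<and>
     (AE t in lborel. t \<in> {0..\<tau>} \<longrightarrow>
        (\<exists>w. (Z has_vector_derivative w) (at t within {0..\<tau>}) \<and>
             orthogonal_projection (tangent_space M (x t)) w = 0))"

text \<open>
  An orientation says which families \<open>b\<close> of \<open>n\<close> vectors are positively oriented bases of the
  tangent space at a given point. The sphere is oriented by the outward normal.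
\<close>

type_synonym ('m, 'n) orientation = "real^'m \<Rightarrow> ('n \<Rightarrow> real^'m) \<Rightarrow> bool"

definition euclidean_orientation :: "('n::finite, 'n) orientation" where
  "euclidean_orientation y b \<longleftrightarrow> det (\<chi> i. b i) > 0"

text \<open>The Euclidean space of dimension \<open>n + 1\<close> is \<open>real^('n option)\<close>, with \<open>None\<close> as first index.\<close>

definition sphere_orientation :: "('n::finite option, 'n) orientation" where
  "sphere_orientation x b \<longleftrightarrow>
     (\<forall>i. b i \<in> tangent_space (sphere 0 1) x) \<and>
     det (\<chi> a. case a of None \<Rightarrow> x | Some i \<Rightarrow> b i) > 0"


section \<open>The configuration space and intrinsic rollings\<close>

text \<open>
  A point \<open>(x, y, A)\<close> stands for the linear map from the tangent space of \<open>M\<close> at \<open>x\<close> to that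
  of \<open>N\<close> at \<open>y\<close> obtained by restricting the matrix \<open>A\<close>. Requiring \<open>A\<close> to vanish on the normal
  space at \<open>x\<close> makes the representation unique, so that the configuration space is an embedded
  submanifold of a Euclidean space.
\<close>

type_synonym ('m, 'k) config = "(real^'m) \<times> (real^'k) \<times> (real^'m^'k)"

definition config_space ::
    "(real^'m) set \<Rightarrow> ('m::finite, 'n) orientation \<Rightarrow> (real^'k) set \<Rightarrow> ('k::finite, 'n) orientation
     \<Rightarrow> ('m, 'k) config set" where
  "config_space M oM N oN =
     {(x, y, A). x \<in> M \<and> y \<in> N \<and>
        (*v) A ` tangent_space M x = tangent_space N y \<and>
        (\<forall>u\<in>tangent_space M x. \<forall>v\<in>tangent_space M x. (A *v u) \<bullet> (A *v v) = u \<bullet> v) \<and>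
        (\<forall>b. (\<forall>i. b i \<in> tangent_space M x) \<and> oM x b \<longrightarrow> oN y (\<lambda>i. A *v b i)) \<and>
        (\<forall>w. (\<forall>v\<in>tangent_space M x. orthogonal w v) \<longrightarrow> A *v w = 0)}"

definition intrinsic_rolling ::
    "(real^'m) set \<Rightarrow> ('m::finite, 'n) orientation \<Rightarrow> (real^'k) set \<Rightarrow> ('k::finite, 'n) orientation
     \<Rightarrow> real \<Rightarrow> (real \<Rightarrow> ('m, 'k) config) \<Rightarrow> bool" where
  "intrinsic_rolling M oM N oN \<tau> q \<longleftrightarrow>
     absolutely_continuous_curve \<tau> q \<and>
     (\<forall>t\<in>{0..\<tau>}. q t \<in> config_space M oM N oN) \<and>
     (let x = \<lambda>t. fst (q t); y = \<lambda>t. fst (snd (q t)); A = \<lambda>t. snd (snd (q t)) in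
        (AE t in lborel. t \<in> {0..\<tau>} \<longrightarrow>
           (\<exists>v. (x has_vector_derivative v) (at t within {0..\<tau>}) \<and>
                (y has_vector_derivative (A t *v v)) (at t within {0..\<tau>}))) \<and>
        (\<forall>Z. tangent_field_along M \<tau> x Z \<longrightarrow>
           (parallel_along M \<tau> x Z \<longleftrightarrow> parallel_along N \<tau> y (\<lambda>t. A t *v Z t))))"

definition completely_controllable ::
    "(real^'m) set \<Rightarrow> ('m::finite, 'n) orientation \<Rightarrow> (real^'k) set \<Rightarrow> ('k::finite, 'n) orientation
     \<Rightarrow> bool" where
  "completely_controllable M oM N oN \<longleftrightarrow>
     (\<forall>q0\<in>config_space M oM N oN. \<forall>q1\<in>config_space M oM N oN.
        \<exists>\<tau>>0. \<exists>q. intrinsic_rolling M oM N oN \<tau> q \<and> q 0 = q0 \<and> q \<tau> = q1)"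


section \<open>The rolling distribution\<close>

text \<open>Positively oriented orthonormal frames on the open subset \<open>M \<inter> U\<close> of \<open>M\<close>.\<close>

definition oriented_frame ::
    "(real^'m) set \<Rightarrow> ('m::finite, 'n) orientation \<Rightarrow> (real^'m) set \<Rightarrow> ('n \<Rightarrow> real^'m \<Rightarrow> real^'m) \<Rightarrow> bool"
  where
  "oriented_frame M oM U e \<longleftrightarrow>
     open U \<and> (\<forall>j. smooth_on U (e j)) \<and>
     (\<forall>p\<in>M \<inter> U. (\<forall>j. e j p \<in> tangent_space M p) \<and>
                  (\<forall>i j. e i p \<bullet> e j p = (if i = j then 1 else 0)) \<and>
                  oM p (\<lambda>j. e j p))"

definition frame_matrix ::
    "('n \<Rightarrow> real^'m \<Rightarrow> real^'m) \<Rightarrow> ('n \<Rightarrow> real^'k \<Rightarrow> real^'k) \<Rightarrow> ('m::finite, 'k::finite) config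
     \<Rightarrow> real^'n::finite^'n" where
  "frame_matrix e e' = (\<lambda>(x, y, A). \<chi> i j. (A *v e j x) \<bullet> e' i y)"

definition trivialization ::
    "('n \<Rightarrow> real^'m \<Rightarrow> real^'m) \<Rightarrow> ('n \<Rightarrow> real^'k \<Rightarrow> real^'k) \<Rightarrow> ('m::finite, 'k::finite) config
     \<Rightarrow> (real^'m) \<times> (real^'k) \<times> (real^'n::finite^'n)" where
  "trivialization e e' q = (fst q, fst (snd q), frame_matrix e e' q)"

text \<open>The coordinate field \<open>\<partial>/\<partial>a\<^sub>r\<^sub>j\<close> is the matrix unit \<open>axis r (axis j 1)\<close> (row \<open>r\<close>, column \<open>j\<close>).\<close>

definition W_field :: "'n \<Rightarrow> 'n \<Rightarrow> real^'n^'n \<Rightarrow> real^'n::finite^'n" where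
  "W_field i j a =
     (\<Sum>r\<in>UNIV. (a $ r $ i) *\<^sub>R axis r (axis j 1) - (a $ r $ j) *\<^sub>R axis r (axis i 1))"

text \<open>
  The element of the splitting \<open>TU \<times> TU' \<times> TSO(n)\<close> determined by \<open>X0\<close>. In the second
  covariant derivative, \<open>qe\<^sub>j\<close> is the field with constant coefficients in the frame \<open>e'\<close>.
\<close>

definition rolling_vector ::
    "(real^'m) set \<Rightarrow> (real^'k) set \<Rightarrow> ('n \<Rightarrow> real^'m \<Rightarrow> real^'m) \<Rightarrow> ('n \<Rightarrow> real^'k \<Rightarrow> real^'k)
     \<Rightarrow> ('m::finite, 'k::finite) config \<Rightarrow> real^'m
     \<Rightarrow> (real^'m) \<times> (real^'k) \<times> (real^'n::{finite,linorder}^'n::{finite,linorder})" where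
  "rolling_vector M N e e' q X0 =
     (let x = fst q; y = fst (snd q); A = snd (snd q); a = frame_matrix e e' q;
          qe = (\<lambda>j y'. \<Sum>s\<in>UNIV. (a $ s $ j) *\<^sub>R e' s y')
      in (X0, A *v X0,
          \<Sum>(i, j)\<in>{(i, j). i < j}.
            (levi_civita M X0 (e j) x \<bullet> e i x - levi_civita N (A *v X0) (qe j) y \<bullet> (A *v e i x))
              *\<^sub>R W_field i j a))"

text \<open>
  A tangent vector of the configuration space belongs to the distribution if its image under the
  derivative of a trivialization has the form above; this does not depend on the frames.
\<close>

definition rolling_distribution ::
    "(real^'m) set \<Rightarrow> ('m::finite, 'n::{finite,linorder}) orientation
     \<Rightarrow> (real^'k) set \<Rightarrow> ('k::finite, 'n) orientation
     \<Rightarrow> ('m, 'k) config \<Rightarrow> ('m, 'k) config set" where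
  "rolling_distribution M oM N oN q =
     {\<eta> \<in> tangent_space (config_space M oM N oN) q.
        \<exists>U U' e e' X0.
          oriented_frame M oM U e \<and> oriented_frame N oN U' e' \<and>
          fst q \<in> U \<and> fst (snd q) \<in> U' \<and> X0 \<in> tangent_space M (fst q) \<and>
          frechet_derivative (trivialization e e') (at q) \<eta> = rolling_vector M N e e' q X0}"


section \<open>Distributions on a submanifold and their flags\<close>

definition smooth_distribution ::
    "'a::euclidean_space set \<Rightarrow> ('a \<Rightarrow> 'a set) \<Rightarrow> nat \<Rightarrow> bool" where
  "smooth_distribution Q D r \<longleftrightarrow>
     (\<forall>p\<in>Q. subspace (D p) \<and> D p \<subseteq> tangent_space Q p \<and> dim (D p) = r) \<and>
     (\<forall>p\<in>Q. \<exists>W X. open W \<and> p \<in> W \<and> (\<forall>i<r. smooth_on W (X i)) \<and>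
        (\<forall>p'\<in>Q \<inter> W. D p' = span ((\<lambda>i. X i p') ` {..<r})))"

text \<open>
  On \<open>Q\<close>, the bracket of fields tangent to \<open>Q\<close> depends only on their restrictions to \<open>Q\<close> and is
  their bracket as vector fields on \<open>Q\<close>.
\<close>

definition lie_bracket :: "('a::real_normed_vector \<Rightarrow> 'a) \<Rightarrow> ('a \<Rightarrow> 'a) \<Rightarrow> 'a \<Rightarrow> 'a" where
  "lie_bracket Y Z p = frechet_derivative Z (at p) (Y p) - frechet_derivative Y (at p) (Z p)"

text \<open>
  \<open>flag_section Q D W k\<close>: the local sections over \<open>Q \<inter> W\<close> of \<open>D\<^sup>k\<close>, where \<open>D\<^sup>1 = D\<close> and
  \<open>D\<^sup>k\<^sup>+\<^sup>1 = D + [D, D\<^sup>k]\<close>, i.e. finite sums of sections of \<open>D\<close> and brackets.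
\<close>

inductive flag_section ::
    "'a::euclidean_space set \<Rightarrow> ('a \<Rightarrow> 'a set) \<Rightarrow> 'a set \<Rightarrow> nat \<Rightarrow> ('a \<Rightarrow> 'a) \<Rightarrow> bool"
  for Q D W where
  section_of_D:
    "1 \<le> k \<Longrightarrow> smooth_on W X \<Longrightarrow> (\<And>p. p \<in> Q \<inter> W \<Longrightarrow> X p \<in> D p) \<Longrightarrow> flag_section Q D W k X"
| bracket:
    "flag_section Q D W 1 Y \<Longrightarrow> flag_section Q D W k Z \<Longrightarrow>
     flag_section Q D W (Suc k) (lie_bracket Y Z)"
| sum:
    "flag_section Q D W k X \<Longrightarrow> flag_section Q D W k Y \<Longrightarrow> flag_section Q D W k (\<lambda>p. X p + Y p)"

definition flag ::
    "'a::euclidean_space set \<Rightarrow> ('a \<Rightarrow> 'a set) \<Rightarrow> nat \<Rightarrow> 'a \<Rightarrow> 'a set" where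
  "flag Q D k q = {X q | X W. open W \<and> q \<in> W \<and> flag_section Q D W k X}"

definition regular_distribution :: "'a::euclidean_space set \<Rightarrow> ('a \<Rightarrow> 'a set) \<Rightarrow> bool" where
  "regular_distribution Q D \<longleftrightarrow>
     (\<forall>k\<ge>1. \<forall>p\<in>Q. \<forall>q\<in>Q. dim (flag Q D k p) = dim (flag Q D k q))"

definition bracket_generating :: "'a::euclidean_space set \<Rightarrow> ('a \<Rightarrow> 'a set) \<Rightarrow> bool" where
  "bracket_generating Q D \<longleftrightarrow> (\<exists>k\<ge>1. \<forall>q\<in>Q. flag Q D k q = tangent_space Q q)"

definition has_step_at :: "'a::euclidean_space set \<Rightarrow> ('a \<Rightarrow> 'a set) \<Rightarrow> nat \<Rightarrow> 'a \<Rightarrow> bool" where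
  "has_step_at Q D k q \<longleftrightarrow>
     (let stops = (\<lambda>l. 2 \<le> l \<and> flag Q D (l - 1) q \<subset> flag Q D l q \<and>
                       flag Q D l q = flag Q D (l + 1) q)
      in (stops k \<and> (\<forall>l. stops l \<longrightarrow> l \<le> k)) \<or>
         (k = 1 \<and> (\<forall>l\<ge>1. flag Q D l q = D q)))"

definition has_step :: "'a::euclidean_space set \<Rightarrow> ('a \<Rightarrow> 'a set) \<Rightarrow> nat \<Rightarrow> bool" where
  "has_step Q D k \<longleftrightarrow> (\<forall>q\<in>Q. has_step_at Q D k q)"

end

theory Submission
  imports Defs
begin

text \<open>
  Stacking \<open>x\<close> on top of the rows of \<open>A\<close> identifies the configuration space with
  \<open>SO(n + 1) \<times> \<real>\<^sup>n\<close>, and \<open>D\<close> becomes the right-invariant distribution spanned by the fields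
  \<open>((e\<^sub>0 u\<^sup>T - u e\<^sub>0\<^sup>T) R, u)\<close>, which are affine in the ambient space. In these coordinates a velocity
  belongs to \<open>D\<close> iff its \<open>A\<close>-component kills the tangent space of the sphere, because the connection
  terms in the trivialization cancel. One bracket yields the rotations \<open>(u v\<^sup>T - v u\<^sup>T) A\<close>
  (twisting), a second one, for \<open>n \<ge> 2\<close>, the remaining directions (slipping). Upper bounds for the
  flag follow by differentiating the constraints \<open>R R\<^sup>T = 1\<close> and \<open>x' = A\<^sup>T y'\<close> along the sections.

  Controllability needs no orbit theorem: rolling along a straight segment of length \<open>2\<pi>\<close> is a pure
  translation, such translations generate all of \<open>\<real>\<^sup>n\<close>, and after correcting by them the straight
  rollings give all rotations in planes containing \<open>e\<^sub>0\<close>, which generate \<open>SO(n + 1)\<close>.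
\<close>


section \<open>Calculus of smooth maps\<close>

text \<open>Only the values of a flag section on the configuration space are prescribed, so away
  from it a section cannot be expanded in the model fields. The two bounds for the flag therefore
  use different means. Lower bounds come from globally defined fields with explicit brackets. Upper
  bounds see a section only through its derivatives in tangent directions, and
  \<open>D\<^sup>2\<close> is singled out by a pointwise linear condition, the absence of slipping.
  Leaving it by a second bracket requires a unit vector orthogonal to the intended slip, which is
  where \<open>n \<ge> 2\<close> enters; the same kind of vector splits a translation into full
  turns.

  An intrinsic rolling is tested against all parallel fields, which are merely absolutely
  continuous. Controllability is first proved for Lipschitz curves tangent to \<open>D\<close>
  outside finitely many times, which can be concatenated; the test is carried out once for all of
  them. The length \<open>2\<pi>\<close> is the circumference of a great circle of the unit sphere:
  after that distance the sphere has its initial attitude again.\<close>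

lemma Ck_on_cong:
  assumes "open S" "\<And>x. x \<in> S \<Longrightarrow> f x = g x" "Ck_on k S f"
  shows "Ck_on k S g"
  using assms(2,3)
proof (induction k arbitrary: f g)
  case 0
  then show ?case by (auto cong: continuous_on_cong)
next
  case (Suc k)
  have der: "(g has_derivative frechet_derivative f (at x)) (at x)" if "x \<in> S" for x
    using Suc.prems that
    by (auto simp: frechet_derivative_works[symmetric]
        intro: has_derivative_transform_within_open[OF iffD1[OF frechet_derivative_works] assms(1) that])
  then have eq: "frechet_derivative g (at x) = frechet_derivative f (at x)" if "x \<in> S" for x
    using frechet_derivative_at[OF der[OF that]] by simp
  have "Ck_on k S (\<lambda>x. frechet_derivative g (at x) v)" for v
    by (rule Suc.IH[of "\<lambda>x. frechet_derivative f (at x) v"]) (use Suc.prems(2) eq in auto)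
  moreover have "\<forall>x\<in>S. g differentiable at x"
    using der unfolding differentiable_def by blast
  ultimately show ?case by simp
qed

text \<open>\<open>Ck_on\<close> is phrased with \<open>frechet_derivative\<close>; this rule
  accepts any formula for the derivative, so that the differentiation rules can be used inside an
  induction on \<open>k\<close>.\<close>

lemma Ck_on_SucI:
  assumes "open S" "\<And>x. x \<in> S \<Longrightarrow> (f has_derivative f' x) (at x)"
    and "\<And>v. Ck_on k S (\<lambda>x. f' x v)"
  shows "Ck_on (Suc k) S f"
proof -
  have "frechet_derivative f (at x) = f' x" if "x \<in> S" for x
    using frechet_derivative_at[OF assms(2)[OF that]] by simp
  then show ?thesis
    using assms by (auto simp: differentiable_def intro!: Ck_on_cong[OF assms(1) _ assms(3)])
qed

lemma Ck_on_weaken: "Ck_on (Suc k) S f \<Longrightarrow> Ck_on k S f"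
proof (induction k arbitrary: f)
  case 0
  then show ?case
    by (auto intro!: continuous_at_imp_continuous_on differentiable_imp_continuous_within)
qed auto

lemma Ck_on_const: "open S \<Longrightarrow> Ck_on k S (\<lambda>x. c)"
proof (induction k arbitrary: c)
  case (Suc k)
  then show ?case by (intro Ck_on_SucI[where f' = "\<lambda>_ _. 0"]) auto
qed auto

lemma Ck_on_linear:
  assumes "open S" "bounded_linear f"
  shows "Ck_on k S f"
proof (cases k)
  case 0
  then show ?thesis using assms by (simp add: linear_continuous_on)
next
  case (Suc l)
  show ?thesis unfolding Suc
    using assms by (intro Ck_on_SucI[where f' = "\<lambda>_. f"] Ck_on_const bounded_linear_imp_has_derivative)
qed

lemma Ck_on_add:
  assumes "open S" "Ck_on k S f" "Ck_on k S g"
  shows "Ck_on k S (\<lambda>x. f x + g x)"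
  using assms(2,3)
proof (induction k arbitrary: f g)
  case 0
  then show ?case by (auto intro: continuous_on_add)
next
  case (Suc k)
  then show ?case
    by (intro Ck_on_SucI[OF assms(1), where f' = "\<lambda>x v. frechet_derivative f (at x) v + frechet_derivative g (at x) v"])
       (auto intro!: has_derivative_add simp: frechet_derivative_works[symmetric])
qed

text \<open>The product rule yields a sum of two expressions of the same bilinear shape, so the
  induction closes. Products of reals, scalings, inner products and matrix products are all
  instances.\<close>

lemma Ck_on_bilinear:
  assumes "open S" "bounded_bilinear h" "Ck_on k S f" "Ck_on k S g"
  shows "Ck_on k S (\<lambda>x. h (f x) (g x))"
  using assms(3,4)
proof (induction k arbitrary: f g)
  case 0
  then show ?case using bounded_bilinear.continuous_on[OF assms(2)] by auto
next
  case (Suc k)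
  note weak = Ck_on_weaken[OF Suc.prems(1)] Ck_on_weaken[OF Suc.prems(2)]
  show ?case
  proof (rule Ck_on_SucI[OF assms(1)])
    show "((\<lambda>x. h (f x) (g x)) has_derivative
        (\<lambda>v. h (f x) (frechet_derivative g (at x) v) + h (frechet_derivative f (at x) v) (g x))) (at x)"
      if "x \<in> S" for x
      using Suc.prems that
      by (intro bounded_bilinear.FDERIV[OF assms(2)]) (auto simp: frechet_derivative_works[symmetric])
    show "Ck_on k S (\<lambda>x. h (f x) (frechet_derivative g (at x) v) + h (frechet_derivative f (at x) v) (g x))" for v
      using Suc weak by (intro Ck_on_add assms(1) Suc.IH) auto
  qed
qed

lemma Ck_on_inverse:
  fixes f :: "'a::real_normed_vector \<Rightarrow> real"
  assumes "open S" "\<And>x. x \<in> S \<Longrightarrow> f x \<noteq> 0" "Ck_on k S f"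
  shows "Ck_on k S (\<lambda>x. inverse (f x))"
  using assms(3)
proof (induction k)
  case 0
  then show ?case using assms by (auto intro!: continuous_on_inverse)
next
  case (Suc k)
  have IH: "Ck_on k S (\<lambda>x. inverse (f x))"
    using Suc Ck_on_weaken by blast
  have *: "Ck_on k S (\<lambda>x. frechet_derivative f (at x) v)" for v
    using Suc.prems by auto
  show ?case
  proof (rule Ck_on_SucI[OF assms(1)])
    show "((\<lambda>x. inverse (f x)) has_derivative
        (\<lambda>v. - (inverse (f x) * frechet_derivative f (at x) v * inverse (f x)))) (at x)" if "x \<in> S" for x
      using Suc.prems that assms(2) by (intro Deriv.has_derivative_inverse) (auto simp: frechet_derivative_works[symmetric])
    have "Ck_on k S (\<lambda>x. - 1 * (inverse (f x) * frechet_derivative f (at x) v * inverse (f x)))" for v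
      by (intro Ck_on_bilinear[OF assms(1) bounded_bilinear_mult] IH * Ck_on_const assms(1))
    then show "Ck_on k S (\<lambda>x. - (inverse (f x) * frechet_derivative f (at x) v * inverse (f x)))" for v
      by simp
  qed
qed

text \<open>The two claims go through the induction together, since each function is, up to a
  factor, the derivative of the other.\<close>

lemma Ck_on_sin_cos:
  fixes c :: real
  assumes "open S"
  shows "Ck_on k S (\<lambda>t. sin (c * t)) \<and> Ck_on k S (\<lambda>t. cos (c * t))"
proof (induction k)
  case 0
  then show ?case by (auto intro!: continuous_intros)
next
  case (Suc k)
  have "Ck_on k S (\<lambda>t. (v * c) * cos (c * t))" "Ck_on k S (\<lambda>t. (- v * c) * sin (c * t))" for v
    using Suc by (intro Ck_on_bilinear[OF assms bounded_bilinear_mult] Ck_on_const assms; simp)+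
  then show ?case
    by (intro conjI Ck_on_SucI[OF assms, where f' = "\<lambda>t v. (v * c) * cos (c * t)"]
        Ck_on_SucI[OF assms, where f' = "\<lambda>t v. (- v * c) * sin (c * t)"])
      (auto intro!: derivative_eq_intros simp: algebra_simps)
qed

lemma smooth_on_cong:
  "open S \<Longrightarrow> smooth_on S f \<Longrightarrow> (\<And>x. x \<in> S \<Longrightarrow> f x = g x) \<Longrightarrow> smooth_on S g"
  unfolding smooth_on_def using Ck_on_cong by blast

lemma smooth_on_const: "open S \<Longrightarrow> smooth_on S (\<lambda>x. c)"
  unfolding smooth_on_def by (simp add: Ck_on_const)

lemma smooth_on_linear: "open S \<Longrightarrow> bounded_linear f \<Longrightarrow> smooth_on S f"
  unfolding smooth_on_def by (simp add: Ck_on_linear)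

lemma smooth_on_add:
  "open S \<Longrightarrow> smooth_on S f \<Longrightarrow> smooth_on S g \<Longrightarrow> smooth_on S (\<lambda>x. f x + g x)"
  unfolding smooth_on_def by (simp add: Ck_on_add)

lemma smooth_on_bilinear:
  "open S \<Longrightarrow> bounded_bilinear h \<Longrightarrow> smooth_on S f \<Longrightarrow> smooth_on S g \<Longrightarrow>
    smooth_on S (\<lambda>x. h (f x) (g x))"
  unfolding smooth_on_def by (simp add: Ck_on_bilinear)

lemma smooth_on_inverse:
  fixes f :: "'a::real_normed_vector \<Rightarrow> real"
  shows "open S \<Longrightarrow> smooth_on S f \<Longrightarrow> (\<And>x. x \<in> S \<Longrightarrow> f x \<noteq> 0) \<Longrightarrow> smooth_on S (\<lambda>x. inverse (f x))"
  unfolding smooth_on_def by (simp add: Ck_on_inverse)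

lemma smooth_on_sin: "open S \<Longrightarrow> smooth_on S (\<lambda>t. sin (c * t :: real))"
  and smooth_on_cos: "open S \<Longrightarrow> smooth_on S (\<lambda>t. cos (c * t :: real))"
  unfolding smooth_on_def by (simp_all add: Ck_on_sin_cos)

lemma smooth_on_minus: "open S \<Longrightarrow> smooth_on S f \<Longrightarrow> smooth_on S (\<lambda>x. - f x)"
  using smooth_on_bilinear[OF _ bounded_bilinear_scaleR smooth_on_const[of S "-1"]] by simp

lemma smooth_on_diff:
  "open S \<Longrightarrow> smooth_on S f \<Longrightarrow> smooth_on S g \<Longrightarrow> smooth_on S (\<lambda>x. f x - g x)"
  using smooth_on_add[of S f "\<lambda>x. - g x"] by (simp add: smooth_on_minus)

lemma smooth_on_scaleR:
  "open S \<Longrightarrow> smooth_on S f \<Longrightarrow> smooth_on S g \<Longrightarrow> smooth_on S (\<lambda>x. f x *\<^sub>R g x)"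
  by (rule smooth_on_bilinear[OF _ bounded_bilinear_scaleR])

lemma smooth_on_sum:
  "finite I \<Longrightarrow> open S \<Longrightarrow> (\<And>i. i \<in> I \<Longrightarrow> smooth_on S (f i)) \<Longrightarrow> smooth_on S (\<lambda>x. \<Sum>i\<in>I. f i x)"
  by (induction I rule: finite_induct) (auto intro: smooth_on_const smooth_on_add)

lemma smooth_on_subset: "smooth_on S f \<Longrightarrow> T \<subseteq> S \<Longrightarrow> smooth_on T f"
proof -
  have "Ck_on k S f \<Longrightarrow> T \<subseteq> S \<Longrightarrow> Ck_on k T f" for k
    by (induction k arbitrary: f) (auto intro: continuous_on_subset)
  then show "smooth_on S f \<Longrightarrow> T \<subseteq> S \<Longrightarrow> smooth_on T f"
    unfolding smooth_on_def by blast
qed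

lemma smooth_on_imp_has_derivative:
  assumes "smooth_on S f" "x \<in> S"
  shows "(f has_derivative frechet_derivative f (at x)) (at x)"
proof -
  have "Ck_on (Suc 0) S f" using assms unfolding smooth_on_def by blast
  then show ?thesis using assms(2) by (simp add: frechet_derivative_works[symmetric])
qed

lemma smooth_on_frechet_derivative:
  "smooth_on S f \<Longrightarrow> smooth_on S (\<lambda>x. frechet_derivative f (at x) v)"
  unfolding smooth_on_def using Ck_on.simps(2) by blast

text \<open>Smoothness controls derivatives in fixed directions only; a variable direction is
  expanded in the standard basis. Brackets of smooth fields become smooth this way.\<close>

lemma smooth_on_frechet_derivative_field:
  fixes f :: "'a::euclidean_space \<Rightarrow> 'b::real_normed_vector"
  assumes "open S" "smooth_on S f" "smooth_on S Y"
  shows "smooth_on S (\<lambda>x. frechet_derivative f (at x) (Y x))"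
proof (rule smooth_on_cong[OF assms(1)])
  show "smooth_on S (\<lambda>x. \<Sum>b\<in>Basis. (Y x \<bullet> b) *\<^sub>R frechet_derivative f (at x) b)"
    by (intro smooth_on_sum smooth_on_scaleR smooth_on_frechet_derivative assms finite_Basis
        smooth_on_bilinear[OF _ bounded_bilinear_inner] smooth_on_const)
  show "(\<Sum>b\<in>Basis. (Y x \<bullet> b) *\<^sub>R frechet_derivative f (at x) b) = frechet_derivative f (at x) (Y x)"
    if "x \<in> S" for x
  proof -
    have lin: "linear (frechet_derivative f (at x))"
      using smooth_on_imp_has_derivative[OF assms(2) that] has_derivative_linear by blast
    have "frechet_derivative f (at x) (\<Sum>b\<in>Basis. (Y x \<bullet> b) *\<^sub>R b) = (\<Sum>b\<in>Basis. (Y x \<bullet> b) *\<^sub>R frechet_derivative f (at x) b)"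
      by (simp add: linear_sum[OF lin] linear_scale[OF lin])
    then show ?thesis by (simp add: euclidean_representation)
  qed
qed

lemma smooth_on_lie_bracket:
  fixes Y Z :: "'a::euclidean_space \<Rightarrow> 'a"
  assumes "open S" "smooth_on S Y" "smooth_on S Z"
  shows "smooth_on S (lie_bracket Y Z)"
  unfolding lie_bracket_def[abs_def]
  by (intro smooth_on_diff smooth_on_frechet_derivative_field assms)


section \<open>Tangent spaces and projections\<close>

text \<open>The source of all upper bounds: a tangent vector is the velocity of a curve inside
  \<open>M\<close>, along which \<open>f\<close> and \<open>g\<close> coincide, whatever they do off
  \<open>M\<close>.\<close>

lemma tangent_space_has_derivative_eq:
  fixes f g :: "'a::real_normed_vector \<Rightarrow> 'b::real_normed_vector"
  assumes v: "v \<in> tangent_space M p" and W: "open W" "p \<in> W"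
    and eq: "\<And>x. x \<in> M \<inter> W \<Longrightarrow> f x = g x"
    and f: "(f has_derivative f') (at p)" and g: "(g has_derivative g') (at p)"
  shows "f' v = g' v"
proof -
  obtain c \<epsilon> where c: "\<epsilon> > 0" "c ` {-\<epsilon><..<\<epsilon>} \<subseteq> M" "c (0::real) = p" "(c has_vector_derivative v) (at 0)"
    using v unfolding tangent_space_def by blast
  have der: "((\<lambda>t. h (c t)) has_vector_derivative h' v) (at 0)"
    if "(h has_derivative h') (at p)" for h :: "'a \<Rightarrow> 'b" and h'
    using has_derivative_compose[of c "\<lambda>t. t *\<^sub>R v" 0 UNIV h h'] that c linear_scale[OF has_derivative_linear[OF that]]
    unfolding has_vector_derivative_def by simp
  have "isCont c 0"
    using c(4) by (rule has_vector_derivative_continuous)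
  then have "eventually (\<lambda>t. c t \<in> W) (at 0)"
    using W c(3) unfolding isCont_def by (metis topological_tendstoD)
  moreover have "eventually (\<lambda>t. t \<in> {-\<epsilon><..<\<epsilon>}) (at (0::real))"
    using c(1) by (intro eventually_at_in_open') auto
  ultimately have "eventually (\<lambda>t. f (c t) = g (c t)) (at 0)"
    by eventually_elim (use c(2) in \<open>auto simp: image_subset_iff intro!: eq\<close>)
  then have "((\<lambda>t. g (c t)) has_vector_derivative f' v) (at 0)"
    using der[OF f] W(2) c eq[of p]
    unfolding has_vector_derivative_def
    by (elim has_derivative_transform_eventually) (auto simp: image_subset_iff)
  then show ?thesis
    using der[OF g] vector_derivative_unique_at by blast
qed

lemma tangent_space_orthonormal_derivative:
  fixes e f :: "'a::real_normed_vector \<Rightarrow> 'b::real_inner"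
  assumes "v \<in> tangent_space M p" "open W" "p \<in> W"
    and "\<And>x. x \<in> M \<inter> W \<Longrightarrow> e x \<bullet> f x = c"
    and "(e has_derivative e') (at p)" "(f has_derivative f') (at p)"
  shows "e' v \<bullet> f p + e p \<bullet> f' v = 0"
proof -
  have "((\<lambda>x. e x \<bullet> f x) has_derivative (\<lambda>v. e p \<bullet> f' v + e' v \<bullet> f p)) (at p)"
    by (rule has_derivative_inner[OF assms(5,6)])
  from tangent_space_has_derivative_eq[OF assms(1-4) this has_derivative_const]
  show ?thesis by (simp add: add.commute)
qed

lemma tangent_space_UNIV [simp]: "tangent_space UNIV p = UNIV"
proof -
  have "v \<in> tangent_space UNIV p" for v
    unfolding tangent_space_def
    by (intro CollectI exI[of _ "\<lambda>t. p + t *\<^sub>R v"] exI[of _ 1])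
      (auto intro!: smooth_on_add smooth_on_const smooth_on_linear[OF _ bounded_linear_scaleR_left]
        derivative_eq_intros simp: has_vector_derivative_def)
  then show ?thesis by blast
qed

lemma tangent_space_sphere:
  fixes x :: "'a::euclidean_space"
  assumes "x \<bullet> x = 1"
  shows "tangent_space (sphere 0 1) x = {v. x \<bullet> v = 0}"
proof (intro equalityI subsetI CollectI)
  fix v assume "v \<in> tangent_space (sphere 0 1) x"
  then show "x \<bullet> v = 0"
    using tangent_space_orthonormal_derivative[of v "sphere 0 1" x UNIV "\<lambda>y. y" "\<lambda>y. y" 1 "\<lambda>y. y" "\<lambda>y. y"]
    by (auto simp: inner_commute norm_eq_1)
next
  fix v assume v: "v \<in> {v. x \<bullet> v = 0}"
  show "v \<in> tangent_space (sphere 0 1) x"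
  proof (cases "v = 0")
    case True
    have "((\<lambda>t. x) has_vector_derivative 0) (at (0::real))" by simp
    then show ?thesis
      unfolding tangent_space_def True using assms
      by (intro CollectI exI[of _ "\<lambda>t. x"] exI[of _ 1]) (auto simp: smooth_on_const norm_eq_1)
  next
    case False
    define w where "w = v /\<^sub>R norm v"
    have w: "w \<bullet> w = 1" "x \<bullet> w = 0" "w \<bullet> x = 0" "norm v *\<^sub>R w = v"
      using v False by (auto simp: w_def inner_commute dot_square_norm power2_eq_square)
    \<comment> \<open>The great circle through \<open>x\<close> with initial velocity
      \<open>v\<close>.\<close>
    define c where "c = (\<lambda>t. cos (norm v * t) *\<^sub>R x + sin (norm v * t) *\<^sub>R w)"
    have "smooth_on {-1<..<1} c"
      unfolding c_def by (intro smooth_on_add smooth_on_scaleR smooth_on_sin smooth_on_cos smooth_on_const) auto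
    moreover have "c t \<in> sphere 0 1" for t
      using w assms by (simp add: c_def norm_eq_1 inner_add_left inner_add_right flip: power2_eq_square)
    moreover have "(c has_vector_derivative norm v *\<^sub>R w) (at 0)"
      unfolding c_def by (auto intro!: derivative_eq_intros simp: has_vector_derivative_def)
    ultimately show ?thesis
      unfolding tangent_space_def
      by (intro CollectI exI[of _ c] exI[of _ 1]) (auto simp: c_def w(4))
  qed
qed

lemma orthogonal_projection_eqI:
  assumes "subspace V" "w \<in> V" "\<And>u. u \<in> V \<Longrightarrow> orthogonal (v - w) u"
  shows "orthogonal_projection V v = w"
  unfolding orthogonal_projection_def
proof (rule the_equality)
  fix w' assume w': "w' \<in> V \<and> (\<forall>u\<in>V. orthogonal (v - w') u)"
  then have "w' - w \<in> V" using assms by (simp add: subspace_diff)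
  then have "(v - w) \<bullet> (w' - w) = 0" "(v - w') \<bullet> (w' - w) = 0"
    using assms(3) w' by (auto simp: orthogonal_def)
  then have "(w' - w) \<bullet> (w' - w) = 0" by (simp add: inner_diff_left)
  then show "w' = w" by simp
qed (use assms in auto)

lemma orthogonal_projection_UNIV [simp]: "orthogonal_projection UNIV v = v"
  by (rule orthogonal_projection_eqI) (auto simp: orthogonal_def)

lemma orthogonal_projection_hyperplane:
  fixes x :: "'a::euclidean_space"
  assumes "x \<bullet> x = 1"
  shows "orthogonal_projection {v. x \<bullet> v = 0} w = w - (x \<bullet> w) *\<^sub>R x"
  using assms
  by (intro orthogonal_projection_eqI subspace_hyperplane) (auto simp: orthogonal_def inner_diff_right)


section \<open>Plane rotations\<close>

definition outer :: "real^'n \<Rightarrow> real^'m \<Rightarrow> real^'m^'n" where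
  "outer a b = (\<chi> i j. a $ i * b $ j)"

lemma outer_mult_vec [simp]: "outer a b *v z = (b \<bullet> z) *\<^sub>R a"
  by (simp add: outer_def vec_eq_iff matrix_vector_mult_def inner_vec_def sum_distrib_left mult_ac)

lemma transpose_outer [simp]: "transpose (outer a b) = outer b a"
  by (simp add: outer_def transpose_def vec_eq_iff mult.commute)

lemma row_outer [simp]: "outer a b $ i = (a $ i) *\<^sub>R b"
  by (simp add: outer_def vec_eq_iff)

lemma inner_transpose_matrix_vector: "(transpose A *v z) \<bullet> a = z \<bullet> (A *v a)" for A :: "real^'n^'m"
  using dot_lmul_matrix[of z A a] by simp

lemma scaleR_matrix_vector_mult: "(c *\<^sub>R A) *v z = c *\<^sub>R (A *v z)" for A :: "real^'n^'m"
  by (simp add: scaleR_matrix_vector_assoc)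

text \<open>For orthonormal \<open>a\<close> and \<open>b\<close>, the rotation by
  \<open>\<theta>\<close> that turns \<open>a\<close> towards \<open>b\<close> and fixes the
  orthogonal complement of their plane. It is affine in \<open>sin \<theta>\<close> and
  \<open>cos \<theta>\<close> with constant matrices, hence easy to differentiate.\<close>

definition plane_rotation :: "real^'n \<Rightarrow> real^'n \<Rightarrow> real \<Rightarrow> real^'n^'n" where
  "plane_rotation a b \<theta> =
     mat 1 + sin \<theta> *\<^sub>R (outer b a - outer a b) + (cos \<theta> - 1) *\<^sub>R (outer a a + outer b b)"

lemma plane_rotation_mult_vec:
  "plane_rotation a b \<theta> *v z =
     z + (sin \<theta> * (a \<bullet> z) + (cos \<theta> - 1) * (b \<bullet> z)) *\<^sub>R b
       + ((cos \<theta> - 1) * (a \<bullet> z) - sin \<theta> * (b \<bullet> z)) *\<^sub>R a"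
  by (simp add: plane_rotation_def matrix_vector_mult_add_rdistrib matrix_vector_mult_diff_rdistrib
      scaleR_matrix_vector_mult algebra_simps)

lemma plane_rotation_0 [simp]: "plane_rotation a b 0 = mat 1"
  by (simp add: plane_rotation_def)

lemma plane_rotation_periodic: "plane_rotation a b (\<theta> + 2 * pi) = plane_rotation a b \<theta>"
  by (simp add: plane_rotation_def)

lemma plane_rotation_swap: "plane_rotation b a \<theta> = plane_rotation a b (- \<theta>)"
  by (simp add: plane_rotation_def algebra_simps)

lemma transpose_plane_rotation: "transpose (plane_rotation a b \<theta>) = plane_rotation a b (- \<theta>)"
  by (simp add: plane_rotation_def transpose_def vec_eq_iff mat_def outer_def algebra_simps)

lemma plane_rotation_add:
  assumes "a \<bullet> a = 1" "b \<bullet> b = 1" "a \<bullet> b = 0"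
  shows "plane_rotation a b \<theta> ** plane_rotation a b \<phi> = plane_rotation a b (\<theta> + \<phi>)"
proof -
  have "plane_rotation a b \<theta> *v (plane_rotation a b \<phi> *v z) = plane_rotation a b (\<theta> + \<phi>) *v z" for z
  proof -
    have a: "a \<bullet> (plane_rotation a b \<phi> *v z) = cos \<phi> * (a \<bullet> z) - sin \<phi> * (b \<bullet> z)"
      and b: "b \<bullet> (plane_rotation a b \<phi> *v z) = sin \<phi> * (a \<bullet> z) + cos \<phi> * (b \<bullet> z)"
      using assms by (simp_all add: plane_rotation_mult_vec inner_add_right inner_commute[of b a] algebra_simps)
    show ?thesis
      unfolding plane_rotation_mult_vec[of a b \<theta>] a b
      by (simp add: plane_rotation_mult_vec sin_add cos_add algebra_simps)
  qed
  then show ?thesis by (simp add: matrix_eq matrix_vector_mul_assoc)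
qed

lemma rotation_matrix_plane_rotation:
  assumes "a \<bullet> a = 1" "b \<bullet> b = 1" "a \<bullet> b = 0"
  shows "rotation_matrix (plane_rotation a b \<theta>)"
proof -
  have ortho: "orthogonal_matrix (plane_rotation a b \<phi>)" for \<phi>
    by (simp add: orthogonal_matrix transpose_plane_rotation plane_rotation_add[OF assms])
  \<comment> \<open>The rotation is the square of the one by half the angle, so its determinant is
    the square of \<open>1\<close> or \<open>-1\<close>.\<close>
  have "det (plane_rotation a b \<theta>) = det (plane_rotation a b (\<theta> / 2)) * det (plane_rotation a b (\<theta> / 2))"
    by (simp add: plane_rotation_add[OF assms] flip: det_mul)
  then have "det (plane_rotation a b \<theta>) = 1"
    using det_orthogonal_matrix[OF ortho[of "\<theta> / 2"]] by auto
  then show ?thesis using ortho by (simp add: rotation_matrix_def)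
qed

lemma plane_rotation_conjugate:
  assumes "orthogonal_matrix K"
  shows "K ** plane_rotation a b \<theta> ** transpose K = plane_rotation (K *v a) (K *v b) \<theta>"
proof -
  have "K *v (transpose K *v z) = z" for z
    using assms by (simp add: matrix_vector_mul_assoc orthogonal_matrix_def del: transpose_matrix_vector)
  moreover have "a \<bullet> (transpose K *v z) = (K *v a) \<bullet> z" for a z
    by (metis inner_commute inner_transpose_matrix_vector)
  ultimately have "K *v (plane_rotation a b \<theta> *v (transpose K *v z)) = plane_rotation (K *v a) (K *v b) \<theta> *v z" for z
    by (simp only: plane_rotation_mult_vec matrix_vector_right_distrib matrix_vector_mult_scaleR)
  then show ?thesis by (simp add: matrix_eq matrix_vector_mul_assoc matrix_mul_assoc del: transpose_matrix_vector)
qed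

lemma rotation_matrix_mult: "rotation_matrix A \<Longrightarrow> rotation_matrix B \<Longrightarrow> rotation_matrix (A ** B)"
  for A B :: "real^'n^'n"
  unfolding rotation_matrix_def using orthogonal_matrix_mul[of A B] by (simp add: det_mul)

lemma rotation_matrix_transpose: "rotation_matrix A \<Longrightarrow> rotation_matrix (transpose A)"
  for A :: "real^'n^'n"
  by (simp add: rotation_matrix_def orthogonal_matrix_transpose)

lemma rotation_matrix_mat_1: "rotation_matrix (mat 1)"
  by (simp add: rotation_matrix_def orthogonal_matrix_id)

lemma rotation_matrixD:
  "rotation_matrix A \<Longrightarrow> A ** transpose A = mat 1"
  "rotation_matrix A \<Longrightarrow> transpose A ** A = mat 1"
  by (simp_all add: rotation_matrix_def orthogonal_matrix_def)

lemma rotation_matrix_iff_det_pos: "rotation_matrix A \<longleftrightarrow> orthogonal_matrix A \<and> det A > 0"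
  for A :: "real^'n^'n"
  using det_orthogonal_matrix[of A] by (auto simp: rotation_matrix_def)

section \<open>Adding one index: block matrices and determinants\<close>

lemma UNIV_option_sum: "(\<Sum>i\<in>(UNIV :: 'n::finite option set). f i) = f None + (\<Sum>i\<in>UNIV. f (Some i))"
  by (simp add: UNIV_option_conv sum.reindex)

lemma UNIV_option_prod: "(\<Prod>i\<in>(UNIV :: 'n::finite option set). f i) = f None * (\<Prod>i\<in>UNIV. f (Some i))"
  by (simp add: UNIV_option_conv prod.reindex)

text \<open>Relates the determinant of size \<open>n + 1\<close> that orients the sphere to the one
  of size \<open>n\<close> that orients \<open>\<real>^n\<close>.\<close>

definition one_block :: "real^'n^'n \<Rightarrow> real^'n option^'n option" where
  "one_block M = (\<chi> i j. case i of None \<Rightarrow> (case j of None \<Rightarrow> 1 | Some _ \<Rightarrow> 0)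
     | Some i' \<Rightarrow> (case j of None \<Rightarrow> 0 | Some j' \<Rightarrow> M $ i' $ j'))"

text \<open>The elementary operations of the induction leave the added row and column alone, so both
  determinants change alike.\<close>

lemma det_one_block: "det (one_block M) = det M"
proof (induction M rule: induct_matrix_row_operations)
  case (1 A i)
  then have "row (Some i) (one_block A) = 0"
    by (auto simp: row_def one_block_def vec_eq_iff split: option.split)
  then show ?case using 1 by (simp add: det_zero_row)
next
  case (2 A)
  then have "one_block A $ i $ j = 0" if "i \<noteq> j" for i j
    using that by (auto simp: one_block_def split: option.split)
  then show ?case
    using 2 by (simp add: det_diagonal UNIV_option_prod) (simp add: one_block_def)
next
  case (3 A m n)
  let ?p = "Transposition.transpose m n" and ?q = "Transposition.transpose (Some m) (Some n)"
  have eq: "one_block (\<chi> i j. A $ i $ ?p j) = (\<chi> i j. one_block A $ i $ ?q j)"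
    by (auto simp: one_block_def vec_eq_iff Transposition.transpose_def split: option.split)
  show ?case
    unfolding eq using 3
    by (simp add: det_permute_columns permutes_swap_id sign_swap_id)
next
  case (4 A m n c)
  have eq: "one_block (\<chi> i. if i = m then row m A + c *\<^sub>R row n A else row i A) =
      (\<chi> i. if i = Some m then row (Some m) (one_block A) + c *s row (Some n) (one_block A) else row i (one_block A))"
    by (auto simp: one_block_def vec_eq_iff row_def split: option.split)
  have eq': "(\<chi> i. if i = m then row m A + c *\<^sub>R row n A else row i A) =
      (\<chi> i. if i = m then row m A + c *s row n A else row i A)"
    by (simp add: vec_eq_iff row_def)
  show ?case
    unfolding eq unfolding eq' using 4 by (simp add: det_row_operation)
qed


section \<open>The configuration space as a rotation group\<close>

lemma bounded_bilinear_matrix_mult: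
  "bounded_bilinear (\<lambda>(A :: real^'n^'m) (B :: real^'p^'n). A ** B)"
  unfolding bilinear_conv_bounded_bilinear[symmetric]
  by (auto simp: bilinear_def linear_iff matrix_matrix_mult_def vec_eq_iff sum.distrib
      sum_distrib_left algebra_simps)

lemma bounded_linear_transpose: "bounded_linear (transpose :: real^'n^'m \<Rightarrow> real^'m^'n)"
  unfolding linear_conv_bounded_linear[symmetric]
  by (simp add: linear_iff transpose_def vec_eq_iff)

lemma matrix_mult_transpose_nth: "(A ** transpose B) $ i $ j = A $ i \<bullet> B $ j"
  for A :: "real^'n^'m" and B :: "real^'n^'k"
  by (simp add: matrix_matrix_mult_def transpose_def inner_vec_def)

lemma vector_matrix_mult_eq_sum: "w v* A = (\<Sum>i\<in>UNIV. (w $ i) *\<^sub>R A $ i)" for A :: "real^'n^'m"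
  by (simp add: vec_eq_iff vector_matrix_mult_def mult.commute)

definition cfg :: "real^'n \<Rightarrow> real^'n option^'n option \<Rightarrow> ('n::finite option, 'n) config" where
  "cfg y R = (R $ None, y, \<chi> i. R $ Some i)"

definition frm :: "('n::finite option, 'n) config \<Rightarrow> real^'n option^'n option" where
  "frm q = (\<chi> a. case a of None \<Rightarrow> fst q | Some i \<Rightarrow> snd (snd q) $ i)"

lemma frm_nth [simp]: "frm q $ None = fst q" "frm q $ Some i = snd (snd q) $ i"
  by (simp_all add: frm_def)

lemma frm_eqI: "fst p = fst q \<Longrightarrow> snd (snd p) = snd (snd q) \<Longrightarrow> frm p = frm q"
  by (simp add: frm_def vec_eq_iff split: option.split)

lemma frm_cfg [simp]: "frm (cfg y R) = R"
  by (simp add: frm_def cfg_def vec_eq_iff split: option.split)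

lemma cfg_sel [simp]: "fst (cfg y R) = R $ None" "fst (snd (cfg y R)) = y"
    "snd (snd (cfg y R)) $ i = R $ Some i"
  by (simp_all add: cfg_def)

lemma cfg_frm [simp]: "cfg (fst (snd q)) (frm q) = q"
  by (simp add: frm_def cfg_def prod_eq_iff vec_eq_iff)

lemma bounded_linear_frm: "bounded_linear frm"
  unfolding linear_conv_bounded_linear[symmetric]
  by (auto simp: linear_iff frm_def vec_eq_iff split: option.split)

lemma bounded_linear_cfg: "bounded_linear (\<lambda>p. cfg (fst p) (snd p))"
  unfolding linear_conv_bounded_linear[symmetric]
  by (auto simp: linear_iff cfg_def vec_eq_iff)

lemmas frm_linear = linear_add[OF bounded_linear.linear[OF bounded_linear_frm]]
  linear_diff[OF bounded_linear.linear[OF bounded_linear_frm]]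
  linear_scale[OF bounded_linear.linear[OF bounded_linear_frm]]

abbreviation rolling_space :: "('n::finite option, 'n) config set" where
  "rolling_space \<equiv> config_space (sphere 0 1) sphere_orientation UNIV
     (euclidean_orientation :: ('n, 'n) orientation)"

lemma frm_mult_transpose_nth [simp]:
  "(frm p ** transpose (frm q)) $ None $ None = fst p \<bullet> fst q"
  "(frm p ** transpose (frm q)) $ None $ Some i = fst p \<bullet> snd (snd q) $ i"
  "(frm p ** transpose (frm q)) $ Some i $ None = (snd (snd p) *v fst q) $ i"
  "(frm p ** transpose (frm q)) $ Some i $ Some j = snd (snd p) $ i \<bullet> snd (snd q) $ j"
  by (simp_all add: matrix_mult_transpose_nth matrix_vector_mul_component)

lemma vector_frm_mult: "w v* frm q = (w $ None) *\<^sub>R fst q + (\<chi> i. w $ Some i) v* snd (snd q)"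
  by (simp add: vector_matrix_mult_eq_sum UNIV_option_sum)

text \<open>Orthonormality of the rows gives the first three facts, that of the columns the last
  one: \<open>A^T A\<close> is the orthogonal projection onto the tangent space at
  \<open>x\<close>.\<close>

lemma rotation_frmD:
  assumes "rotation_matrix (frm (x, y, A))"
  shows "x \<bullet> x = 1" "A *v x = 0" "A ** transpose A = mat 1"
    "\<And>v. (A *v v) v* A = v - (x \<bullet> v) *\<^sub>R x"
proof -
  let ?R = "frm (x, y, A)"
  have eq: "(?R ** transpose ?R) $ i $ j = (if i = j then 1 else 0)" for i j
    using rotation_matrixD(1)[OF assms] by (simp add: mat_def)
  show "x \<bullet> x = 1" using eq[of None None] by simp
  have "(A *v x) $ i = 0" for i using eq[of "Some i" None] by simp
  then show "A *v x = 0" by (simp add: vec_eq_iff)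
  have "A $ i \<bullet> A $ j = (if i = j then 1 else 0)" for i j using eq[of "Some i" "Some j"] by simp
  then show "A ** transpose A = mat 1" by (simp add: vec_eq_iff matrix_mult_transpose_nth mat_def)
  fix v
  have "transpose ?R *v (?R *v v) = v"
    using rotation_matrixD(2)[OF assms] by (simp add: matrix_vector_mul_assoc del: transpose_matrix_vector)
  then have "(?R *v v) v* ?R = v" by simp
  moreover have "(\<chi> i. (?R *v v) $ Some i) = A *v v" "(?R *v v) $ None = x \<bullet> v"
    by (simp_all add: vec_eq_iff matrix_vector_mul_component)
  ultimately have "(x \<bullet> v) *\<^sub>R x + (A *v v) v* A = v"
    by (simp add: vector_frm_mult)
  then show "(A *v v) v* A = v - (x \<bullet> v) *\<^sub>R x"
    by (simp add: algebra_simps)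
qed

text \<open>The first matrix times the transpose of the second is block diagonal, with blocks
  \<open>1\<close> and the transpose of the matrix on the right. Hence the sign of
  \<open>det (frm (x, y, A))\<close> decides whether \<open>A\<close> preserves orientation.\<close>

lemma det_frm_mult:
  assumes "x \<bullet> x = 1" "A *v x = 0" "\<And>i. x \<bullet> b i = 0"
  shows "det (frm (x, y, A)) * det (frm (x, y, \<chi> i. b i)) = det (\<chi> i. A *v b i)"
proof -
  let ?B = "frm (x, y, \<chi> i. b i)"
  have "A $ i \<bullet> x = 0" for i
    using assms(2) by (metis matrix_vector_mul_component zero_index)
  then have "(frm (x, y, A) ** transpose ?B) $ i $ j = one_block (transpose (\<chi> i. A *v b i)) $ i $ j" for i j
    using assms
    by (cases i; cases j)
      (simp_all add: one_block_def transpose_def[of "\<chi> i. A *v b i"] matrix_vector_mul_component)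
  then have "frm (x, y, A) ** transpose ?B = one_block (transpose (\<chi> i. A *v b i))"
    by (simp add: vec_eq_iff)
  then have "det (frm (x, y, A) ** transpose ?B) = det (one_block (transpose (\<chi> i. A *v b i)))"
    by simp
  then show ?thesis by (simp add: det_mul det_one_block)
qed

lemma sphere_orientation_iff:
  "x \<bullet> x = 1 \<Longrightarrow> sphere_orientation x b \<longleftrightarrow> (\<forall>i. x \<bullet> b i = 0) \<and> det (frm (x, y, \<chi> i. b i)) > 0"
proof -
  have "(\<chi> a. case a of None \<Rightarrow> x | Some i \<Rightarrow> b i) = frm (x, y, \<chi> i. b i)"
    by (auto simp: frm_def vec_eq_iff split: option.split)
  then show "x \<bullet> x = 1 \<Longrightarrow> ?thesis"
    by (simp add: sphere_orientation_def tangent_space_sphere)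
qed

lemma rolling_space_iff: "q \<in> rolling_space \<longleftrightarrow> rotation_matrix (frm q)"
proof -
  obtain x y A where q: "q = (x, y, A)" by (cases q)
  show ?thesis unfolding q
  proof
    assume mem: "(x, y, A) \<in> rolling_space"
    then have x: "x \<bullet> x = 1" by (simp add: config_space_def norm_eq_1)
    note T = tangent_space_sphere[OF x]
    have iso: "(A *v u) \<bullet> (A *v v) = u \<bullet> v" if "x \<bullet> u = 0" "x \<bullet> v = 0" for u v
      using mem that by (simp add: config_space_def T)
    have ori: "det (\<chi> i. A *v b i) > 0" if "\<And>i. x \<bullet> b i = 0" "sphere_orientation x b" for b
      using mem that by (auto simp: config_space_def T euclidean_orientation_def)
    have "\<forall>v. x \<bullet> v = 0 \<longrightarrow> orthogonal x v" by (simp add: orthogonal_def)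
    then have Ax: "A *v x = 0"
      using mem by (simp add: config_space_def T)
    \<comment> \<open>The isometry condition speaks of tangent vectors; subtracting normal parts,
      which \<open>A\<close> kills, extends it to all vectors. The missing product is what the row
      \<open>x\<close> contributes to the stacked matrix.\<close>
    have AA: "(A *v u) \<bullet> (A *v v) = u \<bullet> v - (x \<bullet> u) * (x \<bullet> v)" for u v
    proof -
      have "A *v (u - (x \<bullet> u) *\<^sub>R x) = A *v u" "A *v (v - (x \<bullet> v) *\<^sub>R x) = A *v v"
        by (simp_all add: matrix_vector_mult_diff_distrib matrix_vector_mult_scaleR Ax)
      then show ?thesis
        using iso[of "u - (x \<bullet> u) *\<^sub>R x" "v - (x \<bullet> v) *\<^sub>R x"] x
        by (simp add: inner_diff_left inner_diff_right inner_commute algebra_simps Ax)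
    qed
    let ?R = "frm (x, y, A)"
    have "(?R *v u) \<bullet> (?R *v v) = u \<bullet> v" for u v
      using AA[of u v]
      by (simp add: inner_vec_def[of "_ :: real^'a option"] UNIV_option_sum matrix_vector_mul_component
          inner_vec_def[of "A *v u"])
    then have "(transpose ?R *v (?R *v u)) \<bullet> v = u \<bullet> v" for u v
      by (simp only: inner_transpose_matrix_vector)
    then have "transpose ?R *v (?R *v u) = u" for u
      using vector_eq_rdot by blast
    then have ortho: "orthogonal_matrix ?R"
      by (simp add: orthogonal_matrix matrix_eq matrix_vector_mul_assoc del: transpose_matrix_vector)
    have "det ?R \<noteq> 0"
      using det_orthogonal_matrix[OF ortho] by auto
    moreover have False if neg: "det ?R < 0"
    proof -
      fix k :: 'a
      \<comment> \<open>Reversing one row of \<open>A\<close> gives a basis of the tangent space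
        that is positively oriented if the determinant is negative, but whose image under
        \<open>A\<close> is then negatively oriented.\<close>
      define b where "b = (\<lambda>i. (if i = k then -1 else 1) *\<^sub>R A $ i)"
      have b: "x \<bullet> b i = 0" for i
        using Ax unfolding b_def
        by (metis inner_commute inner_scaleR_right matrix_vector_mul_component mult_zero_right zero_index)
      have "frm (x, y, \<chi> i. b i) = (\<chi> i. if i = Some k then (-1) *s ?R $ i else ?R $ i)"
        by (simp add: vec_eq_iff b_def frm_def split: option.split)
      then have "det (frm (x, y, \<chi> i. b i)) = - det ?R"
        using det_row_mul[of "Some k" "-1" "\<lambda>i. ?R $ i" "\<lambda>i. ?R $ i"]
        by (simp only: if_cancel vec_lambda_eta)
      then have pos: "det (frm (x, y, \<chi> i. b i)) > 0" using neg by simp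
      then have "det (\<chi> i. A *v b i) > 0"
        using b ori sphere_orientation_iff[OF x] by blast
      then show False
        using det_frm_mult[where b = b, OF x Ax b, of y] pos neg
        by (metis mult_less_0_iff not_less_iff_gr_or_eq)
    qed
    ultimately show "rotation_matrix ?R"
      using ortho by (metis rotation_matrix_iff_det_pos linorder_neqE_linordered_idom)
  next
    assume rot: "rotation_matrix (frm (x, y, A))"
    note R = rotation_frmD[OF rot]
    note T = tangent_space_sphere[OF R(1)]
    have "w \<in> (*v) A ` {v. x \<bullet> v = 0}" for w
    proof (rule image_eqI)
      show "w = A *v (w v* A)"
        using R(3) by (metis matrix_vector_mul_assoc matrix_vector_mul_lid transpose_matrix_vector)
      show "w v* A \<in> {v. x \<bullet> v = 0}"
        using R(2) by (simp add: inner_commute[of x] dot_lmul_matrix)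
    qed
    then have "(*v) A ` {v. x \<bullet> v = 0} = UNIV" by blast
    moreover have "(A *v u) \<bullet> (A *v v) = u \<bullet> v" if "x \<bullet> u = 0" "x \<bullet> v = 0" for u v
      using that by (simp add: R(4) inner_diff_left flip: dot_lmul_matrix)
    moreover have "det (\<chi> i. A *v b i) > 0" if "sphere_orientation x b" for b
      using that det_frm_mult[OF R(1,2), of b y] rot
      by (auto simp: sphere_orientation_iff[OF R(1), of b y] rotation_matrix_iff_det_pos)
        (metis mult_pos_pos)
    moreover have "A *v w = 0" if "\<And>v. x \<bullet> v = 0 \<Longrightarrow> orthogonal w v" for w
    proof -
      have "orthogonal w (w - (x \<bullet> w) *\<^sub>R x)"
        by (rule that) (simp add: inner_diff_right R(1))
      then have "(A *v w) \<bullet> (A *v w) = 0"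
        unfolding dot_lmul_matrix[symmetric] R(4)
        by (simp add: orthogonal_def inner_commute)
      then show ?thesis by simp
    qed
    ultimately show "(x, y, A) \<in> rolling_space"
      using R(1) by (auto simp: config_space_def T norm_eq_1 euclidean_orientation_def)
  qed
qed


section \<open>The Lie algebra of the rotation group and the tangent spaces\<close>

definition rotation_generators :: "(real^'n^'n) set" where
  "rotation_generators = {\<Omega>. \<exists>g. smooth_on {-1<..<1} g \<and> (\<forall>t::real. rotation_matrix (g t)) \<and>
     g 0 = mat 1 \<and> (g has_vector_derivative \<Omega>) (at 0)}"

lemma rotation_generators_0: "0 \<in> rotation_generators"
  unfolding rotation_generators_def
  by (intro CollectI exI[of _ "\<lambda>_. mat 1"]) (simp add: smooth_on_const rotation_matrix_mat_1)

text \<open>The pointwise product of two curves through the identity has the sum of their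
  velocities. Products of plane rotations thus realize every skew velocity, in place of the matrix
  exponential.\<close>

lemma rotation_generators_add:
  assumes "A \<in> rotation_generators" "B \<in> rotation_generators"
  shows "A + B \<in> rotation_generators"
proof -
  obtain f where f: "smooth_on {-1<..<1} f" "\<forall>t. rotation_matrix (f t)" "f 0 = mat 1"
      "(f has_vector_derivative A) (at 0)"
    using assms(1) unfolding rotation_generators_def by blast
  obtain g where g: "smooth_on {-1<..<1} g" "\<forall>t. rotation_matrix (g t)" "g 0 = mat 1"
      "(g has_vector_derivative B) (at 0)"
    using assms(2) unfolding rotation_generators_def by blast
  have "((\<lambda>t. f t ** g t) has_vector_derivative (f 0 ** B + A ** g 0)) (at 0)"
    by (rule bounded_bilinear.has_vector_derivative[OF bounded_bilinear_matrix_mult f(4) g(4)])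
  then have "((\<lambda>t. f t ** g t) has_vector_derivative (A + B)) (at 0)"
    using f(3) g(3) by (simp add: add.commute)
  moreover have "smooth_on {-1<..<1} (\<lambda>t. f t ** g t)"
    by (intro smooth_on_bilinear[OF _ bounded_bilinear_matrix_mult] f g) simp
  ultimately show ?thesis
    unfolding rotation_generators_def using f g
    by (intro CollectI exI[of _ "\<lambda>t. f t ** g t"]) (simp add: rotation_matrix_mult)
qed

lemma has_vector_derivative_plane_rotation:
  "((\<lambda>t. plane_rotation a b (c * t)) has_vector_derivative
     c *\<^sub>R (cos (c * t) *\<^sub>R (outer b a - outer a b) - sin (c * t) *\<^sub>R (outer a a + outer b b))) (at t within S)"
  unfolding plane_rotation_def has_vector_derivative_def
  by (rule derivative_eq_intros | simp)+ (simp add: algebra_simps)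

lemma plane_rotation_generator:
  "c *\<^sub>R (outer (axis j 1) (axis i 1) - outer (axis i 1) (axis j 1)) \<in> (rotation_generators :: (real^'n^'n) set)"
proof (cases "i = j")
  case False
  let ?g = "\<lambda>t. plane_rotation (axis i 1 :: real^'n) (axis j 1) (c * t)"
  have "rotation_matrix (?g t)" for t
    using False by (intro rotation_matrix_plane_rotation) (auto simp: inner_axis_axis)
  moreover have "smooth_on {-1<..<1} ?g"
    unfolding plane_rotation_def
    by (intro smooth_on_add smooth_on_scaleR smooth_on_diff smooth_on_sin smooth_on_cos smooth_on_const) auto
  moreover have "(?g has_vector_derivative c *\<^sub>R (outer (axis j 1) (axis i 1) - outer (axis i 1) (axis j 1))) (at 0)"
    using has_vector_derivative_plane_rotation[of "axis i 1" "axis j 1" c 0 UNIV] by simp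
  ultimately show ?thesis
    unfolding rotation_generators_def by (intro CollectI exI[of _ ?g]) simp
qed (simp add: rotation_generators_0)

definition skew_matrix :: "real^'n^'n \<Rightarrow> bool" where
  "skew_matrix M \<longleftrightarrow> transpose M = - M"

lemma skew_matrix_iff: "skew_matrix M \<longleftrightarrow> (\<forall>i j. M $ i $ j = - M $ j $ i)"
  by (auto simp: skew_matrix_def transpose_def vec_eq_iff)

lemmas linear_transpose = bounded_linear.linear[OF bounded_linear_transpose]

lemma skew_matrix_0: "skew_matrix 0"
  and skew_matrix_add: "skew_matrix A \<Longrightarrow> skew_matrix B \<Longrightarrow> skew_matrix (A + B)"
  and skew_matrix_scaleR: "skew_matrix A \<Longrightarrow> skew_matrix (c *\<^sub>R A)"
  by (simp_all add: skew_matrix_def linear_0[OF linear_transpose] linear_add[OF linear_transpose]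
      linear_scale[OF linear_transpose])

text \<open>Skew matrices are sums of multiples of infinitesimal plane rotations. As an induction
  rule this serves twice: to find curves with a prescribed velocity and to find sections of
  \<open>D\<^sup>2\<close> with a prescribed twist.\<close>

lemma skew_matrix_induct [consumes 1, case_names zero add generator]:
  fixes M :: "real^'n^'n"
  assumes "skew_matrix M" and "P 0" and add: "\<And>A B. P A \<Longrightarrow> P B \<Longrightarrow> P (A + B)"
    and gen: "\<And>c i j. P (c *\<^sub>R (outer (axis j 1) (axis i 1) - outer (axis i 1) (axis j 1)))"
  shows "P M"
proof -
  \<comment> \<open>The double sum meets every pair of indices in both orders, hence the factor
    \<open>1 / 2\<close>.\<close>
  have M: "M = (\<Sum>j\<in>UNIV. \<Sum>i\<in>UNIV. (M $ j $ i / 2) *\<^sub>R (outer (axis j 1) (axis i 1) - outer (axis i 1) (axis j 1)))"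
    (is "_ = ?S")
  proof -
    have 1: "(\<Sum>j\<in>UNIV. \<Sum>i\<in>UNIV. c j i * (axis j 1 $ k * axis i 1 $ l)) = c k l"
      and 2: "(\<Sum>j\<in>UNIV. \<Sum>i\<in>UNIV. c j i * (axis i 1 $ k * axis j 1 $ l)) = c l k" for k l and c :: "'n \<Rightarrow> 'n \<Rightarrow> real"
    proof -
      have "c j i * (axis j 1 $ k * axis i 1 $ l) = (if i = l then if j = k then c j i else 0 else 0)"
        "c j i * (axis i 1 $ k * axis j 1 $ l) = (if i = k then if j = l then c j i else 0 else 0)" for i j
        by (simp_all add: axis_def)
      then show "(\<Sum>j\<in>UNIV. \<Sum>i\<in>UNIV. c j i * (axis j 1 $ k * axis i 1 $ l)) = c k l"
        "(\<Sum>j\<in>UNIV. \<Sum>i\<in>UNIV. c j i * (axis i 1 $ k * axis j 1 $ l)) = c l k"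
        by simp_all
    qed
    have "?S $ k $ l = M $ k $ l / 2 - M $ l $ k / 2" for k l
      unfolding 1[of "\<lambda>j i. M $ j $ i / 2" k l, symmetric] 2[of "\<lambda>j i. M $ j $ i / 2" k l, symmetric]
      by (simp only: sum_component vector_scaleR_component vector_minus_component outer_def
          vec_lambda_beta real_scaleR_def right_diff_distrib sum_subtractf)
    then have "M $ k $ l = ?S $ k $ l" for k l
      using assms(1)[unfolded skew_matrix_iff, rule_format, of l k] by simp
    then show ?thesis unfolding vec_eq_iff by blast
  qed
  have sum: "P (sum f I)" if "finite I" "\<And>i. i \<in> I \<Longrightarrow> P (f i)" for f :: "'n \<Rightarrow> real^'n^'n" and I
    using that by (induction I rule: finite_induct) (auto intro: add \<open>P 0\<close>)
  have "P ?S" by (intro sum finite gen)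
  with M show ?thesis by (rule ssubst)
qed

lemma skew_matrix_generator: "skew_matrix M \<Longrightarrow> M \<in> rotation_generators"
  by (induction rule: skew_matrix_induct)
    (auto intro: rotation_generators_0 rotation_generators_add plane_rotation_generator)

text \<open>The product \<open>frm (Y p) ** transpose (frm p)\<close> has two uses: with the
  identity for \<open>Y\<close> it is the orthogonality constraint, and for a vector field
  \<open>Y\<close> its skewness expresses tangency.\<close>

lemma frm_constraint_has_derivative:
  assumes "(Y has_derivative Y') (at q)"
  shows "((\<lambda>p. frm (Y p) ** transpose (frm p)) has_derivative
    (\<lambda>v. frm (Y q) ** transpose (frm v) + frm (Y' v) ** transpose (frm q))) (at q)"
  by (intro bounded_bilinear.FDERIV[OF bounded_bilinear_matrix_mult]
      bounded_linear.has_derivative[OF bounded_linear_frm]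
      bounded_linear.has_derivative[OF bounded_linear_transpose] assms has_derivative_ident)

lemma tangent_space_rolling_space:
  fixes q :: "('n::finite option, 'n) config"
  assumes q: "q \<in> rolling_space"
  shows "tangent_space rolling_space q = {\<eta>. skew_matrix (frm \<eta> ** transpose (frm q))}"
proof (intro equalityI subsetI CollectI)
  fix \<eta> assume "\<eta> \<in> tangent_space rolling_space q"
  then have "frm q ** transpose (frm \<eta>) + frm \<eta> ** transpose (frm q) = 0"
    by (rule tangent_space_has_derivative_eq[OF _ open_UNIV UNIV_I _
          frm_constraint_has_derivative[OF has_derivative_ident] has_derivative_const[of "mat 1"]])
      (simp add: rolling_space_iff rotation_matrixD)
  then show "skew_matrix (frm \<eta> ** transpose (frm q))"
    by (simp add: skew_matrix_def matrix_transpose_mul eq_neg_iff_add_eq_0)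
next
  fix \<eta> assume \<eta>: "\<eta> \<in> {\<eta>. skew_matrix (frm \<eta> ** transpose (frm q))}"
  define M where "M = frm \<eta> ** transpose (frm q)"
  obtain g where g: "smooth_on {-1<..<1} g" "\<forall>t. rotation_matrix (g t)" "g 0 = mat 1"
      "(g has_vector_derivative M) (at 0)"
    using skew_matrix_generator[of M] \<eta> unfolding rotation_generators_def M_def by blast
  have MR: "M ** frm q = frm \<eta>"
    using q unfolding M_def matrix_mul_assoc[symmetric]
    by (simp add: rolling_space_iff rotation_matrixD)
  define c where "c = (\<lambda>t. cfg (fst (snd q) + t *\<^sub>R fst (snd \<eta>)) (g t ** frm q))"
  have blR: "bounded_linear (\<lambda>M. M ** frm q)"
    using bounded_bilinear.bounded_linear_left[OF bounded_bilinear_matrix_mult] .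
  have c_alt: "c t = cfg (fst (snd q)) 0 + t *\<^sub>R cfg (fst (snd \<eta>)) 0 + cfg 0 (g t ** frm q)" for t
    by (simp add: c_def cfg_def zero_prod_def vec_eq_iff)
  have bl: "bounded_linear (\<lambda>M. cfg 0 (M ** frm q))"
    using bounded_linear_compose[OF bounded_linear_cfg bounded_linear_Pair[OF bounded_linear_zero blR]]
    by simp
  have lin: "smooth_on S (\<lambda>M. cfg 0 (M ** frm q))" if "open S" for S
    by (rule smooth_on_linear[OF that bl])
  \<comment> \<open>Applying a fixed linear map is read as the bilinear evaluation of a constant
    \<open>blinfun\<close>, which puts it under the bilinear rule.\<close>
  have "smooth_on {-1<..<1} (\<lambda>t. cfg 0 (g t ** frm q))"
    using smooth_on_bilinear[OF _ bounded_bilinear.flip[OF bounded_bilinear_blinfun_apply] g(1) smooth_on_const, of "Blinfun (\<lambda>M. cfg 0 (M ** frm q))"]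
    by (simp add: bounded_linear_Blinfun_apply[OF bl])
  then have "smooth_on {-1<..<1} c"
    unfolding c_alt[abs_def]
    by (intro smooth_on_add smooth_on_const smooth_on_scaleR smooth_on_linear[OF _ bounded_linear_ident]) auto
  moreover have "c t \<in> rolling_space" for t
    using q g(2) by (simp add: rolling_space_iff c_def rotation_matrix_mult)
  moreover have "c 0 = q" using g(3) by (simp add: c_def)
  moreover have "(c has_vector_derivative (cfg (fst (snd \<eta>)) 0 + cfg 0 (M ** frm q))) (at 0)"
    unfolding c_alt[abs_def]
    using bounded_linear.has_vector_derivative[OF bl g(4)]
    by (auto intro!: derivative_eq_intros simp: has_vector_derivative_def scaleR_add_right)
  moreover have "cfg (fst (snd \<eta>)) 0 + cfg 0 (M ** frm q) = \<eta>"
    unfolding MR by (simp add: cfg_def prod_eq_iff vec_eq_iff)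
  ultimately show "\<eta> \<in> tangent_space rolling_space q"
    unfolding tangent_space_def by (intro CollectI exI[of _ c] exI[of _ 1]) auto
qed


section \<open>The rolling fields and their brackets\<close>

text \<open>The element of \<open>D\<close> whose contact point moves with velocity
  \<open>u\<close>: the absence of slipping forces the component \<open>A^T u\<close> on the sphere,
  and keeping the rows of \<open>A\<close> orthogonal to \<open>x\<close> without twisting forces
  \<open>- u x^T\<close>.\<close>

definition rolling_field ::
    "real^'n \<Rightarrow> ('n::finite option, 'n) config \<Rightarrow> ('n option, 'n) config" where
  "rolling_field u q = (u v* snd (snd q), u, - outer u (fst q))"

text \<open>The derivative of the affine map \<open>rolling_field u\<close>. As a field it turns the
  sphere while the contact point in the plane rests, so it is a pure slip, the direction that second
  brackets have to supply.\<close>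

definition rolling_field_linear ::
    "real^'n \<Rightarrow> ('n::finite option, 'n) config \<Rightarrow> ('n option, 'n) config" where
  "rolling_field_linear u q = (u v* snd (snd q), 0, - outer u (fst q))"

lemma bilinear_outer: "bilinear outer"
  by (auto simp: bilinear_def linear_iff outer_def vec_eq_iff algebra_simps)

lemma bilinear_vector_matrix_mult: "bilinear (\<lambda>(w :: real^'m) (A :: real^'n^'m). w v* A)"
  by (auto simp: bilinear_def linear_iff vector_matrix_mult_eq_sum sum.distrib scaleR_sum_right algebra_simps)

lemmas outer_simps = bilinear_ladd[OF bilinear_outer] bilinear_radd[OF bilinear_outer]
  bilinear_lneg[OF bilinear_outer] bilinear_rneg[OF bilinear_outer]
  bilinear_lmul[OF bilinear_outer] bilinear_rmul[OF bilinear_outer]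
  bilinear_lzero[OF bilinear_outer] bilinear_rzero[OF bilinear_outer]
  bilinear_lsub[OF bilinear_outer] bilinear_rsub[OF bilinear_outer]

lemmas vmult_simps = bilinear_ladd[OF bilinear_vector_matrix_mult] bilinear_radd[OF bilinear_vector_matrix_mult]
  bilinear_lneg[OF bilinear_vector_matrix_mult] bilinear_rneg[OF bilinear_vector_matrix_mult]
  bilinear_lmul[OF bilinear_vector_matrix_mult] bilinear_rmul[OF bilinear_vector_matrix_mult]
  bilinear_lzero[OF bilinear_vector_matrix_mult] bilinear_rzero[OF bilinear_vector_matrix_mult]
  bilinear_lsub[OF bilinear_vector_matrix_mult] bilinear_rsub[OF bilinear_vector_matrix_mult]

lemma vector_outer_mult: "w v* outer a b = (w \<bullet> a) *\<^sub>R b"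
  by (simp add: inner_commute flip: transpose_matrix_vector)

lemma vector_mult_outer_mult: "outer a b ** A = outer a (b v* A)"
  by (simp add: outer_def matrix_matrix_mult_def vector_matrix_mult_def vec_eq_iff sum_distrib_left mult_ac)

lemma linear_rolling_field: "linear (\<lambda>u. rolling_field u q)"
  by (auto simp: linear_iff rolling_field_def outer_simps vmult_simps)

lemma bounded_linear_rolling_field_linear: "bounded_linear (rolling_field_linear u)"
  unfolding linear_conv_bounded_linear[symmetric]
  by (auto simp: linear_iff rolling_field_linear_def outer_simps vmult_simps)

lemma rolling_field_affine: "rolling_field u q = rolling_field_linear u q + (0, u, 0)"
  by (simp add: rolling_field_def rolling_field_linear_def)

lemma rolling_field_has_derivative: "(rolling_field u has_derivative rolling_field_linear u) (at q)"
  unfolding rolling_field_affine[abs_def]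
  using bounded_linear_imp_has_derivative[OF bounded_linear_rolling_field_linear]
  by (auto intro!: derivative_eq_intros)

lemma smooth_on_rolling_field: "open W \<Longrightarrow> smooth_on W (rolling_field u)"
  unfolding rolling_field_affine[abs_def]
  by (intro smooth_on_add smooth_on_const smooth_on_linear bounded_linear_rolling_field_linear)

lemma frechet_derivative_rolling_field [simp]:
  "frechet_derivative (rolling_field u) (at q) = rolling_field_linear u"
  by (rule frechet_derivative_at[OF rolling_field_has_derivative, symmetric])

definition spin_field ::
    "real^'n \<Rightarrow> real^'n \<Rightarrow> ('n::finite option, 'n) config \<Rightarrow> ('n option, 'n) config" where
  "spin_field u v q = (0, 0, (outer u v - outer v u) ** snd (snd q))"

text \<open>The sphere components are the same multiple \<open>u \<bullet> v\<close> of
  \<open>x\<close> on both sides and cancel; a twist in the plane of \<open>u\<close> and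
  \<open>v\<close> remains.\<close>

lemma lie_bracket_rolling_field: "lie_bracket (rolling_field u) (rolling_field v) = spin_field u v"
  by (rule ext)
    (simp add: lie_bracket_def spin_field_def rolling_field_linear_def rolling_field_def vmult_simps
      outer_simps vector_outer_mult bounded_bilinear.diff_left[OF bounded_bilinear_matrix_mult] vector_mult_outer_mult inner_commute)

lemma bounded_linear_spin_field: "bounded_linear (spin_field u v)"
  unfolding linear_conv_bounded_linear[symmetric]
  by (auto simp: linear_iff spin_field_def matrix_add_ldistrib
      bounded_bilinear.scaleR_right[OF bounded_bilinear_matrix_mult])

lemma frechet_derivative_spin_field [simp]: "frechet_derivative (spin_field u v) (at q) = spin_field u v"
  by (rule frechet_derivative_at[OF bounded_linear_imp_has_derivative[OF bounded_linear_spin_field], symmetric])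

text \<open>The skew matrix \<open>outer u v - outer v u\<close> sends the unit vector
  \<open>v\<close> to \<open>u\<close>. The bracket applies it to the rolling direction
  \<open>v\<close>, which leaves the field of \<open>u\<close> without its contact velocity.\<close>

lemma lie_bracket_spin_field:
  assumes "v \<bullet> v = 1" "u \<bullet> v = 0"
  shows "lie_bracket (rolling_field v) (spin_field u v) = rolling_field_linear u"
proof
  fix q :: "('a option, 'a) config"
  have "(outer u v - outer v u) ** outer v x = outer u x" for x :: "real^'a option"
    using assms by (simp add: bounded_bilinear.diff_left[OF bounded_bilinear_matrix_mult] vector_mult_outer_mult vector_outer_mult outer_simps)
  moreover have "v v* ((outer u v - outer v u) ** A) = - (u v* A)" for A :: "real^'a option^'a"
    using assms by (simp add: bounded_bilinear.diff_left[OF bounded_bilinear_matrix_mult] vector_mult_outer_mult vector_outer_mult vmult_simps inner_commute)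
  moreover have "(outer u v - outer v u) ** (- B) = - ((outer u v - outer v u) ** B)" for B :: "real^'a option^'a"
    by (simp add: bounded_bilinear.minus_right[OF bounded_bilinear_matrix_mult])
  ultimately show "lie_bracket (rolling_field v) (spin_field u v) q = rolling_field_linear u q"
    by (simp add: lie_bracket_def spin_field_def rolling_field_linear_def rolling_field_def outer_simps)
qed

section \<open>Splitting tangent vectors into rolling, twisting and slipping\<close>

abbreviation rolling_tangent :: "('n::finite option, 'n) config \<Rightarrow> ('n option, 'n) config set" where
  "rolling_tangent q \<equiv> {\<eta>. skew_matrix (frm \<eta> ** transpose (frm q))}"

text \<open>
  The value at \<open>q\<close> of the derived distribution \<open>D\<^sup>2\<close>: the velocities of rolling without slipping,
  twisting being allowed.
\<close>

definition no_slip :: "('n::finite option, 'n) config \<Rightarrow> ('n option, 'n) config set" where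
  "no_slip q = {\<eta> \<in> rolling_tangent q. fst \<eta> = fst (snd \<eta>) v* snd (snd q)}"

lemma subspace_rolling_tangent: "subspace (rolling_tangent q)"
  by (simp add: subspace_def frm_linear skew_matrix_0 skew_matrix_add skew_matrix_scaleR
      linear_0[OF bounded_linear.linear[OF bounded_linear_frm]]
      bounded_bilinear.zero_left[OF bounded_bilinear_matrix_mult]
      bounded_bilinear.add_left[OF bounded_bilinear_matrix_mult]
      bounded_bilinear.scaleR_left[OF bounded_bilinear_matrix_mult])

lemma subspace_no_slip: "subspace (no_slip q)"
  using subspace_rolling_tangent[of q]
  by (simp add: subspace_def no_slip_def vmult_simps)

lemma rolling_field_in_no_slip:
  assumes "q \<in> rolling_space"
  shows "rolling_field u q \<in> no_slip q"
proof -
  obtain x y A where q: "q = (x, y, A)" by (cases q)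
  note R = rotation_frmD[OF assms[unfolded rolling_space_iff q]]
  have Ax: "A $ i \<bullet> x = 0" "x \<bullet> A $ i = 0" for i
    using R(2) by (metis inner_commute matrix_vector_mul_component zero_index)+
  have "A *v (u v* A) = u"
    using R(3) by (metis matrix_vector_mul_assoc matrix_vector_mul_lid transpose_matrix_vector)
  then have Au: "(u v* A) \<bullet> A $ i = u $ i" for i
    by (metis inner_commute matrix_vector_mul_component)
  have ux: "(u v* A) \<bullet> x = 0"
    by (simp add: dot_lmul_matrix R(2))
  have "M $ i $ j = - M $ j $ i" if "M = frm (rolling_field u q) ** transpose (frm q)" for M i j
    unfolding that using R(1,2)
    by (cases i; cases j) (simp_all add: q rolling_field_def Au Ax ux
        matrix_vector_mul_component)
  then have "skew_matrix (frm (rolling_field u q) ** transpose (frm q))"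
    unfolding skew_matrix_iff by blast
  moreover have "fst (rolling_field u q) = fst (snd (rolling_field u q)) v* snd (snd q)"
    by (simp add: rolling_field_def)
  ultimately show ?thesis by (simp add: no_slip_def)
qed

lemma rolling_field_linear_in_tangent:
  assumes "q \<in> rolling_space"
  shows "rolling_field_linear u q \<in> rolling_tangent q"
proof -
  have "frm (rolling_field_linear u q) = frm (rolling_field u q)"
    by (rule frm_eqI) (simp_all add: rolling_field_def rolling_field_linear_def)
  then show ?thesis using rolling_field_in_no_slip[OF assms, of u] by (simp add: no_slip_def)
qed

text \<open>Subtracting the rolling field with the same contact velocity leaves only a component
  \<open>B\<close>. Skewness against the first row gives \<open>B x = 0\<close>, so that
  \<open>B = (B A^T) A\<close>, and \<open>B A^T\<close> is skew.\<close>

lemma no_slip_decompose: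
  assumes q: "q \<in> rolling_space" and \<eta>: "\<eta> \<in> no_slip q"
  obtains M where "skew_matrix M" "\<eta> = rolling_field (fst (snd \<eta>)) q + (0, 0, M ** snd (snd q))"
proof -
  obtain x y A where q': "q = (x, y, A)" by (cases q)
  note R = rotation_frmD[OF q[unfolded rolling_space_iff q']]
  define v where "v = fst (snd \<eta>)"
  define B where "B = snd (snd (\<eta> - rolling_field v q))"
  have eq: "\<eta> - rolling_field v q = (0, 0, B)"
    using \<eta> by (simp add: B_def v_def rolling_field_def no_slip_def prod_eq_iff)
  have "\<eta> - rolling_field v q \<in> no_slip q"
    by (intro subspace_diff[OF subspace_no_slip] \<eta> rolling_field_in_no_slip[OF q])
  then have skew: "skew_matrix (frm (0, 0, B) ** transpose (frm q))" by (simp add: eq no_slip_def)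
  have "(B *v x) $ i = 0" for i
    using skew[unfolded skew_matrix_iff, rule_format, of "Some i" None] by (simp add: q')
  then have Bx: "B *v x = 0" by (simp add: vec_eq_iff)
  have "skew_matrix (B ** transpose A)"
    unfolding skew_matrix_iff
  proof (intro allI)
    show "(B ** transpose A) $ i $ j = - (B ** transpose A) $ j $ i" for i j
      using skew[unfolded skew_matrix_iff, rule_format, of "Some i" "Some j"]
      by (simp add: q' matrix_mult_transpose_nth)
  qed
  moreover have "B ** transpose A ** A = B"
  proof -
    have "B *v (transpose A *v (A *v w)) = B *v w" for w
      by (simp add: R(4) matrix_vector_mult_diff_distrib matrix_vector_mult_scaleR Bx)
    then show ?thesis by (simp add: matrix_eq matrix_vector_mul_assoc matrix_mul_assoc del: transpose_matrix_vector)
  qed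
  moreover have "\<eta> = rolling_field v q + (0, 0, B)" using eq by (simp add: algebra_simps)
  ultimately show thesis using that[of "B ** transpose A"] by (simp add: v_def q')
qed

lemma tangent_decompose:
  assumes q: "q \<in> rolling_space" and \<eta>: "\<eta> \<in> rolling_tangent q"
  obtains z \<zeta> where "\<zeta> \<in> no_slip q" "\<eta> = \<zeta> + rolling_field_linear z q"
proof -
  obtain x y A where q': "q = (x, y, A)" by (cases q)
  note R = rotation_frmD[OF q[unfolded rolling_space_iff q']]
  have "x \<bullet> fst \<eta> = 0"
    using \<eta>[simplified, unfolded skew_matrix_iff, rule_format, of None None] by (simp add: q' inner_commute)
  then have "(A *v fst \<eta>) v* A = fst \<eta>" by (simp add: R(4))
  \<comment> \<open>\<open>z\<close> is the slip: the velocity on the sphere, carried over by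
    \<open>A\<close>, minus the contact velocity.\<close>
  moreover define z where "z = A *v fst \<eta> - fst (snd \<eta>)"
  ultimately have "fst (\<eta> - rolling_field_linear z q) = fst (snd \<eta>) v* A"
    by (simp add: rolling_field_linear_def q' vmult_simps)
  moreover have "\<eta> - rolling_field_linear z q \<in> rolling_tangent q"
    by (intro subspace_diff[OF subspace_rolling_tangent] \<eta> rolling_field_linear_in_tangent[OF q])
  ultimately have "\<eta> - rolling_field_linear z q \<in> no_slip q"
    by (simp add: no_slip_def q' rolling_field_linear_def)
  then show thesis using that[of "\<eta> - rolling_field_linear z q" z] by simp
qed


section \<open>The flag\<close>

lemma flag_section_smooth:
  "flag_section Q D W k X \<Longrightarrow> open W \<Longrightarrow> smooth_on W X"
  by (induction rule: flag_section.induct) (auto intro: smooth_on_lie_bracket smooth_on_add)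

lemma flag_section_level_pos: "flag_section Q D W k X \<Longrightarrow> 1 \<le> k"
  by (induction rule: flag_section.induct) auto

lemma flag_section_Suc: "flag_section Q D W k X \<Longrightarrow> flag_section Q D W (Suc k) X"
  by (induction rule: flag_section.induct) (auto intro: flag_section.intros)

lemma flag_section_mono: "k \<le> l \<Longrightarrow> flag_section Q D W k X \<Longrightarrow> flag_section Q D W l X"
  by (induction rule: dec_induct) (auto intro: flag_section_Suc)

text \<open>The skewness condition for \<open>Z\<close> is differentiated along \<open>Y q\<close>
  and the one for \<open>Y\<close> along \<open>Z q\<close>. The terms containing both values form
  the same symmetric matrix in the two equations and drop out of the difference.\<close>

lemma lie_bracket_tangent:
  fixes Y Z :: "('n::finite option, 'n) config \<Rightarrow> ('n option, 'n) config"
  assumes W: "open W" "q \<in> W" "q \<in> rolling_space" and smooth: "smooth_on W Y" "smooth_on W Z"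
    and Y: "\<And>p. p \<in> rolling_space \<inter> W \<Longrightarrow> Y p \<in> rolling_tangent p"
    and Z: "\<And>p. p \<in> rolling_space \<inter> W \<Longrightarrow> Z p \<in> rolling_tangent p"
  shows "lie_bracket Y Z q \<in> rolling_tangent q"
proof -
  let ?C = "\<lambda>X p. frm (X p) ** transpose (frm p)"
  let ?d = "\<lambda>X. frechet_derivative X (at q)"
  have der: "frm (X q) ** transpose (frm v) + frm (?d X v) ** transpose (frm q) +
      transpose (frm (X q) ** transpose (frm v) + frm (?d X v) ** transpose (frm q)) = 0"
    if X: "smooth_on W X" "\<And>p. p \<in> rolling_space \<inter> W \<Longrightarrow> X p \<in> rolling_tangent p"
      and v: "v \<in> rolling_tangent q" for X v
  proof -
    note h = frm_constraint_has_derivative[OF smooth_on_imp_has_derivative[OF X(1) W(2)]]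
    show ?thesis
    proof (rule tangent_space_has_derivative_eq[OF _ W(1,2) _ _ has_derivative_const[of 0],
          of v rolling_space "\<lambda>p. ?C X p + transpose (?C X p)"])
      show "v \<in> tangent_space rolling_space q"
        using v tangent_space_rolling_space[OF W(3)] by blast
      show "?C X p + transpose (?C X p) = 0" if "p \<in> rolling_space \<inter> W" for p
        using X(2)[OF that] by (simp add: skew_matrix_def)
      show "((\<lambda>p. ?C X p + transpose (?C X p)) has_derivative
          (\<lambda>v. frm (X q) ** transpose (frm v) + frm (?d X v) ** transpose (frm q) +
            transpose (frm (X q) ** transpose (frm v) + frm (?d X v) ** transpose (frm q)))) (at q)"
        by (intro has_derivative_add h bounded_linear.has_derivative[OF bounded_linear_transpose h])
    qed
  qed
  have "Y q \<in> rolling_tangent q" "Z q \<in> rolling_tangent q" using Y Z W by blast+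
  then have "frm (lie_bracket Y Z q) ** transpose (frm q) + transpose (frm (lie_bracket Y Z q) ** transpose (frm q)) = 0"
    using der[OF smooth(2) Z, of "Y q"] der[OF smooth(1) Y, of "Z q"]
    by (simp add: lie_bracket_def frm_linear linear_add[OF linear_transpose] linear_diff[OF linear_transpose]
        bounded_bilinear.diff_left[OF bounded_bilinear_matrix_mult] matrix_transpose_mul algebra_simps)
      (metis add_left_cancel)
  then show ?thesis by (simp add: skew_matrix_def add_eq_0_iff)
qed

text \<open>Differentiating \<open>x' = A^T y'\<close> along the other field produces a term with
  the derivative of \<open>A\<close>. For two values in \<open>D\<close> it is the multiple
  \<open>- (u \<bullet> w)\<close> of \<open>x\<close>, symmetric in the fields, and cancels. With a
  twist component it need not cancel, so slipping can appear one level later.\<close>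

lemma lie_bracket_no_slip:
  fixes Y Z :: "('n::finite option, 'n) config \<Rightarrow> ('n option, 'n) config"
  assumes W: "open W" "q \<in> W" "q \<in> rolling_space" and smooth: "smooth_on W Y" "smooth_on W Z"
    and Y: "\<And>p. p \<in> rolling_space \<inter> W \<Longrightarrow> Y p \<in> range (\<lambda>u. rolling_field u p)"
    and Z: "\<And>p. p \<in> rolling_space \<inter> W \<Longrightarrow> Z p \<in> range (\<lambda>u. rolling_field u p)"
  shows "lie_bracket Y Z q \<in> no_slip q"
proof -
  let ?d = "\<lambda>X. frechet_derivative X (at q)"
  note bl = bilinear_vector_matrix_mult[unfolded bilinear_conv_bounded_bilinear]
  have slip: "X p \<in> no_slip p" if "p \<in> rolling_space" "X p \<in> range (\<lambda>u. rolling_field u p)" for X p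
    using that by (auto simp: rolling_field_in_no_slip)
  have der: "fst (?d X v) = fst (snd (X q)) v* snd (snd v) + fst (snd (?d X v)) v* snd (snd q)"
    if X: "smooth_on W X" "\<And>p. p \<in> rolling_space \<inter> W \<Longrightarrow> X p \<in> range (\<lambda>u. rolling_field u p)"
      and v: "v \<in> rolling_tangent q" for X :: "('n option, 'n) config \<Rightarrow> ('n option, 'n) config" and v
  proof (rule tangent_space_has_derivative_eq[where M = rolling_space and f = "\<lambda>p. fst (X p)"
        and f' = "\<lambda>v. fst (?d X v)" and g = "\<lambda>p. fst (snd (X p)) v* snd (snd p)"
        and g' = "\<lambda>v. fst (snd (X q)) v* snd (snd v) + fst (snd (?d X v)) v* snd (snd q)", OF _ W(1,2)])
    note h = smooth_on_imp_has_derivative[OF X(1) W(2)]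
    show "v \<in> tangent_space rolling_space q"
      using v tangent_space_rolling_space[OF W(3)] by blast
    show "fst (X p) = fst (snd (X p)) v* snd (snd p)" if "p \<in> rolling_space \<inter> W" for p
      using slip[of p X] X(2)[OF that] that by (simp add: no_slip_def)
    show "((\<lambda>p. fst (X p)) has_derivative (\<lambda>v. fst (?d X v))) (at q)"
      by (intro has_derivative_fst h)
    show "((\<lambda>p. fst (snd (X p)) v* snd (snd p)) has_derivative
        (\<lambda>v. fst (snd (X q)) v* snd (snd v) + fst (snd (?d X v)) v* snd (snd q))) (at q)"
      by (intro bounded_bilinear.FDERIV[OF bl] has_derivative_fst has_derivative_snd h has_derivative_ident)
  qed
  obtain u w where uw: "Y q = rolling_field u q" "Z q = rolling_field w q" using Y[of q] Z[of q] W by blast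
  have T: "Y p \<in> rolling_tangent p" "Z p \<in> rolling_tangent p" if "p \<in> rolling_space \<inter> W" for p
    using that slip[of p Y] slip[of p Z] Y Z by (auto simp: no_slip_def)
  have "Y q \<in> rolling_tangent q" "Z q \<in> rolling_tangent q" using T W by blast+
  from der[OF smooth(2) Z this(1)] der[OF smooth(1) Y this(2)]
  have "fst (lie_bracket Y Z q) = fst (snd (lie_bracket Y Z q)) v* snd (snd q)"
    by (simp add: lie_bracket_def uw vmult_simps)
      (simp add: rolling_field_def vmult_simps vector_outer_mult inner_commute)
  then show ?thesis
    using lie_bracket_tangent[OF W smooth T] by (simp add: no_slip_def)
qed

text \<open>A slip in a coordinate direction has contact velocity \<open>0\<close> but moves
  \<open>x\<close>.\<close>

lemma no_slip_psubset_tangent: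
  fixes q :: "('n::finite option, 'n) config"
  assumes q: "q \<in> rolling_space"
  shows "no_slip q \<subset> rolling_tangent q"
proof -
  obtain x y A where q': "q = (x, y, A)" by (cases q)
  note R = rotation_frmD[OF q[unfolded rolling_space_iff q']]
  fix i :: 'n
  have "A *v (axis i 1 v* A) = axis i 1"
    using R(3) by (metis matrix_vector_mul_assoc matrix_vector_mul_lid transpose_matrix_vector)
  then have "axis i 1 v* A \<noteq> 0"
    by (metis axis_eq_0_iff matrix_vector_mult_0_right zero_neq_one)
  then have "rolling_field_linear (axis i 1) q \<notin> no_slip q"
    by (simp add: no_slip_def rolling_field_linear_def q' vmult_simps)
  then show ?thesis
    using rolling_field_linear_in_tangent[OF q] by (auto simp: no_slip_def)
qed

text \<open>Separates the computation of the flag from frames and trivializations; all that is known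
  about \<open>D\<close> is its value at each configuration.\<close>

locale rolling_flag =
  fixes D :: "('n::finite option, 'n) config \<Rightarrow> ('n option, 'n) config set"
  assumes D: "\<And>p. p \<in> rolling_space \<Longrightarrow> D p = range (\<lambda>u. rolling_field u p)"
    and card: "2 \<le> CARD('n)"
begin

text \<open>Levels start at \<open>1\<close> and a bracket raises the level, so no bracket occurs
  here.\<close>

lemma flag_section_1:
  "flag_section rolling_space D W k X \<Longrightarrow> k = 1 \<Longrightarrow> p \<in> rolling_space \<inter> W \<Longrightarrow> X p \<in> D p"
proof (induction rule: flag_section.induct)
  case (sum k X Y)
  have "subspace (D p)"
    using sum.prems by (auto simp: D intro: linear_subspace_image[OF linear_rolling_field])
  then show ?case using sum by (simp add: subspace_add)
qed (auto dest: flag_section_level_pos)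

lemma flag_section_tangent:
  "flag_section rolling_space D W k X \<Longrightarrow> open W \<Longrightarrow> p \<in> rolling_space \<inter> W \<Longrightarrow> X p \<in> rolling_tangent p"
proof (induction arbitrary: p rule: flag_section.induct)
  case (section_of_D k X)
  then obtain u where "X p = rolling_field u p" using D[of p] by blast
  then have "X p \<in> no_slip p" using section_of_D.prems rolling_field_in_no_slip[of p] by simp
  then show ?case by (simp add: no_slip_def)
next
  case (bracket Y k Z)
  show ?case
  proof (rule lie_bracket_tangent[OF bracket.prems(1)])
    show "smooth_on W Y" "smooth_on W Z"
      using bracket.hyps bracket.prems(1) by (auto intro: flag_section_smooth)
  qed (use bracket in simp_all)
next
  case (sum k X Y)
  then show ?case using subspace_add[OF subspace_rolling_tangent] by blast
qed

lemma flag_section_2: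
  "flag_section rolling_space D W k X \<Longrightarrow> k = 2 \<Longrightarrow> open W \<Longrightarrow> p \<in> rolling_space \<inter> W \<Longrightarrow> X p \<in> no_slip p"
proof (induction rule: flag_section.induct)
  case (section_of_D k X)
  then obtain u where "X p = rolling_field u p" using D[of p] by blast
  then show ?case using section_of_D.prems rolling_field_in_no_slip[of p] by simp
next
  case (bracket Y k Z)
  then have "k = 1" by simp
  have mem: "Y p \<in> range (\<lambda>u. rolling_field u p)" "Z p \<in> range (\<lambda>u. rolling_field u p)"
    if "p \<in> rolling_space \<inter> W" for p
    using flag_section_1[OF bracket.hyps(1) refl that] flag_section_1[OF bracket.hyps(2) \<open>k = 1\<close> that] D that
    by blast+
  show ?case
  proof (rule lie_bracket_no_slip[OF bracket.prems(2) _ _ _ _ mem])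
    show "smooth_on W Y" "smooth_on W Z"
      using bracket.hyps bracket.prems(2) by (auto intro: flag_section_smooth)
  qed (use bracket.prems in simp_all)
next
  case (sum k X Y)
  then show ?case using subspace_add[OF subspace_no_slip] by blast
qed

lemma flag_section_rolling_field: "1 \<le> k \<Longrightarrow> flag_section rolling_space D UNIV k (rolling_field u)"
  by (rule flag_section.section_of_D) (auto simp: smooth_on_rolling_field D)

lemma flag_section_spin_field: "flag_section rolling_space D UNIV 2 (spin_field u v)"
  using flag_section.bracket[OF flag_section_rolling_field flag_section_rolling_field, of 1 u v]
  by (simp add: lie_bracket_rolling_field numeral_2_eq_2)

lemma flag_section_rolling_field_linear: "flag_section rolling_space D UNIV 3 (rolling_field_linear u)"
proof -
  \<comment> \<open>\<open>n \<ge> 2\<close> provides the direction orthogonal to \<open>u\<close>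
    from which the slip along \<open>u\<close> is bracketed.\<close>
  have "DIM(real^'n) \<ge> 2" using card by simp
  then obtain w where w: "w \<noteq> 0" "orthogonal u w"
    using orthogonal_to_vector_exists[of u] by blast
  define v where "v = w /\<^sub>R norm w"
  have "v \<bullet> v = 1" "u \<bullet> v = 0"
    using w by (auto simp: v_def orthogonal_def dot_square_norm power2_eq_square)
  then show ?thesis
    using flag_section.bracket[OF flag_section_rolling_field[of 1 v] flag_section_spin_field[of u v]]
    by (simp add: lie_bracket_spin_field numeral_3_eq_3 numeral_2_eq_2)
qed

lemma no_slip_subset_flag:
  assumes q: "q \<in> rolling_space" and \<eta>: "\<eta> \<in> no_slip q"
  shows "\<exists>X. flag_section rolling_space D UNIV 2 X \<and> X q = \<eta>"
proof -
  obtain M where M: "skew_matrix M" "\<eta> = rolling_field (fst (snd \<eta>)) q + (0, 0, M ** snd (snd q))"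
    using no_slip_decompose[OF q \<eta>] .
  from M(1) have "\<exists>X. flag_section rolling_space D UNIV 2 X \<and> X q = (0, 0, M ** snd (snd q))"
  proof (induction rule: skew_matrix_induct)
    case zero
    have "spin_field 0 0 q = (0, 0, 0 ** snd (snd q))" by (simp add: spin_field_def)
    then show ?case using flag_section_spin_field by blast
  next
    case (add A B)
    then obtain X Y where "flag_section rolling_space D UNIV 2 X" "X q = (0, 0, A ** snd (snd q))"
      "flag_section rolling_space D UNIV 2 Y" "Y q = (0, 0, B ** snd (snd q))" by blast
    then show ?case
      by (intro exI[of _ "\<lambda>p. X p + Y p"])
        (auto intro: flag_section.sum simp: bounded_bilinear.add_left[OF bounded_bilinear_matrix_mult])
  next
    case (generator c i j)
    \<comment> \<open>The coefficient is absorbed into the first vector, since the rules for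
      sections form sums but no multiples.\<close>
    have "spin_field (c *\<^sub>R axis j 1) (axis i 1) q =
        (0, 0, (c *\<^sub>R (outer (axis j 1) (axis i 1) - outer (axis i 1) (axis j 1))) ** snd (snd q))"
      by (simp add: spin_field_def outer_simps algebra_simps)
    then show ?case using flag_section_spin_field by blast
  qed
  then obtain X where X: "flag_section rolling_space D UNIV 2 X" "X q = (0, 0, M ** snd (snd q))" by blast
  then show ?thesis
    using M(2) by (intro exI[of _ "\<lambda>p. rolling_field (fst (snd \<eta>)) p + X p"])
      (auto intro!: flag_section.sum flag_section_rolling_field)
qed

lemma tangent_subset_flag:
  assumes q: "q \<in> rolling_space" and \<eta>: "\<eta> \<in> rolling_tangent q"
  shows "\<exists>X. flag_section rolling_space D UNIV 3 X \<and> X q = \<eta>"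
proof -
  obtain z \<zeta> where z: "\<zeta> \<in> no_slip q" "\<eta> = \<zeta> + rolling_field_linear z q"
    using tangent_decompose[OF q \<eta>] .
  obtain X where "flag_section rolling_space D UNIV 2 X" "X q = \<zeta>"
    using no_slip_subset_flag[OF q z(1)] by blast
  then have "flag_section rolling_space D UNIV 3 X" "X q = \<zeta>"
    using flag_section_mono[of 2 3] by auto
  then show ?thesis
    using z(2) by (intro exI[of _ "\<lambda>p. X p + rolling_field_linear z p"])
      (auto intro!: flag_section.sum flag_section_rolling_field_linear)
qed

lemma flag_1: "q \<in> rolling_space \<Longrightarrow> flag rolling_space D 1 q = D q"
proof (intro equalityI subsetI)
  assume q: "q \<in> rolling_space"
  show "\<eta> \<in> flag rolling_space D 1 q" if "\<eta> \<in> D q" for \<eta>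
    using that q D[OF q] flag_section_rolling_field[of 1] unfolding flag_def by blast
  show "\<eta> \<in> D q" if "\<eta> \<in> flag rolling_space D 1 q" for \<eta>
    using that q flag_section_1[OF _ refl] unfolding flag_def by blast
qed

lemma flag_2: "q \<in> rolling_space \<Longrightarrow> flag rolling_space D 2 q = no_slip q"
proof (intro equalityI subsetI)
  assume q: "q \<in> rolling_space"
  show "\<eta> \<in> flag rolling_space D 2 q" if "\<eta> \<in> no_slip q" for \<eta>
    using no_slip_subset_flag[OF q that] unfolding flag_def by blast
  show "\<eta> \<in> no_slip q" if "\<eta> \<in> flag rolling_space D 2 q" for \<eta>
    using that q flag_section_2[OF _ refl] unfolding flag_def by blast
qed

lemma flag_ge_3: "q \<in> rolling_space \<Longrightarrow> 3 \<le> k \<Longrightarrow> flag rolling_space D k q = rolling_tangent q"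
proof (intro equalityI subsetI)
  assume q: "q \<in> rolling_space" and k: "3 \<le> k"
  show "\<eta> \<in> flag rolling_space D k q" if "\<eta> \<in> rolling_tangent q" for \<eta>
    using tangent_subset_flag[OF q that] flag_section_mono[OF k] unfolding flag_def by blast
  show "\<eta> \<in> rolling_tangent q" if "\<eta> \<in> flag rolling_space D k q" for \<eta>
    using that q flag_section_tangent unfolding flag_def by blast
qed

lemma has_step_3: "has_step rolling_space D 3"
  unfolding has_step_def
proof
  fix q :: "('n option, 'n) config" assume q: "q \<in> rolling_space"
  \<comment> \<open>From level \<open>3\<close> on the flag is the whole tangent space, so it cannot
    grow at any \<open>l \<ge> 4\<close>.\<close>
  have "l \<le> 3" if "flag rolling_space D (l - 1) q \<subset> flag rolling_space D l q" for l
    using that flag_ge_3[OF q, of "l - 1"] flag_ge_3[OF q, of l] by (cases "4 \<le> l") auto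
  moreover have "flag rolling_space D 2 q \<subset> flag rolling_space D 3 q"
    using no_slip_psubset_tangent[OF q] flag_ge_3[OF q, of 3] flag_2[OF q] by simp
  moreover have "flag rolling_space D 3 q = flag rolling_space D (3 + 1) q"
    using flag_ge_3[OF q, of 3] flag_ge_3[OF q, of "3 + 1"] by simp
  ultimately show "has_step_at rolling_space D 3 q"
    unfolding has_step_at_def Let_def by auto
qed

lemma bracket_generating: "bracket_generating rolling_space D"
  unfolding bracket_generating_def
  by (intro exI[of _ 3]) (simp add: flag_ge_3 tangent_space_rolling_space)

end

text \<open>
  Right translation by the rotation taking the configuration \<open>p\<close> to \<open>q\<close> preserves the flag, so
  that its dimensions are constant.
\<close>

definition translate ::
  "('n::finite option, 'n) config \<Rightarrow> ('n option, 'n) config \<Rightarrow> ('n option, 'n) config \<Rightarrow> ('n option, 'n) config"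
  where "translate p q \<eta> = cfg (fst (snd \<eta>)) (frm \<eta> ** (transpose (frm p) ** frm q))"

lemma linear_translate: "linear (translate p q)"
  by (auto simp: linear_iff translate_def cfg_def frm_linear vec_eq_iff
      bounded_bilinear.add_left[OF bounded_bilinear_matrix_mult]
      bounded_bilinear.scaleR_left[OF bounded_bilinear_matrix_mult])

lemma translate_inverse:
  assumes "p \<in> rolling_space" "q \<in> rolling_space"
  shows "translate q p (translate p q \<eta>) = \<eta>"
proof -
  have "frm \<eta> ** (transpose (frm p) ** frm q) ** (transpose (frm q) ** frm p) =
      frm \<eta> ** (transpose (frm p) ** (frm q ** transpose (frm q)) ** frm p)"
    by (simp only: matrix_mul_assoc)
  also have "\<dots> = frm \<eta>"
    using assms by (simp add: rolling_space_iff rotation_matrixD)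
  finally have "frm \<eta> ** (transpose (frm p) ** frm q) ** (transpose (frm q) ** frm p) = frm \<eta>" .
  then show ?thesis by (simp add: translate_def)
qed

lemma dim_translate_le:
  assumes "p \<in> rolling_space" "q \<in> rolling_space" "translate p q ` S \<subseteq> T"
  shows "dim S \<le> dim T"
proof -
  have "inj_on (translate p q) (span S)"
    using translate_inverse[OF assms(1,2)] by (metis inj_onI)
  then have "dim S = dim (translate p q ` S)"
    using dim_image_eq[OF linear_translate] by metis
  also have "\<dots> \<le> dim T" by (rule dim_subset[OF assms(3)])
  finally show ?thesis .
qed

lemma translate_rolling_tangent:
  assumes "p \<in> rolling_space" "q \<in> rolling_space" "\<eta> \<in> rolling_tangent p"
  shows "translate p q \<eta> \<in> rolling_tangent q"
proof -
  have "frm (translate p q \<eta>) ** transpose (frm q) =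
      frm \<eta> ** transpose (frm p) ** (frm q ** transpose (frm q))"
    by (simp add: translate_def matrix_mul_assoc)
  also have "\<dots> = frm \<eta> ** transpose (frm p)"
    using assms(2) by (simp add: rolling_space_iff rotation_matrixD)
  finally have "frm (translate p q \<eta>) ** transpose (frm q) = frm \<eta> ** transpose (frm p)" .
  then show ?thesis using assms(3) by simp
qed

lemma translate_no_slip:
  assumes "p \<in> rolling_space" "q \<in> rolling_space" "\<eta> \<in> no_slip p"
  shows "translate p q \<eta> \<in> no_slip q"
proof -
  \<comment> \<open>With the contact velocity padded by a zero to \<open>?w\<close>, the absence of
    slipping reads \<open>fst \<eta> = ?w v* frm p\<close>, a condition that survives multiplication
    by \<open>?g\<close> from the right.\<close>
  let ?g = "transpose (frm p) ** frm q" and ?w = "\<chi> a. case a of None \<Rightarrow> 0 | Some i \<Rightarrow> fst (snd \<eta>) $ i"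
  have w: "fst (snd \<eta>) v* snd (snd r) = ?w v* frm r" for r :: "('a option, 'a) config"
    by (simp add: vector_frm_mult vec_lambda_eta)
  have g: "frm p ** ?g = frm q"
    using assms(1) by (simp add: matrix_mul_assoc rolling_space_iff rotation_matrixD)
  have "fst (translate p q \<eta>) = fst \<eta> v* ?g"
    by (simp add: translate_def matrix_matrix_mult_def vector_matrix_mult_def vec_eq_iff mult.commute)
  also have "fst \<eta> = ?w v* frm p" using assms(3) w by (simp add: no_slip_def)
  also have "?w v* frm p v* ?g = ?w v* frm q"
    by (simp only: vector_matrix_mul_assoc g)
  finally show ?thesis
    using assms translate_rolling_tangent[OF assms(1,2)] w
    by (simp add: no_slip_def) (simp add: translate_def)
qed

lemma inj_rolling_field: "inj (\<lambda>u. rolling_field u q)"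
  by (simp add: inj_def rolling_field_def)

lemma dim_range_rolling_field: "dim (range (\<lambda>u :: real^'n. rolling_field u q)) = CARD('n::finite)"
  using dim_image_eq[OF linear_rolling_field, of q UNIV] inj_rolling_field[of q] by simp

context rolling_flag begin

lemma regular: "regular_distribution rolling_space D"
  unfolding regular_distribution_def
proof (intro allI impI ballI)
  fix k :: nat and p q :: "('n option, 'n) config"
  assume k: "1 \<le> k" and p: "p \<in> rolling_space" and q: "q \<in> rolling_space"
  have T: "dim (rolling_tangent p) \<le> dim (rolling_tangent q)"
    and S: "dim (no_slip p) \<le> dim (no_slip q)"
    if "p \<in> rolling_space" "q \<in> rolling_space" for p q :: "('n option, 'n) config"
    using translate_rolling_tangent[OF that] translate_no_slip[OF that]
    by (intro dim_translate_le[OF that] image_subsetI; blast)+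
  consider "k = 1" | "k = 2" | "3 \<le> k" using k by linarith
  then show "dim (flag rolling_space D k p) = dim (flag rolling_space D k q)"
  proof cases
    case 1
    then show ?thesis using p q by (simp only: flag_1 D dim_range_rolling_field)
  next
    case 2
    then show ?thesis using S[OF p q] S[OF q p] p q by (simp add: flag_2)
  next
    case 3
    then show ?thesis using T[OF p q] T[OF q p] p q by (simp only: flag_ge_3)
  qed
qed

lemma smooth_distribution: "smooth_distribution rolling_space D CARD('n)"
  unfolding smooth_distribution_def
proof (intro conjI ballI)
  fix p :: "('n option, 'n) config" assume p: "p \<in> rolling_space"
  show "subspace (D p)"
    using p by (auto simp: D intro: linear_subspace_image[OF linear_rolling_field])
  show "D p \<subseteq> tangent_space rolling_space p"
    unfolding D[OF p] tangent_space_rolling_space[OF p]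
    using rolling_field_in_no_slip[OF p] unfolding no_slip_def by blast
  show "dim (D p) = CARD('n)" using p by (simp only: D dim_range_rolling_field)
  obtain h :: "nat \<Rightarrow> 'n" where h: "bij_betw h {..<CARD('n)} UNIV"
    using ex_bij_betw_nat_finite[OF finite[of "UNIV :: 'n set"]] by (auto simp: atLeast0LessThan)
  have "D p' = span ((\<lambda>i. rolling_field (axis (h i) 1) p') ` {..<CARD('n)})" if "p' \<in> rolling_space" for p'
  proof -
    have "(\<lambda>i. rolling_field (axis (h i) 1) p') ` {..<CARD('n)} =
        (\<lambda>u. rolling_field u p') ` (\<lambda>i. axis i 1) ` (h ` {..<CARD('n)})" by (simp add: image_image)
    also have "\<dots> = (\<lambda>u. rolling_field u p') ` Basis"
      using h by (auto simp: bij_betw_def Basis_vec_def)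
    finally show ?thesis
      using linear_span_image[OF linear_rolling_field, of p' Basis] D[OF that] by simp
  qed
  then show "\<exists>W X. open W \<and> p \<in> W \<and> (\<forall>i<CARD('n). smooth_on W (X i)) \<and>
      (\<forall>p'\<in>rolling_space \<inter> W. D p' = span ((\<lambda>i. X i p') ` {..<CARD('n)}))"
    by (intro exI[of _ UNIV] exI[of _ "\<lambda>i. rolling_field (axis (h i) 1)"])
      (auto simp: smooth_on_rolling_field)
qed

end


section \<open>The rolling distribution\<close>

text \<open>The vectors are the rows of a square matrix, whose right inverse is also a left
  inverse.\<close>

lemma orthonormal_expansion:
  fixes f :: "'n::finite \<Rightarrow> real^'n"
  assumes "\<And>i j. f i \<bullet> f j = (if i = j then 1 else 0)"
  shows "(\<Sum>i\<in>UNIV. (w \<bullet> f i) *\<^sub>R f i) = w"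
proof -
  let ?F = "\<chi> i. f i"
  have "?F ** transpose ?F = mat 1"
    using assms by (simp add: vec_eq_iff matrix_mult_transpose_nth mat_def)
  then have "transpose ?F ** ?F = mat 1" by (simp add: matrix_left_right_inverse)
  then have "transpose ?F *v (?F *v w) = w"
    by (simp add: matrix_vector_mul_assoc del: transpose_matrix_vector)
  then show ?thesis
    by (simp add: vector_matrix_mult_eq_sum matrix_vector_mul_component inner_commute)
qed

lemma W_field_nth:
  "W_field i j a $ r $ s = (if s = j then a $ r $ i else 0) - (if s = i then a $ r $ j else 0)"
proof -
  have "W_field i j a $ r $ s = (\<Sum>t\<in>UNIV. if t = r then (if s = j then a $ r $ i else 0) - (if s = i then a $ r $ j else 0) else 0)"
    unfolding W_field_def sum_component by (intro sum.cong) (auto simp: axis_def)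
  then show ?thesis by simp
qed

text \<open>\<open>W_field i j a\<close> is \<open>a\<close> times an elementary skew matrix, a
  left-invariant field on the rotation group. With skew coefficients, the sum over
  \<open>i < j\<close> is therefore the matrix product of \<open>a\<close> and
  \<open>c\<close>.\<close>

lemma sum_W_field:
  fixes c :: "'n::{finite,linorder} \<Rightarrow> 'n \<Rightarrow> real"
  assumes skew: "\<And>i j. c i j = - c j i"
  shows "(\<Sum>(i, j)\<in>{(i, j). i < j}. c i j *\<^sub>R W_field i j a) $ r $ s = (\<Sum>k\<in>UNIV. a $ r $ k * c k s)"
proof -
  have "(\<Sum>(i, j)\<in>{(i, j). i < j}. c i j *\<^sub>R W_field i j a) $ r $ s =
      (\<Sum>p\<in>{p \<in> UNIV. fst p < snd p}. c (fst p) (snd p) * W_field (fst p) (snd p) a $ r $ s)"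
    by (simp add: sum_component case_prod_unfold)
  also have "\<dots> = (\<Sum>p\<in>UNIV \<times> UNIV. if fst p < snd p then c (fst p) (snd p) * W_field (fst p) (snd p) a $ r $ s else 0)"
    by (subst sum.inter_filter) auto
  also have "\<dots> = (\<Sum>i\<in>UNIV. \<Sum>j\<in>UNIV. if i < j then c i j * W_field i j a $ r $ s else 0)"
    by (simp add: sum.cartesian_product case_prod_unfold)
  also have "\<dots> = (\<Sum>i\<in>UNIV. \<Sum>j\<in>UNIV. if s = j then (if i < j then c i j * a $ r $ i else 0) else 0)
      - (\<Sum>i\<in>UNIV. \<Sum>j\<in>UNIV. if s = i then (if i < j then c i j * a $ r $ j else 0) else 0)"
    unfolding sum_subtractf[symmetric] by (intro sum.cong) (auto simp: W_field_nth algebra_simps)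
  also have "(\<Sum>i\<in>UNIV. \<Sum>j\<in>UNIV. if s = i then (if i < j then c i j * a $ r $ j else 0) else 0) =
      (\<Sum>j\<in>UNIV. \<Sum>i\<in>UNIV. if s = i then (if i < j then c i j * a $ r $ j else 0) else 0)"
    by (rule sum.swap)
  also have "(\<Sum>i\<in>UNIV. \<Sum>j\<in>UNIV. if s = j then (if i < j then c i j * a $ r $ i else 0) else 0) -
      (\<Sum>j\<in>UNIV. \<Sum>i\<in>UNIV. if s = i then (if i < j then c i j * a $ r $ j else 0) else 0) =
      (\<Sum>k\<in>UNIV. (if k < s then c k s * a $ r $ k else 0) - (if s < k then c s k * a $ r $ k else 0))"
    by (simp add: sum_subtractf)
  also have "\<dots> = (\<Sum>k\<in>UNIV. a $ r $ k * c k s)"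
  proof (rule sum.cong[OF refl])
    fix k
    have "k = s \<Longrightarrow> c k s = 0" using skew[of s s] by simp
    then show "(if k < s then c k s * a $ r $ k else 0) - (if s < k then c s k * a $ r $ k else 0) = a $ r $ k * c k s"
      using skew[of s k] by (cases k s rule: linorder_cases) auto
  qed
  finally show ?thesis .
qed

lemma has_derivative_matrix:
  fixes f :: "'a::euclidean_space \<Rightarrow> real^'n^'m"
  assumes "\<And>i j. ((\<lambda>x. f x $ i $ j) has_derivative (\<lambda>h. f' h $ i $ j)) (at q)"
  shows "(f has_derivative f') (at q)"
proof -
  have "((\<lambda>x. f x \<bullet> b) has_derivative (\<lambda>h. f' h \<bullet> b)) (at q)" if b: "b \<in> Basis" for b
  proof -
    obtain i j where "b = axis i (axis j 1)" using b by (auto simp: Basis_vec_def)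
    then show ?thesis using assms by (simp add: inner_axis)
  qed
  then show ?thesis by (subst has_derivative_componentwise_within) blast
qed

lemma bounded_bilinear_matrix_vector_mult:
  "bounded_bilinear (\<lambda>(A :: real^'n^'m) v. A *v v)"
  unfolding bilinear_conv_bounded_bilinear[symmetric]
  by (auto simp: bilinear_def linear_iff matrix_vector_mult_def vec_eq_iff sum.distrib
      sum_distrib_left algebra_simps)

lemma trivialization_has_derivative:
  fixes q :: "('n::finite option, 'n) config"
  assumes e: "\<And>j. (e j has_derivative De j) (at (fst q))"
    and e': "\<And>i. (e' i has_derivative De' i) (at (fst (snd q)))"
  shows "(trivialization e e' has_derivative (\<lambda>\<eta>. (fst \<eta>, fst (snd \<eta>),
    \<chi> i j. (snd (snd \<eta>) *v e j (fst q)) \<bullet> e' i (fst (snd q))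
      + (snd (snd q) *v De j (fst \<eta>)) \<bullet> e' i (fst (snd q))
      + (snd (snd q) *v e j (fst q)) \<bullet> De' i (fst (snd \<eta>))))) (at q)"
proof -
  have tr: "trivialization e e' = (\<lambda>q. (fst q, fst (snd q), frame_matrix e e' q))"
    by (simp add: trivialization_def fun_eq_iff)
  have x: "((\<lambda>q. e j (fst q)) has_derivative (\<lambda>\<eta>. De j (fst \<eta>))) (at q)" for j
    by (rule has_derivative_compose[OF has_derivative_fst[OF has_derivative_ident] e])
  have y: "((\<lambda>q. e' i (fst (snd q))) has_derivative (\<lambda>\<eta>. De' i (fst (snd \<eta>)))) (at q)" for i
    by (rule has_derivative_compose[OF has_derivative_fst[OF has_derivative_snd[OF has_derivative_ident]] e'])
  show ?thesis unfolding tr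
  proof (intro has_derivative_Pair has_derivative_fst has_derivative_snd has_derivative_ident has_derivative_matrix)
    fix i j
    have "((\<lambda>p. (snd (snd p) *v e j (fst p)) \<bullet> e' i (fst (snd p))) has_derivative
       (\<lambda>\<eta>. (snd (snd q) *v e j (fst q)) \<bullet> De' i (fst (snd \<eta>))
         + (snd (snd q) *v De j (fst \<eta>) + snd (snd \<eta>) *v e j (fst q)) \<bullet> e' i (fst (snd q)))) (at q)"
      by (intro has_derivative_inner bounded_bilinear.FDERIV[OF bounded_bilinear_matrix_vector_mult]
          x y has_derivative_snd has_derivative_ident)
    then show "((\<lambda>p. frame_matrix e e' p $ i $ j) has_derivative
       (\<lambda>\<eta>. (\<chi> i j. (snd (snd \<eta>) *v e j (fst q)) \<bullet> e' i (fst (snd q))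
        + (snd (snd q) *v De j (fst \<eta>)) \<bullet> e' i (fst (snd q))
        + (snd (snd q) *v e j (fst q)) \<bullet> De' i (fst (snd \<eta>))) $ i $ j)) (at q)"
      by (simp add: frame_matrix_def case_prod_unfold inner_add_left add_ac)
  qed
qed

lemma rotation_isometry:
  assumes "rotation_matrix (frm (x, y, A))" "x \<bullet> v = 0"
  shows "(A *v w) \<bullet> (A *v v) = w \<bullet> v"
  using rotation_frmD[OF assms(1)] assms(2)
  by (simp add: inner_diff_left flip: dot_lmul_matrix)

text \<open>The frame matrix changes for two reasons: \<open>A\<close> changes, and the frames turn
  along the motion. The second contribution is exactly the product of \<open>a\<close> with the
  connection coefficients, which is the last component of \<open>rolling_vector\<close>. Equality
  thus says that the change of \<open>A\<close> kills the frame.\<close>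

lemma rolling_vector_iff:
  fixes q :: "('n::{finite,linorder} option, 'n) config"
    and e :: "'n \<Rightarrow> real^('n option) \<Rightarrow> real^('n option)"
    and e' :: "'n \<Rightarrow> real^'n::{finite,linorder} \<Rightarrow> real^'n::{finite,linorder}"
  assumes q: "q \<in> rolling_space"
    and e: "oriented_frame (sphere 0 1) sphere_orientation U e" "fst q \<in> U"
    and e': "oriented_frame UNIV euclidean_orientation U' e'" "fst (snd q) \<in> U'"
    and X0: "X0 \<in> tangent_space (sphere 0 1) (fst q)"
  shows "frechet_derivative (trivialization e e') (at q) \<eta> = rolling_vector (sphere 0 1) UNIV e e' q X0 \<longleftrightarrow>
    fst \<eta> = X0 \<and> fst (snd \<eta>) = snd (snd q) *v X0 \<and> (\<forall>j. snd (snd \<eta>) *v e j (fst q) = 0)"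
proof -
  obtain x y A where q': "q = (x, y, A)" by (cases q)
  have rot: "rotation_matrix (frm (x, y, A))" using q by (simp add: rolling_space_iff q')
  note R = rotation_frmD[OF rot]
  note T = tangent_space_sphere[OF R(1)]
  have S: "x \<in> sphere 0 1" using R(1) by (simp add: norm_eq_1)
  have U: "open U" "x \<in> U" and U': "open U'" "y \<in> U'" using e e' by (auto simp: oriented_frame_def q')
  define De where "De j = frechet_derivative (e j) (at x)" for j
  define De' where "De' i = frechet_derivative (e' i) (at y)" for i
  have De: "(e j has_derivative De j) (at x)" for j
    using e U(2) unfolding De_def oriented_frame_def by (blast intro: smooth_on_imp_has_derivative)
  have De': "(e' j has_derivative De' j) (at y)" for j
    using e' U'(2) unfolding De'_def oriented_frame_def by (blast intro: smooth_on_imp_has_derivative)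
  have oe: "e i p \<bullet> e j p = (if i = j then 1 else 0)" if "p \<in> sphere 0 1 \<inter> U" for i j p
    using e(1) that by (simp add: oriented_frame_def)
  have oe': "e' i p \<bullet> e' j p = (if i = j then 1 else 0)" if "p \<in> U'" for i j p
    using e'(1) that by (simp add: oriented_frame_def)
  have xe: "x \<bullet> e j x = 0" for j
  proof -
    have "e j x \<in> tangent_space (sphere 0 1) x" using e(1) S U unfolding oriented_frame_def by blast
    then show ?thesis by (simp add: T)
  qed
  have ex: "e j x \<bullet> x = 0" for j using xe by (simp add: inner_commute)
  have Ae: "(A *v w) \<bullet> (A *v e j x) = w \<bullet> e j x" for w j
    by (rule rotation_isometry[OF rot xe])
  have exp_Ae: "(\<Sum>k\<in>UNIV. (w \<bullet> (A *v e k x)) *\<^sub>R (A *v e k x)) = w" for w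
    by (rule orthonormal_expansion) (use Ae oe S U in simp)
  have exp_e': "(\<Sum>k\<in>UNIV. (w \<bullet> e' k y) *\<^sub>R e' k y) = w" for w
    by (rule orthonormal_expansion) (use oe' U' in simp)
  define a where "a = frame_matrix e e' q"
  have a: "a $ i $ j = (A *v e j x) \<bullet> e' i y" for i j by (simp add: a_def frame_matrix_def q')
  define qe where "qe j y' = (\<Sum>s\<in>UNIV. (a $ s $ j) *\<^sub>R e' s y')" for j y'
  define z where "z j h = (\<Sum>s\<in>UNIV. (a $ s $ j) *\<^sub>R De' s h)" for j h
  have qe: "(qe j has_derivative z j) (at y)" for j
    unfolding qe_def[abs_def] z_def[abs_def]
    by (intro has_derivative_sum has_derivative_scaleR_right De')
  have qey: "qe j y = A *v e j x" for j
    using exp_e' by (simp add: qe_def a)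
  define c where "c k l = levi_civita (sphere 0 1) X0 (e l) x \<bullet> e k x
      - levi_civita UNIV (A *v X0) (qe l) y \<bullet> (A *v e k x)" for k l
  have c: "c k l = De l X0 \<bullet> e k x - z l (A *v X0) \<bullet> (A *v e k x)" for k l
    using frechet_derivative_at[OF qe]
    by (simp add: c_def levi_civita_def T orthogonal_projection_hyperplane[OF R(1)] De_def
        inner_diff_left xe)
  \<comment> \<open>Both halves of \<open>c\<close> are skew: the \<open>e j\<close> are
    orthonormal, and the \<open>qe j\<close>, having constant coefficients in the orthonormal frame
    \<open>e'\<close>, have constant inner products.\<close>
  have skew: "c k l = - c l k" for k l
  proof -
    have 1: "De l X0 \<bullet> e k x + e l x \<bullet> De k X0 = 0"
      by (rule tangent_space_orthonormal_derivative[OF _ U _ De De]) (use X0 q' oe in auto)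
    have 2: "z l h \<bullet> qe k y + qe l y \<bullet> z k h = 0" for h
    proof (rule tangent_space_orthonormal_derivative[OF _ U' _ qe qe])
      show "h \<in> tangent_space UNIV y" by simp
      show "qe l p \<bullet> qe k p = (\<Sum>s\<in>UNIV. a $ s $ l * a $ s $ k)" if "p \<in> UNIV \<inter> U'" for p
        using that by (simp add: qe_def inner_sum_left inner_sum_right oe' if_distrib mult.commute cong: if_cong)
    qed
    show ?thesis using 1 2[of "A *v X0"] unfolding c qey by (simp add: inner_commute)
  qed
  \<comment> \<open>Multiplication by \<open>a\<close> passes from coefficients in the basis
    \<open>A *v e k x\<close> to coefficients in \<open>e'\<close>. Skewness of the derivative of
    \<open>e'\<close> turns the minus sign in \<open>c\<close> into a plus.\<close>
  have sum_ac: "(\<Sum>k\<in>UNIV. a $ i $ k * c k j) =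
      (A *v De j X0) \<bullet> e' i y + (A *v e j x) \<bullet> De' i (A *v X0)" for i j
  proof -
    have 1: "(\<Sum>k\<in>UNIV. a $ i $ k * (w \<bullet> (A *v e k x))) = w \<bullet> e' i y" for w
    proof -
      have "(\<Sum>k\<in>UNIV. a $ i $ k * (w \<bullet> (A *v e k x))) = (\<Sum>k\<in>UNIV. (w \<bullet> (A *v e k x)) *\<^sub>R (A *v e k x)) \<bullet> e' i y"
        by (simp add: a inner_sum_left mult.commute)
      then show ?thesis by (simp add: exp_Ae)
    qed
    have skew': "De' s h \<bullet> e' i y = - (e' s y \<bullet> De' i h)" for s h
      using tangent_space_orthonormal_derivative[OF _ U' _ De' De', of h UNIV s i "if s = i then 1 else 0"] oe'
      by simp
    have "z j h \<bullet> e' i y = - ((\<Sum>s\<in>UNIV. ((A *v e j x) \<bullet> e' s y) *\<^sub>R e' s y) \<bullet> De' i h)" for h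
      by (simp add: z_def inner_sum_left skew' a sum_negf)
    then have 2: "z j h \<bullet> e' i y = - ((A *v e j x) \<bullet> De' i h)" for h by (simp add: exp_e')
    have "(\<Sum>k\<in>UNIV. a $ i $ k * c k j) = (\<Sum>k\<in>UNIV. a $ i $ k * ((A *v De j X0) \<bullet> (A *v e k x)))
        - (\<Sum>k\<in>UNIV. a $ i $ k * (z j (A *v X0) \<bullet> (A *v e k x)))"
      by (simp add: c Ae right_diff_distrib sum_subtractf)
    then show ?thesis by (simp add: 1 2)
  qed
  have vec: "rolling_vector (sphere 0 1) UNIV e e' q X0 = (X0, A *v X0,
      \<chi> i j. (A *v De j X0) \<bullet> e' i y + (A *v e j x) \<bullet> De' i (A *v X0))"
  proof -
    have "(\<Sum>(i, j)\<in>{(i, j). i < j}. c i j *\<^sub>R W_field i j a) =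
        (\<chi> i j. (A *v De j X0) \<bullet> e' i y + (A *v e j x) \<bullet> De' i (A *v X0))"
      by (simp only: vec_eq_iff sum_W_field[of c, OF skew] sum_ac vec_lambda_beta) simp
    then show ?thesis
      by (simp add: rolling_vector_def Let_def q' a_def[symmetric, unfolded q'] c_def qe_def[abs_def])
  qed
  have fre: "frechet_derivative (trivialization e e') (at q) = (\<lambda>\<eta>. (fst \<eta>, fst (snd \<eta>),
      \<chi> i j. (snd (snd \<eta>) *v e j x) \<bullet> e' i y + (A *v De j (fst \<eta>)) \<bullet> e' i y
      + (A *v e j x) \<bullet> De' i (fst (snd \<eta>))))"
    using frechet_derivative_at[OF trivialization_has_derivative[of e De q e' De']] De De' by (simp add: q')
  have basis: "(\<forall>i. w \<bullet> e' i y = 0) \<longleftrightarrow> w = 0" for w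
    using exp_e'[of w] by auto
  show ?thesis
    unfolding vec fre by (auto simp: vec_eq_iff[of "vec_lambda _"] q') (simp add: basis[symmetric])
qed

lemma continuous_on_det:
  fixes M :: "'a::topological_space \<Rightarrow> real^'n^'n"
  assumes "\<And>i j. continuous_on S (\<lambda>p. M p $ i $ j)"
  shows "continuous_on S (\<lambda>p. det (M p))"
  unfolding det_def by (intro continuous_intros assms)

text \<open>
  The rotation in the plane of \<open>x\<close> and \<open>p\<close> taking \<open>x\<close> to \<open>p\<close> carries the rows of \<open>A\<close>, an
  oriented orthonormal basis of the tangent space at \<open>x\<close>, to a frame at \<open>p\<close>.
\<close>

lemma sphere_frame_exists:
  fixes x :: "real^('n::finite option)" and A :: "real^('n option)^'n"
  assumes rot: "rotation_matrix (frm (x, y, A))"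
  shows "\<exists>U e. oriented_frame (sphere 0 1) sphere_orientation U (e :: 'n \<Rightarrow> _) \<and> x \<in> U"
proof -
  note R = rotation_frmD[OF rot]
  have xA: "A $ i \<bullet> x = 0" "x \<bullet> A $ i = 0" for i
    using R(2) by (metis inner_commute matrix_vector_mul_component zero_index)+
  have AA: "A $ i \<bullet> A $ j = (if i = j then 1 else 0)" for i j
    using arg_cong[OF R(3), of "\<lambda>M. M $ i $ j"] by (simp add: matrix_mult_transpose_nth mat_def)
  define e where "e j p = A $ j - ((p \<bullet> A $ j) * inverse (1 + p \<bullet> x)) *\<^sub>R (p + x)" for j p
  \<comment> \<open>On the sphere only the antipode of \<open>x\<close>, where the denominator
    vanishes, lies outside \<open>V\<close>.\<close>
  define V where "V = {p. -1 < p \<bullet> x}"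
  have V: "open V" unfolding V_def by (intro open_Collect_less continuous_intros)
  have nz: "1 + p \<bullet> x \<noteq> 0" if "p \<in> V" for p using that by (simp add: V_def)
  have smooth: "smooth_on V (e j)" for j
    unfolding e_def[abs_def]
    by (intro smooth_on_diff smooth_on_scaleR smooth_on_bilinear[OF V bounded_bilinear_mult]
        smooth_on_inverse smooth_on_add smooth_on_const V nz smooth_on_linear bounded_linear_inner_left
        bounded_linear_ident) auto
  \<comment> \<open>Continuity carries the positive determinant at \<open>x\<close>, where the frame
    consists of the rows of \<open>A\<close>, to nearby points.\<close>
  define U where "U = V \<inter> (\<lambda>p. det (frm (p, y, \<chi> j. e j p))) -` {0<..}"
  have "continuous_on V (e j)" for j
    using smooth[of j, unfolded smooth_on_def, rule_format, of 0] by simp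
  then have "continuous_on V (\<lambda>p. frm (p, y, \<chi> j. e j p) $ a $ b)" for a b
    by (cases a) (auto intro!: continuous_intros)
  then have "open U"
    unfolding U_def by (intro continuous_open_preimage[OF continuous_on_det V]) auto
  moreover have "x \<in> U"
    using rot by (simp add: U_def V_def e_def R(1) xA vec_lambda_eta rotation_matrix_iff_det_pos)
  moreover have frame: "p \<bullet> e j p = 0" "e i p \<bullet> e j p = (if i = j then 1 else 0)"
    if p: "p \<in> sphere 0 1" "p \<in> V" for i j p
  proof -
    have pp: "p \<bullet> p = 1" using p by (simp add: norm_eq_1)
    define s where "s = p \<bullet> x"
    have s: "1 + s \<noteq> 0" "x \<bullet> p = s" "p \<bullet> x = s" using nz[OF p(2)] by (auto simp: s_def inner_commute)
    define t where "t = inverse (1 + s)"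
    have t: "t * (1 + s) = 1" using s by (simp add: t_def)
    have e: "e j p = A $ j - ((p \<bullet> A $ j) * t) *\<^sub>R (p + x)" for j by (simp add: e_def t_def s)
    have "p \<bullet> e j p = (p \<bullet> A $ j) - (p \<bullet> A $ j) * (t * (1 + s))"
      by (simp add: e inner_diff_right inner_add_right pp s algebra_simps)
    then show "p \<bullet> e j p = 0" by (simp add: t)
    have Ap: "A $ j \<bullet> p = p \<bullet> A $ j" for j by (rule inner_commute)
    have "e i p \<bullet> e j p = A $ i \<bullet> A $ j - 2 * t * (p \<bullet> A $ i) * (p \<bullet> A $ j)
        + 2 * (t * (1 + s)) * t * (p \<bullet> A $ i) * (p \<bullet> A $ j)"
      by (simp add: e inner_diff_right inner_diff_left inner_add_right inner_add_left pp s R(1) xA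
          Ap algebra_simps)
    then show "e i p \<bullet> e j p = (if i = j then 1 else 0)" by (simp add: t AA)
  qed
  moreover have "sphere_orientation p (\<lambda>j. e j p) \<and> (\<forall>j. e j p \<in> tangent_space (sphere 0 1) p)"
    if p: "p \<in> sphere 0 1 \<inter> U" for p
  proof -
    have pp: "p \<bullet> p = 1" using p by (simp add: norm_eq_1)
    show ?thesis
      using p frame(1)[of p] by (auto simp: sphere_orientation_iff[OF pp, of _ y] tangent_space_sphere[OF pp] U_def)
  qed
  ultimately have "oriented_frame (sphere 0 1) sphere_orientation U e"
    unfolding oriented_frame_def using smooth_on_subset[OF smooth, of U] by (auto simp: U_def)
  with \<open>x \<in> U\<close> show ?thesis by blast
qed

abbreviation rolling_dist ::
    "('n::{finite,linorder} option, 'n) config \<Rightarrow> ('n option, 'n) config set" where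
  "rolling_dist \<equiv> rolling_distribution (sphere 0 1) sphere_orientation UNIV
     (euclidean_orientation :: ('n, 'n) orientation)"

lemma rolling_distribution_eq:
  fixes q :: "('n::{finite,linorder} option, 'n) config"
  assumes q: "q \<in> rolling_space"
  shows "rolling_dist q = range (\<lambda>u. rolling_field u q)"
proof (intro equalityI subsetI)
  obtain x y A where q': "q = (x, y, A)" by (cases q)
  have rot: "rotation_matrix (frm (x, y, A))" using q by (simp add: rolling_space_iff q')
  note R = rotation_frmD[OF rot]
  have S: "x \<in> sphere 0 1" using R(1) by (simp add: norm_eq_1)
  note T = tangent_space_sphere[OF R(1)]
  {
    fix \<eta> assume "\<eta> \<in> rolling_dist q"
    then obtain U U' and e :: "'n \<Rightarrow> _" and e' :: "'n \<Rightarrow> _" and X0 where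
      \<eta>: "\<eta> \<in> tangent_space rolling_space q"
      and e: "oriented_frame (sphere 0 1) sphere_orientation U e" "fst q \<in> U"
      and e': "oriented_frame UNIV euclidean_orientation U' e'" "fst (snd q) \<in> U'"
      and X0: "X0 \<in> tangent_space (sphere 0 1) (fst q)"
      and eq: "frechet_derivative (trivialization e e') (at q) \<eta> = rolling_vector (sphere 0 1) UNIV e e' q X0"
      unfolding rolling_distribution_def by blast
    note v = iffD1[OF rolling_vector_iff[OF q e e' X0] eq]
    define B where "B = snd (snd \<eta>)"
    have e_on: "e j x \<in> tangent_space (sphere 0 1) x" "e i x \<bullet> e j x = (if i = j then 1 else 0)" for i j
      using e S q' unfolding oriented_frame_def by auto
    then have xe: "x \<bullet> e j x = 0" for j by (simp add: T)
    \<comment> \<open>\<open>B\<close> vanishes on the frame. That the frame spans the tangent space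
      is seen by expanding \<open>A *v w\<close> in \<open>\<real>^n\<close> and pulling back with
      \<open>A^T\<close>.\<close>
    have "B *v w = 0" if w: "x \<bullet> w = 0" for w
    proof -
      have "(\<Sum>k\<in>UNIV. ((A *v w) \<bullet> (A *v e k x)) *\<^sub>R (A *v e k x)) = A *v w"
        by (rule orthonormal_expansion) (simp add: rotation_isometry[OF rot xe] e_on)
      then have "A *v w = A *v (\<Sum>k\<in>UNIV. (w \<bullet> e k x) *\<^sub>R e k x)"
        by (simp add: rotation_isometry[OF rot xe] linear_sum[OF matrix_vector_mul_linear]
            linear_scale[OF matrix_vector_mul_linear])
      then have "(A *v w) v* A = (A *v (\<Sum>k\<in>UNIV. (w \<bullet> e k x) *\<^sub>R e k x)) v* A" by simp
      then have "w = (\<Sum>k\<in>UNIV. (w \<bullet> e k x) *\<^sub>R e k x)"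
        by (simp add: R(4) w inner_sum_right xe)
      then have "B *v w = B *v (\<Sum>k\<in>UNIV. (w \<bullet> e k x) *\<^sub>R e k x)" by simp
      also have "\<dots> = 0"
        using v by (simp add: linear_sum[OF matrix_vector_mul_linear]
            linear_scale[OF matrix_vector_mul_linear] B_def q')
      finally show ?thesis .
    qed
    then have Bt: "B *v (w - (x \<bullet> w) *\<^sub>R x) = 0" for w
      by (simp add: inner_diff_right R(1))
    have Bw: "B *v w = (x \<bullet> w) *\<^sub>R (B *v x)" for w
      using Bt[of w] by (simp add: matrix_vector_mult_diff_distrib matrix_vector_mult_scaleR)
    have skew: "skew_matrix (frm \<eta> ** transpose (frm q))"
      using \<eta> tangent_space_rolling_space[OF q] by blast
    \<comment> \<open>The value of \<open>B\<close> on the normal vector \<open>x\<close> is fixed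
      by tangency: the rows of \<open>A\<close> stay orthogonal to \<open>x\<close>.\<close>
    have "(B *v x) $ i = - (A *v X0) $ i" for i
      using skew[unfolded skew_matrix_iff, rule_format, of "Some i" None] v
      by (simp add: q' B_def matrix_vector_mul_component inner_commute)
    then have Bx: "B *v x = - (A *v X0)" by (simp add: vec_eq_iff)
    have "B *v w = - outer (A *v X0) x *v w" for w
      by (subst Bw) (simp add: Bx flip: outer_simps(3))
    then have "B = - outer (A *v X0) x" by (simp add: matrix_eq)
    moreover have "(A *v X0) v* A = X0" using X0 by (simp add: R(4) q' T)
    ultimately have "\<eta> = rolling_field (A *v X0) q"
      using v by (simp add: rolling_field_def q' prod_eq_iff B_def)
    then show "\<eta> \<in> range (\<lambda>u. rolling_field u q)" by blast
  }
  {
    fix \<eta> assume "\<eta> \<in> range (\<lambda>u. rolling_field u q)"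
    then obtain u where u: "\<eta> = rolling_field u q" by blast
    obtain U and e :: "'n \<Rightarrow> _" where e: "oriented_frame (sphere 0 1) sphere_orientation U e" "x \<in> U"
      using sphere_frame_exists[OF rot] by blast
    have "(\<chi> i. axis i 1) = (mat 1 :: real^'n::{finite,linorder}^'n::{finite,linorder})"
      by (simp add: vec_eq_iff mat_def axis_def)
    then have e': "oriented_frame UNIV euclidean_orientation UNIV (\<lambda>i y. axis i 1 :: real^'n::{finite,linorder})"
      by (simp add: oriented_frame_def smooth_on_const inner_axis_axis euclidean_orientation_def)
    have X0: "u v* A \<in> tangent_space (sphere 0 1) x"
      by (simp add: T inner_commute[of x] dot_lmul_matrix R(2))
    have "e j x \<in> tangent_space (sphere 0 1) x" for j
      using e S unfolding oriented_frame_def by blast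
    then have "x \<bullet> e j x = 0" for j by (simp add: T)
    moreover have "A *v (u v* A) = u"
      using R(3) by (metis matrix_vector_mul_assoc matrix_vector_mul_lid transpose_matrix_vector)
    ultimately have "fst \<eta> = u v* A \<and> fst (snd \<eta>) = A *v (u v* A) \<and> (\<forall>j. snd (snd \<eta>) *v e j x = 0)"
      by (simp add: u rolling_field_def q' flip: outer_simps(3))
    then have "frechet_derivative (trivialization e (\<lambda>i y. axis i 1)) (at q) \<eta> =
        rolling_vector (sphere 0 1) UNIV e (\<lambda>i y. axis i 1) q (u v* A)"
      using rolling_vector_iff[OF q, of U e UNIV "\<lambda>i y. axis i 1" "u v* A" \<eta>] e e' X0 by (simp add: q')
    moreover have "\<eta> \<in> tangent_space rolling_space q"
      using rolling_field_in_no_slip[OF q, of u] unfolding u tangent_space_rolling_space[OF q] no_slip_def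
      by blast
    ultimately show "\<eta> \<in> rolling_dist q"
      unfolding rolling_distribution_def using e e' X0 q'
      by (intro CollectI conjI exI[of _ U] exI[of _ UNIV] exI[of _ e] exI[of _ "\<lambda>i y. axis i 1"]
          exI[of _ "u v* A"]) auto
  }
qed


section \<open>Absolutely continuous rollings\<close>

definition interval_family :: "real \<Rightarrow> real \<Rightarrow> nat \<Rightarrow> (nat \<Rightarrow> real) \<Rightarrow> (nat \<Rightarrow> real) \<Rightarrow> bool" where
  "interval_family \<tau> \<delta> m s t \<longleftrightarrow> (\<forall>i<m. 0 \<le> s i \<and> s i \<le> t i \<and> t i \<le> \<tau>) \<and>
     (\<forall>i<m. \<forall>j<m. i \<noteq> j \<longrightarrow> {s i<..<t i} \<inter> {s j<..<t j} = {}) \<and> (\<Sum>i<m. t i - s i) < \<delta>"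

lemma absolutely_continuous_curve_iff:
  "absolutely_continuous_curve \<tau> f \<longleftrightarrow>
     (\<forall>\<epsilon>>0. \<exists>\<delta>>0. \<forall>m s t. interval_family \<tau> \<delta> m s t \<longrightarrow> (\<Sum>i<m. dist (f (s i)) (f (t i))) < \<epsilon>)"
  unfolding absolutely_continuous_curve_def interval_family_def by (rule refl)

lemma interval_familyD:
  assumes "interval_family \<tau> \<delta> m s t" "i < m"
  shows "s i \<le> t i" "s i \<in> {0..\<tau>}" "t i \<in> {0..\<tau>}"
  using assms by (force simp: interval_family_def)+

text \<open>Compares Lipschitz curves with a linear function, components with the whole curve, and
  curves that agree on the interval with each other.\<close>

lemma absolutely_continuous_curve_dist_le:
  assumes "absolutely_continuous_curve \<tau> g"
    and le: "\<And>s t. s \<in> {0..\<tau>} \<Longrightarrow> t \<in> {0..\<tau>} \<Longrightarrow> dist (f s) (f t) \<le> dist (g s) (g t)"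
  shows "absolutely_continuous_curve \<tau> f"
  unfolding absolutely_continuous_curve_iff
proof (intro allI impI)
  fix \<epsilon> :: real assume "\<epsilon> > 0"
  then obtain \<delta> where \<delta>: "\<delta> > 0" "\<And>(m :: nat) s t. interval_family \<tau> \<delta> m s t \<Longrightarrow>
      (\<Sum>i<m. dist (g (s i)) (g (t i))) < \<epsilon>"
    using assms(1) unfolding absolutely_continuous_curve_iff by blast
  show "\<exists>\<delta>>0. \<forall>m s t. interval_family \<tau> \<delta> m s t \<longrightarrow>
      (\<Sum>i<m. dist (f (s i)) (f (t i))) < \<epsilon>"
  proof (intro exI[of _ \<delta>] conjI allI impI \<delta>(1))
    fix m :: nat and s t :: "nat \<Rightarrow> real"
    assume h: "interval_family \<tau> \<delta> m s t"
    have "(\<Sum>i<m. dist (f (s i)) (f (t i))) \<le> (\<Sum>i<m. dist (g (s i)) (g (t i)))"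
      using h by (intro sum_mono le interval_familyD) auto
    also have "\<dots> < \<epsilon>" using \<delta>(2) h by blast
    finally show "(\<Sum>i<m. dist (f (s i)) (f (t i))) < \<epsilon>" .
  qed
qed

lemma absolutely_continuous_curve_linear: "absolutely_continuous_curve \<tau> (\<lambda>t :: real. c * t)"
  unfolding absolutely_continuous_curve_iff
proof (intro allI impI)
  fix \<epsilon> :: real assume \<epsilon>: "\<epsilon> > 0"
  \<comment> \<open>The added \<open>1\<close> makes the choice of \<delta> valid also for
    \<open>c = 0\<close>.\<close>
  have c: "\<bar>c\<bar> + 1 > 0" by linarith
  show "\<exists>\<delta>>0. \<forall>(m::nat) s t. interval_family \<tau> \<delta> m s t \<longrightarrow>
      (\<Sum>i<m. dist (c * s i) (c * t i)) < \<epsilon>"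
  proof (intro exI[of _ "\<epsilon> / (\<bar>c\<bar> + 1)"] conjI allI impI)
    show "0 < \<epsilon> / (\<bar>c\<bar> + 1)" using \<epsilon> c by simp
    fix m :: nat and s t :: "nat \<Rightarrow> real"
    assume h: "interval_family \<tau> (\<epsilon> / (\<bar>c\<bar> + 1)) m s t"
    have "(\<Sum>i<m. dist (c * s i) (c * t i)) \<le> (\<Sum>i<m. (\<bar>c\<bar> + 1) * (t i - s i))"
    proof (rule sum_mono)
      fix i assume "i \<in> {..<m}"
      then have le: "s i \<le> t i" using interval_familyD[OF h] by simp
      have "dist (c * s i) (c * t i) = \<bar>c\<bar> * (t i - s i)"
        using le by (simp add: dist_real_def abs_mult flip: right_diff_distrib)
      also have "\<dots> \<le> (\<bar>c\<bar> + 1) * (t i - s i)" using le by (intro mult_right_mono) auto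
      finally show "dist (c * s i) (c * t i) \<le> (\<bar>c\<bar> + 1) * (t i - s i)" .
    qed
    also have "\<dots> = (\<bar>c\<bar> + 1) * (\<Sum>i<m. t i - s i)" by (rule sum_distrib_left[symmetric])
    also have "\<dots> < (\<bar>c\<bar> + 1) * (\<epsilon> / (\<bar>c\<bar> + 1))" using h c unfolding interval_family_def by (intro mult_strict_left_mono) auto
    also have "\<dots> = \<epsilon>" using c by simp
    finally show "(\<Sum>i<m. dist (c * s i) (c * t i)) < \<epsilon>" .
  qed
qed

lemma lipschitz_imp_absolutely_continuous_curve:
  assumes "L-lipschitz_on {0..\<tau>} f"
  shows "absolutely_continuous_curve \<tau> f"
proof (rule absolutely_continuous_curve_dist_le[OF absolutely_continuous_curve_linear[of _ L]])
  fix s t assume "s \<in> {0..\<tau>}" "t \<in> {0..\<tau>}"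
  then have "dist (f s) (f t) \<le> L * dist s t" by (rule lipschitz_onD[OF assms])
  also have "\<dots> = dist (L * s) (L * t)"
    using lipschitz_on_nonneg[OF assms] by (simp add: dist_real_def abs_mult flip: right_diff_distrib)
  finally show "dist (f s) (f t) \<le> dist (L * s) (L * t)" .
qed

lemma absolutely_continuous_curve_continuous:
  assumes "absolutely_continuous_curve \<tau> f"
  shows "continuous_on {0..\<tau>} f"
  unfolding continuous_on_iff
proof (intro ballI allI impI)
  fix x and \<epsilon> :: real assume x: "x \<in> {0..\<tau>}" and "\<epsilon> > 0"
  then obtain \<delta> where \<delta>: "\<delta> > 0" "\<And>(m :: nat) s t. interval_family \<tau> \<delta> m s t \<Longrightarrow>
      (\<Sum>i<m. dist (f (s i)) (f (t i))) < \<epsilon>"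
    using assms unfolding absolutely_continuous_curve_iff by blast
  have "dist (f x') (f x) < \<epsilon>" if "x' \<in> {0..\<tau>}" "dist x' x < \<delta>" for x'
  proof -
    have "(\<Sum>i<Suc 0. dist (f (min x x')) (f (max x x'))) < \<epsilon>"
      by (rule \<delta>(2)) (use that x in \<open>auto simp: interval_family_def dist_real_def min_def max_def\<close>)
    then show ?thesis by (auto simp: min_def max_def dist_commute split: if_splits)
  qed
  then show "\<exists>d>0. \<forall>x'\<in>{0..\<tau>}. dist x' x < d \<longrightarrow> dist (f x') (f x) < \<epsilon>"
    using \<delta>(1) by blast
qed

text \<open>Lets absolute continuity pass between a field \<open>Z\<close> and its image
  \<open>A Z\<close>. Both factors are bounded, being continuous on a compact interval.\<close>

lemma absolutely_continuous_curve_bilinear: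
  assumes "bounded_bilinear h" and f: "absolutely_continuous_curve \<tau> f" and g: "absolutely_continuous_curve \<tau> g"
  shows "absolutely_continuous_curve \<tau> (\<lambda>t. h (f t) (g t))"
  unfolding absolutely_continuous_curve_iff
proof (intro allI impI)
  interpret h: bounded_bilinear h by fact
  obtain K where K: "K > 0" "\<And>a b. norm (h a b) \<le> norm a * norm b * K" using h.pos_bounded by blast
  have "bounded (f ` {0..\<tau>})" "bounded (g ` {0..\<tau>})"
    using absolutely_continuous_curve_continuous[OF f] absolutely_continuous_curve_continuous[OF g]
    by (auto intro!: compact_imp_bounded compact_continuous_image)
  then obtain F G where FG: "F > 0" "G > 0" "\<And>t. t \<in> {0..\<tau>} \<Longrightarrow> norm (f t) \<le> F" "\<And>t. t \<in> {0..\<tau>} \<Longrightarrow> norm (g t) \<le> G"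
    unfolding bounded_pos by (metis imageI)
  fix \<epsilon> :: real assume \<epsilon>: "\<epsilon> > 0"
  have "\<epsilon> / (2 * G * K) > 0" "\<epsilon> / (2 * F * K) > 0" using FG K \<epsilon> by simp_all
  then obtain \<delta>1 \<delta>2 where \<delta>1: "\<delta>1 > 0" "\<And>(m :: nat) s t. interval_family \<tau> \<delta>1 m s t \<Longrightarrow>
      (\<Sum>i<m. dist (f (s i)) (f (t i))) < \<epsilon> / (2 * G * K)"
    and \<delta>2: "\<delta>2 > 0" "\<And>(m :: nat) s t. interval_family \<tau> \<delta>2 m s t \<Longrightarrow>
      (\<Sum>i<m. dist (g (s i)) (g (t i))) < \<epsilon> / (2 * F * K)"
    using f[unfolded absolutely_continuous_curve_iff, rule_format, of "\<epsilon> / (2 * G * K)"]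
      g[unfolded absolutely_continuous_curve_iff, rule_format, of "\<epsilon> / (2 * F * K)"] by blast
  show "\<exists>\<delta>>0. \<forall>(m::nat) s t. interval_family \<tau> \<delta> m s t \<longrightarrow>
      (\<Sum>i<m. dist (h (f (s i)) (g (s i))) (h (f (t i)) (g (t i)))) < \<epsilon>"
  proof (intro exI[of _ "min \<delta>1 \<delta>2"] conjI allI impI)
    show "0 < min \<delta>1 \<delta>2" using \<delta>1(1) \<delta>2(1) by simp
    fix m :: nat and s t :: "nat \<Rightarrow> real"
    assume hyp: "interval_family \<tau> (min \<delta>1 \<delta>2) m s t"
    have fam: "interval_family \<tau> \<delta>1 m s t" "interval_family \<tau> \<delta>2 m s t"
      using hyp by (auto simp: interval_family_def)
    have "(\<Sum>i<m. dist (h (f (s i)) (g (s i))) (h (f (t i)) (g (t i)))) \<le>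
      (\<Sum>i<m. F * K * dist (g (s i)) (g (t i)) + G * K * dist (f (s i)) (f (t i)))"
    proof (rule sum_mono)
      fix i assume "i \<in> {..<m}"
      then have st: "s i \<in> {0..\<tau>}" "t i \<in> {0..\<tau>}" using interval_familyD[OF hyp] by simp_all
      have eq: "h (f (s i)) (g (s i)) - h (f (t i)) (g (t i)) = h (f (s i)) (g (s i) - g (t i)) + h (f (s i) - f (t i)) (g (t i))"
        by (simp add: h.diff_left h.diff_right)
      have "dist (h (f (s i)) (g (s i))) (h (f (t i)) (g (t i))) \<le>
          norm (h (f (s i)) (g (s i) - g (t i))) + norm (h (f (s i) - f (t i)) (g (t i)))"
        unfolding dist_norm eq by (rule norm_triangle_ineq)
      also have "\<dots> \<le> norm (f (s i)) * norm (g (s i) - g (t i)) * K + norm (f (s i) - f (t i)) * norm (g (t i)) * K"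
        by (intro add_mono K)
      also have "\<dots> \<le> F * norm (g (s i) - g (t i)) * K + norm (f (s i) - f (t i)) * G * K"
        using K(1) FG st by (intro add_mono mult_right_mono mult_left_mono) auto
      finally show "dist (h (f (s i)) (g (s i))) (h (f (t i)) (g (t i))) \<le>
          F * K * dist (g (s i)) (g (t i)) + G * K * dist (f (s i)) (f (t i))"
        by (simp add: dist_norm mult_ac)
    qed
    also have "\<dots> = F * K * (\<Sum>i<m. dist (g (s i)) (g (t i))) + G * K * (\<Sum>i<m. dist (f (s i)) (f (t i)))"
      by (simp add: sum.distrib sum_distrib_left)
    also have "\<dots> < F * K * (\<epsilon> / (2 * F * K)) + G * K * (\<epsilon> / (2 * G * K))"
      using FG K \<delta>1(2)[of m s t] \<delta>2(2)[of m s t] fam by (intro add_strict_mono mult_strict_left_mono) auto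
    also have "\<dots> = \<epsilon>" using FG K by (simp add: field_simps)
    finally show "(\<Sum>i<m. dist (h (f (s i)) (g (s i))) (h (f (t i)) (g (t i)))) < \<epsilon>" .
  qed
qed

text \<open>
  A class of curves that, unlike smooth ones, can be concatenated, and for which being a rolling is
  checked by their velocity only.
\<close>

definition rolling_arc :: "real \<Rightarrow> (real \<Rightarrow> ('n::finite option, 'n) config) \<Rightarrow> bool" where
  "rolling_arc \<tau> q \<longleftrightarrow> 0 < \<tau> \<and> (\<exists>L. L-lipschitz_on {0..\<tau>} q) \<and> (\<forall>t\<in>{0..\<tau>}. q t \<in> rolling_space) \<and>
     (\<exists>S. finite S \<and> (\<forall>t\<in>{0<..<\<tau>} - S. \<exists>u. (q has_vector_derivative rolling_field u (q t)) (at t)))"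

text \<open>The derivative \<open>- u x^T\<close> of \<open>A\<close> kills tangent vectors, so
  \<open>(A Z)' = A Z'\<close>, which vanishes if \<open>Z'\<close> is normal. Conversely
  \<open>Z = A^T (A Z)\<close>, and if \<open>A Z\<close> has derivative \<open>0\<close>, that of
  \<open>Z\<close> is a multiple of \<open>x\<close>.\<close>

lemma rolling_arc_intrinsic_rolling:
  assumes "rolling_arc \<tau> q"
  shows "intrinsic_rolling (sphere 0 1) sphere_orientation UNIV
    (euclidean_orientation :: ('n::finite, 'n) orientation) \<tau> q"
proof -
  obtain L S where L: "L-lipschitz_on {0..\<tau>} q" and mem: "\<And>t. t \<in> {0..\<tau>} \<Longrightarrow> q t \<in> rolling_space"
    and S: "finite S" "\<And>t. t \<in> {0<..<\<tau>} - S \<Longrightarrow> \<exists>u. (q has_vector_derivative rolling_field u (q t)) (at t)"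
    using assms unfolding rolling_arc_def by blast
  define x y A where "x = (\<lambda>t. fst (q t))" and "y = (\<lambda>t. fst (snd (q t)))" and "A = (\<lambda>t. snd (snd (q t)))"
  have q: "q t = (x t, y t, A t)" for t by (simp add: x_def y_def A_def)
  \<comment> \<open>The exceptional times and both endpoints, where the velocity of the arc is not
    prescribed.\<close>
  define N where "N = S \<union> {0, \<tau>}"
  have AE: "AE t in lborel. t \<notin> N"
    unfolding N_def using S(1) by (intro AE_not_in countable_imp_null_set_lborel) (simp add: countable_finite)
  have R: "x t \<bullet> x t = 1" "A t *v x t = 0" "(A t *v v) v* A t = v - (x t \<bullet> v) *\<^sub>R x t"
    if "t \<in> {0..\<tau>}" for t v
    using rotation_frmD[of "x t" "y t" "A t"] mem[OF that] by (simp_all add: rolling_space_iff q)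
  have T: "tangent_space (sphere 0 1) (x t) = {v. x t \<bullet> v = 0}" if "t \<in> {0..\<tau>}" for t
    using R(1)[OF that] by (rule tangent_space_sphere)
  have der: "\<exists>u. (x has_vector_derivative (u v* A t)) (at t within {0..\<tau>}) \<and>
      (y has_vector_derivative u) (at t within {0..\<tau>}) \<and>
      (A has_vector_derivative (- outer u (x t))) (at t within {0..\<tau>})"
    if "t \<in> {0..\<tau>}" "t \<notin> N" for t
  proof -
    have "t \<in> {0<..<\<tau>} - S" using that by (auto simp: N_def)
    then obtain u where "(q has_vector_derivative rolling_field u (q t)) (at t)" using S(2) by blast
    then have "(q has_vector_derivative (u v* A t, u, - outer u (x t))) (at t within {0..\<tau>})"
      using has_vector_derivative_at_within by (fastforce simp: rolling_field_def q)
    from bounded_linear.has_vector_derivative[OF bounded_linear_fst this]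
      bounded_linear.has_vector_derivative[OF bounded_linear_fst bounded_linear.has_vector_derivative[OF bounded_linear_snd this]]
      bounded_linear.has_vector_derivative[OF bounded_linear_snd bounded_linear.has_vector_derivative[OF bounded_linear_snd this]]
    show ?thesis unfolding x_def y_def A_def by auto
  qed
  have ACq: "absolutely_continuous_curve \<tau> q" by (rule lipschitz_imp_absolutely_continuous_curve[OF L])
  have "dist (A s) (A t) \<le> dist (q s) (q t)" for s t
    unfolding A_def by (rule order_trans[OF dist_snd_le dist_snd_le])
  then have ACA: "absolutely_continuous_curve \<tau> A"
    by (rule absolutely_continuous_curve_dist_le[OF ACq])
  note blA = bounded_bilinear_matrix_vector_mult
  note blv = bilinear_vector_matrix_mult[unfolded bilinear_conv_bounded_bilinear]
  have roll: "AE t in lborel. t \<in> {0..\<tau>} \<longrightarrow> (\<exists>v. (x has_vector_derivative v) (at t within {0..\<tau>}) \<and>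
      (y has_vector_derivative (A t *v v)) (at t within {0..\<tau>}))"
    using AE
  proof eventually_elim
    case (elim t)
    show ?case
    proof
      assume t: "t \<in> {0..\<tau>}"
      obtain u where u: "(x has_vector_derivative (u v* A t)) (at t within {0..\<tau>})"
        "(y has_vector_derivative u) (at t within {0..\<tau>})" using der[OF t elim] by blast
      have "A t ** transpose (A t) = mat 1"
        using rotation_frmD(3)[of "x t" "y t" "A t"] mem[OF t] by (simp add: rolling_space_iff q)
      then have "A t *v (u v* A t) = u"
        by (metis matrix_vector_mul_assoc matrix_vector_mul_lid transpose_matrix_vector)
      with u show "\<exists>v. (x has_vector_derivative v) (at t within {0..\<tau>}) \<and>
          (y has_vector_derivative (A t *v v)) (at t within {0..\<tau>})" by metis
    qed
  qed
  have par: "parallel_along (sphere 0 1) \<tau> x Z \<longleftrightarrow> parallel_along UNIV \<tau> y (\<lambda>t. A t *v Z t)"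
    if Z: "tangent_field_along (sphere 0 1) \<tau> x Z" for Z
  proof
    have xZ: "x t \<bullet> Z t = 0" if "t \<in> {0..\<tau>}" for t
      using Z that T[OF that] unfolding tangent_field_along_def by blast
    {
      assume P: "parallel_along (sphere 0 1) \<tau> x Z"
      have "absolutely_continuous_curve \<tau> (\<lambda>t. A t *v Z t)"
        using P by (intro absolutely_continuous_curve_bilinear[OF blA ACA]) (simp add: parallel_along_def)
      moreover have "AE t in lborel. t \<in> {0..\<tau>} \<longrightarrow>
          (\<exists>w. ((\<lambda>t. A t *v Z t) has_vector_derivative w) (at t within {0..\<tau>}) \<and> w = 0)"
      proof -
        have "AE t in lborel. t \<in> {0..\<tau>} \<longrightarrow> (\<exists>w. (Z has_vector_derivative w) (at t within {0..\<tau>}) \<and>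
             orthogonal_projection (tangent_space (sphere 0 1) (x t)) w = 0)"
          using P by (simp add: parallel_along_def)
        with AE show ?thesis
        proof eventually_elim
          case (elim t)
          show ?case
          proof
            assume t: "t \<in> {0..\<tau>}"
            obtain w where w: "(Z has_vector_derivative w) (at t within {0..\<tau>})"
              "orthogonal_projection (tangent_space (sphere 0 1) (x t)) w = 0" using elim t by blast
            obtain u where u: "(A has_vector_derivative (- outer u (x t))) (at t within {0..\<tau>})"
              using der[OF t elim(1)] by blast
            have "w = (x t \<bullet> w) *\<^sub>R x t"
              using w(2) by (simp add: T[OF t] orthogonal_projection_hyperplane R(1)[OF t])
            then have "A t *v w = 0"
              by (metis R(2) matrix_vector_mult_scaleR scaleR_zero_right t)
            moreover have "- outer u (x t) *v Z t = 0"
              using xZ[OF t] by (simp flip: outer_simps(3))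
            ultimately show "\<exists>w. ((\<lambda>t. A t *v Z t) has_vector_derivative w) (at t within {0..\<tau>}) \<and> w = 0"
              using bounded_bilinear.has_vector_derivative[OF blA u w(1)] by simp
          qed
        qed
      qed
      ultimately show "parallel_along UNIV \<tau> y (\<lambda>t. A t *v Z t)"
        by (simp add: parallel_along_def tangent_field_along_def)
    }
    {
      assume P: "parallel_along UNIV \<tau> y (\<lambda>t. A t *v Z t)"
      define \<zeta> where "\<zeta> t = A t *v Z t" for t
      have Z\<zeta>: "Z t = \<zeta> t v* A t" if "t \<in> {0..\<tau>}" for t
        using xZ[OF that] by (simp add: \<zeta>_def R(3)[OF that])
      have "absolutely_continuous_curve \<tau> (\<lambda>t. \<zeta> t v* A t)"
        using P by (intro absolutely_continuous_curve_bilinear[OF blv] ACA) (simp add: parallel_along_def \<zeta>_def)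
      then have "absolutely_continuous_curve \<tau> Z"
        by (rule absolutely_continuous_curve_dist_le) (simp add: Z\<zeta>)
      moreover have "AE t in lborel. t \<in> {0..\<tau>} \<longrightarrow> (\<exists>w. (Z has_vector_derivative w) (at t within {0..\<tau>}) \<and>
             orthogonal_projection (tangent_space (sphere 0 1) (x t)) w = 0)"
      proof -
        have "AE t in lborel. t \<in> {0..\<tau>} \<longrightarrow> (\<zeta> has_vector_derivative 0) (at t within {0..\<tau>})"
          using P by (simp add: parallel_along_def \<zeta>_def[abs_def])
        with AE show ?thesis
        proof eventually_elim
          case (elim t)
          show ?case
          proof
            assume t: "t \<in> {0..\<tau>}"
            obtain u where u: "(A has_vector_derivative (- outer u (x t))) (at t within {0..\<tau>})"
              using der[OF t elim(1)] by blast
            have "((\<lambda>t. \<zeta> t v* A t) has_vector_derivative (\<zeta> t v* (- outer u (x t)))) (at t within {0..\<tau>})"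
              using bounded_bilinear.has_vector_derivative[OF blv _ u, of \<zeta> 0] elim(2) t
              by (simp add: vmult_simps)
            then have "(Z has_vector_derivative (- (\<zeta> t \<bullet> u) *\<^sub>R x t)) (at t within {0..\<tau>})"
              using has_vector_derivative_transform[OF t Z\<zeta>]
              by (simp add: vmult_simps vector_outer_mult)
            moreover have "orthogonal_projection (tangent_space (sphere 0 1) (x t)) (- (\<zeta> t \<bullet> u) *\<^sub>R x t) = 0"
              by (simp add: T[OF t] orthogonal_projection_hyperplane R(1)[OF t])
            ultimately show "\<exists>w. (Z has_vector_derivative w) (at t within {0..\<tau>}) \<and>
               orthogonal_projection (tangent_space (sphere 0 1) (x t)) w = 0" by blast
          qed
        qed
      qed
      ultimately show "parallel_along (sphere 0 1) \<tau> x Z"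
        using Z by (simp add: parallel_along_def)
    }
  qed
  show ?thesis
    unfolding intrinsic_rolling_def Let_def
    using ACq mem roll par unfolding x_def y_def A_def by blast
qed

lemma rolling_arc_concat:
  assumes p: "rolling_arc \<sigma> p" and q: "rolling_arc \<tau> q" and pq: "p \<sigma> = q 0"
  shows "rolling_arc (\<sigma> + \<tau>) (\<lambda>t. if t \<le> \<sigma> then p t else q (t - \<sigma>))"
proof -
  let ?r = "\<lambda>t. if t \<le> \<sigma> then p t else q (t - \<sigma>)"
  obtain L S where P: "0 < \<sigma>" "L-lipschitz_on {0..\<sigma>} p" "\<And>t. t \<in> {0..\<sigma>} \<Longrightarrow> p t \<in> rolling_space"
    "finite S" "\<And>t. t \<in> {0<..<\<sigma>} - S \<Longrightarrow> \<exists>u. (p has_vector_derivative rolling_field u (p t)) (at t)"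
    using p unfolding rolling_arc_def by blast
  obtain M S' where Q: "0 < \<tau>" "M-lipschitz_on {0..\<tau>} q" "\<And>t. t \<in> {0..\<tau>} \<Longrightarrow> q t \<in> rolling_space"
    "finite S'" "\<And>t. t \<in> {0<..<\<tau>} - S' \<Longrightarrow> \<exists>u. (q has_vector_derivative rolling_field u (q t)) (at t)"
    using q unfolding rolling_arc_def by blast
  have "M-lipschitz_on {\<sigma>..\<sigma> + \<tau>} (\<lambda>t. q (t - \<sigma>))"
    using Q(2) by (auto simp: lipschitz_on_def dist_real_def) (smt (verit, best) atLeastAtMost_iff)
  then have "(max L M)-lipschitz_on {0..\<sigma> + \<tau>} ?r"
    using lipschitz_on_concat_max[OF P(2), of M "\<sigma> + \<tau>" "\<lambda>t. q (t - \<sigma>)"] pq by simp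
  moreover have "?r t \<in> rolling_space" if "t \<in> {0..\<sigma> + \<tau>}" for t
    using that P(3)[of t] Q(3)[of "t - \<sigma>"] by auto
  \<comment> \<open>The junction becomes exceptional, because the velocity may jump there.\<close>
  moreover have "finite (S \<union> {\<sigma>} \<union> (\<lambda>t. t + \<sigma>) ` S')" using P Q by simp
  moreover have "\<exists>u. (?r has_vector_derivative rolling_field u (?r t)) (at t)"
    if t: "t \<in> {0<..<\<sigma> + \<tau>} - (S \<union> {\<sigma>} \<union> (\<lambda>t. t + \<sigma>) ` S')" for t
  proof (cases "t < \<sigma>")
    case True
    then obtain u where "(p has_vector_derivative rolling_field u (p t)) (at t)"
      using P(5)[of t] t by auto
    then have "(?r has_vector_derivative rolling_field u (p t)) (at t)"
      by (rule has_vector_derivative_transform_within_open[of _ _ _ "{..<\<sigma>}"]) (use True in auto)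
    then show ?thesis using True by auto
  next
    case False
    then have "\<sigma> < t" using t by auto
    have "t - \<sigma> \<notin> S'"
    proof
      assume "t - \<sigma> \<in> S'"
      then have "(t - \<sigma>) + \<sigma> \<in> (\<lambda>t. t + \<sigma>) ` S'" by (rule imageI)
      then show False using t by simp
    qed
    then obtain u where "(q has_vector_derivative rolling_field u (q (t - \<sigma>))) (at (t - \<sigma>))"
      using Q(5)[of "t - \<sigma>"] t \<open>\<sigma> < t\<close> by auto
    then have "((\<lambda>t. q (t - \<sigma>)) has_vector_derivative rolling_field u (q (t - \<sigma>))) (at t)"
      using vector_diff_chain_at[of "\<lambda>t. t - \<sigma>" 1 t q] by (simp add: o_def has_vector_derivative_diff_const)
    then have "(?r has_vector_derivative rolling_field u (q (t - \<sigma>))) (at t)"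
      by (rule has_vector_derivative_transform_within_open[of _ _ _ "{\<sigma><..}"]) (use \<open>\<sigma> < t\<close> in auto)
    then show ?thesis using \<open>\<sigma> < t\<close> by auto
  qed
  ultimately show ?thesis using P(1) Q(1) unfolding rolling_arc_def by (meson add_pos_pos)
qed


section \<open>Controllability\<close>

definition embed :: "real^'n \<Rightarrow> real^('n::finite option)" where
  "embed u = (\<chi> a. case a of None \<Rightarrow> 0 | Some i \<Rightarrow> u $ i)"

lemma embed_nth [simp]: "embed u $ None = 0" "embed u $ Some i = u $ i"
  by (simp_all add: embed_def)

abbreviation e0 :: "real^('n::finite option)" where "e0 \<equiv> axis None 1"

lemma embed_inner [simp]: "embed u \<bullet> embed v = u \<bullet> v" "embed u \<bullet> e0 = 0" "e0 \<bullet> embed u = 0"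
  "e0 \<bullet> (e0 :: real^('n::finite option)) = 1"
  by (simp_all add: inner_vec_def[of "embed u"] UNIV_option_sum inner_vec_def[of u] inner_axis inner_axis')

lemma embed_drop: "b \<bullet> e0 = 0 \<Longrightarrow> embed (\<chi> i. b $ Some i) = b"
  by (simp add: embed_def vec_eq_iff inner_axis split: option.split)

lemma matrix_mult_row: "(A ** B) $ i = A $ i v* B" for A :: "real^'n^'m" and B :: "real^'p^'n"
  by (simp add: matrix_matrix_mult_def vector_matrix_mult_def vec_eq_iff mult.commute)

lemma rolling_field_cfg: "rolling_field u p = cfg u ((outer e0 (embed u) - outer (embed u) e0) ** frm p)"
proof -
  have "embed u v* frm p = u v* snd (snd p)" by (simp add: vector_frm_mult vec_lambda_eta)
  moreover have "e0 v* frm p = fst p" by (simp add: vector_frm_mult zero_vec_def[symmetric] vmult_simps axis_def)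
  ultimately show ?thesis
    by (simp add: cfg_def rolling_field_def matrix_mult_row vmult_simps vec_eq_iff outer_def[of u] axis_def)
qed

text \<open>The integral curve of \<open>rolling_field u\<close> for a unit vector \<open>u\<close>:
  the contact point runs straight at unit speed, and the sphere, having radius \<open>1\<close>,
  turns by an angle equal to the distance.\<close>

definition roll_along :: "real^'n \<Rightarrow> real^'n \<Rightarrow> real^('n option)^('n option) \<Rightarrow> real \<Rightarrow> ('n::finite option, 'n) config" where
  "roll_along u y R t = cfg (y + t *\<^sub>R u) (plane_rotation (embed u) e0 t ** R)"

lemma roll_along_has_derivative:
  assumes u: "u \<bullet> u = 1"
  shows "(roll_along u y R has_vector_derivative rolling_field u (roll_along u y R t)) (at t within S)"
proof -
  let ?a = "embed u" and ?P = "plane_rotation (embed u) e0"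
  have "(?P has_vector_derivative
      (cos t *\<^sub>R (outer e0 ?a - outer ?a e0) - sin t *\<^sub>R (outer ?a ?a + outer e0 e0))) (at t within S)"
    using has_vector_derivative_plane_rotation[of ?a e0 1 t S] by simp
  also have "cos t *\<^sub>R (outer e0 ?a - outer ?a e0) - sin t *\<^sub>R (outer ?a ?a + outer e0 e0) =
      (outer e0 ?a - outer ?a e0) ** ?P t"
    unfolding matrix_eq matrix_vector_mul_assoc[symmetric]
    by (simp add: plane_rotation_mult_vec matrix_vector_mult_diff_rdistrib matrix_vector_mult_add_rdistrib
        scaleR_matrix_vector_mult inner_add_right u algebra_simps)
  finally have P: "(?P has_vector_derivative (outer e0 ?a - outer ?a e0) ** ?P t) (at t within S)" .
  have "((\<lambda>t. (y + t *\<^sub>R u, ?P t ** R)) has_vector_derivative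
      (u, (outer e0 ?a - outer ?a e0) ** ?P t ** R)) (at t within S)"
    by (intro has_vector_derivative_Pair
        bounded_linear.has_vector_derivative[OF bounded_bilinear.bounded_linear_left[OF bounded_bilinear_matrix_mult] P])
      (auto intro!: derivative_eq_intros simp: has_vector_derivative_def)
  from bounded_linear.has_vector_derivative[OF bounded_linear_cfg this]
  show ?thesis
    unfolding roll_along_def[abs_def] rolling_field_cfg by (simp add: matrix_mul_assoc)
qed

lemma bounded_derivative_imp_lipschitz_on:
  fixes f :: "real \<Rightarrow> 'a::real_normed_vector"
  assumes "\<And>t. t \<in> {a..b} \<Longrightarrow> (f has_vector_derivative f' t) (at t within {a..b})"
    and "\<And>t. t \<in> {a..b} \<Longrightarrow> norm (f' t) \<le> B" "0 \<le> B"
  shows "B-lipschitz_on {a..b} f"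
proof (rule lipschitz_onI)
  fix s t assume st: "s \<in> {a..b}" "t \<in> {a..b}"
  have "norm (f s - f t) \<le> B * norm (s - t)"
  proof (rule differentiable_bound[OF _ _ _ st])
    show "convex {a..b}" by simp
    show "(f has_derivative (\<lambda>h. h *\<^sub>R f' r)) (at r within {a..b})" if "r \<in> {a..b}" for r
      using assms(1)[OF that] by (simp add: has_vector_derivative_def)
    show "onorm (\<lambda>h. h *\<^sub>R f' r) \<le> B" if "r \<in> {a..b}" for r
      using assms(2)[OF that] assms(3) by (intro onorm_bound) (auto simp: mult.commute[of B] intro: mult_left_mono)
  qed
  then show "dist (f s) (f t) \<le> B * dist s t" by (simp add: dist_norm)
qed (fact assms)

lemma rolling_arc_roll_along:
  fixes u :: "real^'n::finite"
  assumes u: "u \<bullet> u = 1" and "0 < \<tau>" and R: "rotation_matrix R"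
  shows "rolling_arc \<tau> (roll_along u y R)"
proof -
  note der = roll_along_has_derivative[OF u, of y R]
  have path: "continuous_on {0..\<tau>} (roll_along u y R)"
    using der by (intro continuous_on_vector_derivative) blast
  have field: "continuous_on UNIV (rolling_field u)"
    by (intro continuous_at_imp_continuous_on ballI has_derivative_continuous[OF rolling_field_has_derivative])
  have "continuous_on {0..\<tau>} (\<lambda>t. rolling_field u (roll_along u y R t))"
    by (rule continuous_on_compose2[OF field path]) auto
  then have "bounded ((\<lambda>t. rolling_field u (roll_along u y R t)) ` {0..\<tau>})"
    by (intro compact_imp_bounded compact_continuous_image) auto
  then obtain B where B: "0 < B" "\<And>t. t \<in> {0..\<tau>} \<Longrightarrow> norm (rolling_field u (roll_along u y R t)) \<le> B"
    unfolding bounded_pos by (metis imageI)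
  then have "B-lipschitz_on {0..\<tau>} (roll_along u y R)"
    by (intro bounded_derivative_imp_lipschitz_on[OF der]) auto
  moreover have "roll_along u y R t \<in> rolling_space" for t
    using u R by (simp add: rolling_space_iff roll_along_def rotation_matrix_mult rotation_matrix_plane_rotation)
  ultimately show ?thesis
    unfolding rolling_arc_def using \<open>0 < \<tau>\<close> der by blast
qed

definition rolling_reachable :: "('n::finite option, 'n) config \<Rightarrow> ('n option, 'n) config \<Rightarrow> bool" where
  "rolling_reachable p q \<longleftrightarrow> (\<exists>\<tau> c. rolling_arc \<tau> c \<and> c 0 = p \<and> c \<tau> = q)"

lemma rolling_reachable_trans:
  assumes "rolling_reachable p q" "rolling_reachable q r"
  shows "rolling_reachable p r"
proof -
  obtain \<sigma> c where c: "rolling_arc \<sigma> c" "c 0 = p" "c \<sigma> = q"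
    using assms(1) unfolding rolling_reachable_def by blast
  obtain \<tau> d where d: "rolling_arc \<tau> d" "d 0 = q" "d \<tau> = r"
    using assms(2) unfolding rolling_reachable_def by blast
  have "0 < \<sigma>" "0 < \<tau>" using c(1) d(1) by (auto simp: rolling_arc_def)
  then show ?thesis
    unfolding rolling_reachable_def
    using rolling_arc_concat[OF c(1) d(1)] c d
    by (intro exI[of _ "\<sigma> + \<tau>"] exI[of _ "\<lambda>t. if t \<le> \<sigma> then c t else d (t - \<sigma>)"]) auto
qed

text \<open>
  Rollings commute with right translations, so the displacements \<open>(g, v)\<close> that they produce form a
  semigroup independent of the starting point.
\<close>

definition rolls :: "real^('n option)^('n option) \<Rightarrow> real^'n::finite \<Rightarrow> bool" where
  "rolls g v \<longleftrightarrow> rotation_matrix g \<and>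
     (\<forall>y R. rotation_matrix R \<longrightarrow> rolling_reachable (cfg y R) (cfg (y + v) (g ** R)))"

lemma rolls_mult:
  assumes "rolls g v" "rolls h w"
  shows "rolls (h ** g) (v + w)"
  unfolding rolls_def
proof (intro conjI allI impI)
  show "rotation_matrix (h ** g)" using assms by (simp add: rolls_def rotation_matrix_mult)
  fix y and R :: "real^('a option)^('a option)" assume R: "rotation_matrix R"
  have "rolling_reachable (cfg y R) (cfg (y + v) (g ** R))"
    using assms(1) R unfolding rolls_def by blast
  moreover have "rolling_reachable (cfg (y + v) (g ** R)) (cfg (y + v + w) (h ** (g ** R)))"
    using assms R rotation_matrix_mult unfolding rolls_def by blast
  ultimately have "rolling_reachable (cfg y R) (cfg (y + v + w) (h ** (g ** R)))"
    by (rule rolling_reachable_trans)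
  then show "rolling_reachable (cfg y R) (cfg (y + (v + w)) (h ** g ** R))"
    by (simp only: add.assoc matrix_mul_assoc)
qed

lemma rolls_straight:
  assumes u: "u \<bullet> u = 1" and "0 < t"
  shows "rolls (plane_rotation (embed u) e0 t) (t *\<^sub>R u)"
  unfolding rolls_def
proof (intro conjI allI impI)
  show "rotation_matrix (plane_rotation (embed u) e0 t)"
    using u by (intro rotation_matrix_plane_rotation) auto
  fix y R assume "rotation_matrix (R :: real^('a option)^('a option))"
  then show "rolling_reachable (cfg y R) (cfg (y + t *\<^sub>R u) (plane_rotation (embed u) e0 t ** R))"
    using rolling_arc_roll_along[OF u \<open>0 < t\<close>, of R y] unfolding rolling_reachable_def
    by (intro exI[of _ t] exI[of _ "roll_along u y R"]) (simp add: roll_along_def)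
qed

lemma rolls_full_turn:
  assumes "norm v = 2 * pi"
  shows "rolls (mat 1) v"
proof -
  define u where "u = v /\<^sub>R (2 * pi)"
  have "norm u = 1" using assms by (simp add: u_def)
  then have "u \<bullet> u = 1" by (simp add: norm_eq_1)
  from rolls_straight[OF this, of "2 * pi"] show ?thesis
    using plane_rotation_periodic[of "embed u" e0 0] by (simp add: u_def)
qed

section \<open>Generating all translations and rotations\<close>

lemma unit_orthogonal_exists:
  fixes v :: "real^'n::finite"
  assumes "2 \<le> CARD('n)"
  obtains w where "w \<bullet> w = 1" "v \<bullet> w = 0"
proof -
  have "DIM(real^'n) \<ge> 2" using assms by simp
  then obtain w where w: "w \<noteq> 0" "orthogonal v w"
    using orthogonal_to_vector_exists[of v] by blast
  show thesis
    by (rule that[of "w /\<^sub>R norm w"])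
      (use w in \<open>auto simp: orthogonal_def dot_square_norm power2_eq_square\<close>)
qed

text \<open>
  A vector of length at most \<open>4\<pi>\<close> is a sum of two vectors of length \<open>2\<pi>\<close>, hence a
  displacement produced by two full turns.
\<close>

lemma rolls_translation:
  fixes v :: "real^'n::finite"
  assumes card: "2 \<le> CARD('n)"
  shows "rolls (mat 1) v"
proof -
  have short: "rolls (mat 1) v" if v: "norm v \<le> 4 * pi" for v :: "real^'n"
  proof -
    obtain w where w: "w \<bullet> w = 1" "v \<bullet> w = 0" using unit_orthogonal_exists[OF card] .
    \<comment> \<open>The height of the isosceles triangle with base \<open>v\<close> and legs of
      length \<open>2 * pi\<close>; its legs are the two full turns.\<close>
    define c where "c = sqrt ((2 * pi)\<^sup>2 - (norm v / 2)\<^sup>2)"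
    have "(norm v / 2)\<^sup>2 \<le> (2 * pi)\<^sup>2" using v by (intro power_mono) auto
    then have c: "c * c = (2 * pi)\<^sup>2 - (norm v / 2)\<^sup>2" by (simp add: c_def flip: power2_eq_square)
    have vv: "v \<bullet> v = 4 * (norm v / 2)\<^sup>2" by (simp add: dot_square_norm power_divide)
    have n: "norm ((1 / 2) *\<^sub>R v + s *\<^sub>R w) = 2 * pi" if "s * s = c * c" for s
    proof -
      have "((1 / 2) *\<^sub>R v + s *\<^sub>R w) \<bullet> ((1 / 2) *\<^sub>R v + s *\<^sub>R w) = (v \<bullet> v) / 4 + s * s"
        using w by (simp add: inner_add_left inner_add_right inner_commute[of w v])
      also have "\<dots> = (2 * pi)\<^sup>2" using that c vv by simp
      finally show ?thesis by (simp add: norm_eq_sqrt_inner real_sqrt_mult)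
    qed
    have "rolls (mat 1 ** mat 1) (((1 / 2) *\<^sub>R v + c *\<^sub>R w) + ((1 / 2) *\<^sub>R v + (- c) *\<^sub>R w))"
      by (intro rolls_mult rolls_full_turn n) auto
    moreover have "((1 / 2) *\<^sub>R v + c *\<^sub>R w) + ((1 / 2) *\<^sub>R v + (- c) *\<^sub>R w) = v"
      by (simp flip: scaleR_add_left add: algebra_simps)
    ultimately show ?thesis by simp
  qed
  \<comment> \<open>A long vector is cut into \<open>N\<close> equal pieces, each short enough for
    two full turns.\<close>
  obtain N :: nat where N: "norm v < real N" using reals_Archimedean2 by blast
  then have "N > 0" using norm_ge_zero[of v] by (cases N) auto
  have "norm (v /\<^sub>R N) \<le> 1" using N \<open>N > 0\<close> by (simp add: field_simps)
  also have "1 \<le> 4 * pi" using pi_gt3 by simp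
  finally have small: "norm (v /\<^sub>R N) \<le> 4 * pi" .
  have "rolls (mat 1) (real k *\<^sub>R (v /\<^sub>R N))" for k
  proof (induction k)
    case (Suc k)
    from rolls_mult[OF Suc short[OF small]] show ?case by (simp add: algebra_simps)
  qed (simp add: short)
  from this[of N] show ?thesis using \<open>N > 0\<close> by simp
qed

text \<open>A straight rolling produces the rotation, and a pure translation then undoes its
  displacement. Rolling takes positive time, so the angle is first made positive by adding full
  turns.\<close>

lemma rolls_rotation:
  fixes u :: "real^'n::finite"
  assumes card: "2 \<le> CARD('n)" and u: "u \<bullet> u = 1"
  shows "rolls (plane_rotation (embed u) e0 t) 0"
proof -
  obtain k :: nat where k: "- t / (2 * pi) < real k" using reals_Archimedean2 by blast
  have per: "plane_rotation (embed u) e0 (t + real k * (2 * pi)) = plane_rotation (embed u) e0 t"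
  proof (induction k)
    case (Suc k)
    then show ?case
      using plane_rotation_periodic[of "embed u" e0 "t + real k * (2 * pi)"] by (simp add: algebra_simps)
  qed simp
  have "0 < t + real k * (2 * pi)" using k by (simp add: field_simps)
  from rolls_mult[OF rolls_straight[OF u this] rolls_translation[OF card, of "- ((t + real k * (2 * pi)) *\<^sub>R u)"]]
  show ?thesis by (simp add: per)
qed

lemma rolls_mult_0: "rolls g 0 \<Longrightarrow> rolls h 0 \<Longrightarrow> rolls (h ** g) 0"
  using rolls_mult[of g 0 h 0] by simp

lemma plane_rotation_first: "a \<bullet> a = 1 \<Longrightarrow> a \<bullet> b = 0 \<Longrightarrow> plane_rotation a b \<theta> *v a = cos \<theta> *\<^sub>R a + sin \<theta> *\<^sub>R b"
  by (simp add: plane_rotation_mult_vec inner_commute[of b a] algebra_simps)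

lemma plane_rotation_fix: "a \<bullet> z = 0 \<Longrightarrow> b \<bullet> z = 0 \<Longrightarrow> plane_rotation a b \<theta> *v z = z"
  by (simp add: plane_rotation_mult_vec)

lemma rolls_plane_rotation_e0:
  fixes b :: "real^('n::finite option)"
  assumes card: "2 \<le> CARD('n)" and "b \<bullet> b = 1" "b \<bullet> e0 = 0"
  shows "rolls (plane_rotation b e0 t) 0"
proof -
  have "embed (\<chi> i. b $ Some i) = b" using assms(3) by (rule embed_drop)
  then show ?thesis using rolls_rotation[OF card, of "\<chi> i. b $ Some i" t] assms(2)
    by (metis embed_inner(1))
qed

text \<open>Rotations in planes orthogonal to \<open>e0\<close> are conjugate to the available ones by a quarter turn.\<close>

lemma rolls_plane_rotation:
  fixes a b :: "real^('n::finite option)"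
  assumes card: "2 \<le> CARD('n)" and a: "a \<bullet> a = 1" "a \<bullet> e0 = 0"
    and b: "b \<bullet> b = 1" "b \<bullet> e0 = 0" and ab: "a \<bullet> b = 0"
  shows "rolls (plane_rotation a b \<theta>) 0"
proof -
  let ?K = "plane_rotation e0 a (pi / 2)"
  have e0: "e0 \<bullet> a = 0" "e0 \<bullet> b = 0" "e0 \<bullet> (e0 :: real^('n option)) = 1" using a b by (simp_all add: inner_commute)
  have "orthogonal_matrix ?K"
    using rotation_matrix_plane_rotation[OF e0(3) a(1) e0(1)] by (simp add: rotation_matrix_def)
  then have "?K ** plane_rotation e0 b \<theta> ** transpose ?K = plane_rotation (?K *v e0) (?K *v b) \<theta>"
    by (rule plane_rotation_conjugate)
  also have "?K *v e0 = a" using plane_rotation_first[of e0 a "pi / 2"] e0 by simp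
  also have "?K *v b = b" by (rule plane_rotation_fix) (use e0 ab in auto)
  finally have "plane_rotation a b \<theta> = ?K ** plane_rotation e0 b \<theta> ** transpose ?K" by simp
  also have "\<dots> = plane_rotation a e0 (- (pi / 2)) ** plane_rotation b e0 (- \<theta>) ** plane_rotation a e0 (pi / 2)"
    by (simp add: transpose_plane_rotation plane_rotation_swap[of a e0] plane_rotation_swap[of b e0])
  finally show ?thesis
    by (simp add: rolls_mult_0 rolls_plane_rotation_e0[OF card] a b)
qed

text \<open>
  Givens elimination: a plane rotation that moves one more basis vector to its place, starting with
  \<open>e0\<close>, reduces a rotation to one fixing more basis vectors.
\<close>

lemma rolls_all_rotations:
  fixes R :: "real^('n::finite option)^('n option)"
  assumes card: "2 \<le> CARD('n)" and "rotation_matrix R"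
  shows "rolls R 0"
  using assms(2)
proof (induction "card {i. R *v axis i 1 \<noteq> axis i 1}" arbitrary: R rule: less_induct)
  case less
  let ?F = "{i. R *v axis i 1 = axis i 1}"
  have iso: "(R *v v) \<bullet> (R *v w) = v \<bullet> w" for v w
    using rotation_matrixD(2)[OF less.prems]
    by (metis inner_transpose_matrix_vector matrix_vector_mul_assoc matrix_vector_mul_lid inner_commute)
  show ?case
  proof (cases "?F = UNIV")
    case True
    have "R $ r $ s = mat 1 $ r $ s" for r s
    proof -
      have "s \<in> ?F" unfolding True ..
      have "R $ r $ s = (R *v axis s 1) $ r" by (simp add: matrix_vector_mul_component inner_axis)
      also have "\<dots> = axis s 1 $ r" using \<open>s \<in> ?F\<close> by simp
      finally show ?thesis by (simp add: mat_def axis_def)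
    qed
    then have "R = mat 1" by (simp add: vec_eq_iff)
    then show ?thesis using rolls_translation[OF card, of 0] by simp
  next
    case False
    \<comment> \<open>\<open>e0\<close> comes first: once it is fixed, every later rotation takes
      place in a plane orthogonal to it, as \<open>rolls_plane_rotation\<close> demands.\<close>
    obtain i where i: "i \<notin> ?F" "i = None \<or> None \<in> ?F" using False by blast
    define v where "v = R *v axis i 1"
    have v: "v \<bullet> v = 1" "v \<noteq> axis i 1" using i(1) by (simp_all add: v_def iso inner_axis_axis)
    have vF: "v \<bullet> axis s 1 = 0" if "s \<in> ?F" for s
    proof -
      have "v \<bullet> axis s 1 = (R *v axis i 1) \<bullet> (R *v axis s 1)" using that by (simp add: v_def)
      also have "\<dots> = 0" unfolding iso using that i(1) by (auto simp: inner_axis_axis)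
      finally show ?thesis .
    qed
    \<comment> \<open>The image \<open>v\<close> is reached from \<open>axis i 1\<close> by turning
      towards some \<open>b\<close>. Since \<open>b\<close> is orthogonal to all basis vectors fixed
      so far, the rotation does not disturb them.\<close>
    obtain b \<theta> where b: "b \<bullet> b = 1" "axis i 1 \<bullet> b = 0" "v = cos \<theta> *\<^sub>R axis i 1 + sin \<theta> *\<^sub>R b"
      and bF: "\<And>s. s \<in> ?F \<Longrightarrow> b \<bullet> axis s 1 = 0"
    proof -
      define c where "c = v \<bullet> axis i 1"
      define w where "w = v - c *\<^sub>R axis i 1"
      have ww: "w \<bullet> w = 1 - c\<^sup>2"
        by (simp add: w_def inner_diff_left inner_diff_right v inner_axis_axis inner_commute[of "axis i 1" v]
            c_def[symmetric] power2_eq_square)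
      have wi: "axis i 1 \<bullet> w = 0"
        by (simp add: w_def inner_diff_right inner_axis_axis c_def inner_commute)
      show thesis
      proof (cases "w = 0")
        case False
        have "c\<^sup>2 + (norm w)\<^sup>2 = 1" using ww by (simp add: dot_square_norm)
        then obtain \<theta> where \<theta>: "c = cos \<theta>" "norm w = sin \<theta>" using sincos_total_2pi by metis
        show thesis
        proof (rule that[of "w /\<^sub>R norm w" \<theta>])
          show "v = cos \<theta> *\<^sub>R axis i 1 + sin \<theta> *\<^sub>R (w /\<^sub>R norm w)"
            using False by (simp add: w_def flip: \<theta>)
          show "(w /\<^sub>R norm w) \<bullet> axis s 1 = 0" if "s \<in> ?F" for s
          proof -
            have "axis i 1 \<bullet> (axis s 1 :: real^('n option)) = 0"
              using that i(1) by (auto simp: inner_axis_axis)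
            then show ?thesis by (simp add: w_def inner_diff_left vF[OF that])
          qed
        qed (use False wi in \<open>auto simp: dot_square_norm power2_eq_square\<close>)
      next
        case True
        then have "c\<^sup>2 = 1" "v = c *\<^sub>R axis i 1" using ww by (simp_all add: w_def)
        then have vi: "v = - axis i 1" using v(2) by (auto simp: power2_eq_1_iff)
        \<comment> \<open>A half turn takes \<open>axis i 1\<close> to its negative and needs a
          second direction that is not yet fixed. If there were none, \<open>R\<close> would be a
          reflection with determinant \<open>-1\<close>.\<close>
        have "\<exists>j. j \<noteq> i \<and> j \<notin> ?F"
        proof (rule ccontr)
          assume "\<not> ?thesis"
          then have Rs: "R *v axis s 1 = (if s = i then - axis s 1 else axis s 1)" for s
            using vi v_def by auto
          have entries: "R $ r $ s = (if r = s then if s = i then - 1 else 1 else 0)" for r s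
          proof -
            have "R $ r $ s = (R *v axis s 1) $ r" by (simp add: matrix_vector_mul_component inner_axis)
            also have "\<dots> = (if s = i then - axis s 1 else axis s 1) $ r" by (simp only: Rs)
            finally show ?thesis by (simp add: axis_def)
          qed
          have "det R = (\<Prod>s\<in>UNIV. R $ s $ s)" by (rule det_diagonal) (simp add: entries)
          also have "\<dots> = -1" by (simp add: entries)
          finally show False using less.prems by (simp add: rotation_matrix_def)
        qed
        then obtain j where j: "j \<noteq> i" "j \<notin> ?F" by blast
        show thesis
        proof (rule that[of "axis j 1" pi])
          show "axis j 1 \<bullet> (axis s 1 :: real^('n option)) = 0" if "s \<in> ?F" for s
            using that j by (auto simp: inner_axis_axis)
        qed (use j vi in \<open>auto simp: inner_axis_axis\<close>)
      qed
    qed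
    define h where "h = plane_rotation (axis i 1) b \<theta>"
    have ii: "axis i 1 \<bullet> (axis i 1 :: real^('n option)) = 1" by (simp add: inner_axis_axis)
    have hrot: "rotation_matrix h" unfolding h_def by (rule rotation_matrix_plane_rotation[OF ii b(1,2)])
    have hi: "h *v axis i 1 = v" unfolding h_def b(3) by (rule plane_rotation_first[OF ii b(2)])
    have rolls_h: "rolls h 0"
    proof (cases "i = None")
      case True
      have "h = plane_rotation b e0 (- \<theta>)" using plane_rotation_swap[of b e0 "- \<theta>"] by (simp add: h_def True)
      then show ?thesis using rolls_plane_rotation_e0[OF card b(1)] b(2) True by (simp add: inner_commute)
    next
      case False
      then have "None \<in> ?F" using i(2) by blast
      then show ?thesis
        unfolding h_def using False by (intro rolls_plane_rotation[OF card ii _ b(1) bF b(2)]) (auto simp: inner_axis_axis)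
    qed
    define R' where "R' = transpose h ** R"
    have R: "R = h ** R'"
      unfolding R'_def using rotation_matrixD(1)[OF hrot] by (simp add: matrix_mul_assoc)
    have "R' *v axis i 1 = axis i 1"
    proof -
      have "R' *v axis i 1 = transpose h *v (h *v axis i 1)"
        by (simp add: R'_def hi v_def matrix_vector_mul_assoc del: transpose_matrix_vector)
      then show ?thesis
        using rotation_matrixD(2)[OF hrot] by (simp add: matrix_vector_mul_assoc del: transpose_matrix_vector)
    qed
    moreover have "R' *v axis s 1 = axis s 1" if "s \<in> ?F" for s
    proof -
      have "transpose h *v axis s 1 = axis s 1"
        unfolding h_def transpose_plane_rotation
        by (rule plane_rotation_fix) (use that i(1) bF in \<open>auto simp: inner_axis_axis\<close>)
      moreover have "R' *v axis s 1 = transpose h *v (R *v axis s 1)"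
        by (simp add: R'_def matrix_vector_mul_assoc del: transpose_matrix_vector)
      ultimately show ?thesis using that by simp
    qed
    ultimately have "{s. R' *v axis s 1 \<noteq> axis s 1} \<subset> {s. R *v axis s 1 \<noteq> axis s 1}"
      using i(1) by blast
    then have "card {s. R' *v axis s 1 \<noteq> axis s 1} < card {s. R *v axis s 1 \<noteq> axis s 1}"
      by (intro psubset_card_mono) simp_all
    moreover have "rotation_matrix R'"
      unfolding R'_def by (intro rotation_matrix_mult rotation_matrix_transpose hrot less.prems)
    ultimately have "rolls R' 0" by (rule less.hyps)
    then show ?thesis unfolding R by (rule rolls_mult_0[OF _ rolls_h])
  qed
qed

text \<open>Displacements act alike at all configurations, so a single one suffices: the translation
  between the contact points combined with the rotation between the frames.\<close>

lemma completely_controllable_rolling: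
  assumes card: "2 \<le> CARD('n::finite)"
  shows "completely_controllable (sphere 0 1 :: (real^('n option)) set) sphere_orientation
    UNIV (euclidean_orientation :: ('n, 'n) orientation)"
  unfolding completely_controllable_def
proof (intro ballI)
  fix p q :: "('n option, 'n) config" assume p: "p \<in> rolling_space" and q: "q \<in> rolling_space"
  let ?g = "frm q ** transpose (frm p)" and ?v = "fst (snd q) - fst (snd p)"
  have "rotation_matrix ?g"
    using p q by (simp add: rolling_space_iff rotation_matrix_mult rotation_matrix_transpose)
  from rolls_mult[OF rolls_translation[OF card] rolls_all_rotations[OF card this]]
  have "rolls ?g ?v" by (metis add.right_neutral matrix_mul_rid)
  then have "rolling_reachable (cfg (fst (snd p)) (frm p)) (cfg (fst (snd p) + ?v) (?g ** frm p))"
    using p unfolding rolls_def rolling_space_iff by blast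
  moreover have "?g ** frm p = frm q"
    using p unfolding matrix_mul_assoc[symmetric] by (simp add: rolling_space_iff rotation_matrixD)
  ultimately obtain \<tau> c where arc: "rolling_arc \<tau> c" "c 0 = p" "c \<tau> = q"
    unfolding rolling_reachable_def by auto
  moreover from arc have "0 < \<tau>" by (simp add: rolling_arc_def)
  ultimately show "\<exists>\<tau>>0. \<exists>c. intrinsic_rolling (sphere 0 1) sphere_orientation UNIV
      (euclidean_orientation :: ('n, 'n) orientation) \<tau> c \<and> c 0 = p \<and> c \<tau> = q"
    using rolling_arc_intrinsic_rolling by blast
qed

theorem mainTheorem7:
  fixes Q :: "('n::{finite,linorder} option, 'n) config set"
    and D :: "('n option, 'n) config \<Rightarrow> ('n option, 'n) config set"
  assumes "2 \<le> CARD('n)"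
    and "Q = config_space (sphere 0 1) sphere_orientation UNIV
               (euclidean_orientation :: ('n, 'n) orientation)"
    and "D = rolling_distribution (sphere 0 1) sphere_orientation UNIV
               (euclidean_orientation :: ('n, 'n) orientation)"
  shows "smooth_distribution Q D CARD('n) \<and>
         regular_distribution Q D \<and>
         bracket_generating Q D \<and>
         has_step Q D 3 \<and>
         completely_controllable (sphere 0 1 :: (real^'n option) set) sphere_orientation
           UNIV (euclidean_orientation :: ('n, 'n) orientation)"
proof -
  interpret rolling_flag D
    by unfold_locales (simp_all add: assms(1,3) rolling_distribution_eq)
  show ?thesis
    unfolding assms(2)
    using smooth_distribution regular bracket_generating has_step_3
      completely_controllable_rolling[OF assms(1)] by blast
qed

end
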